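(* Assume the Riemann hypothesis. Then for every arbitrarily large fixed $A\geqslant 1$ there exist constants $T_{0},c_{0}$ and $h$, depending only on $A$, such that for every $T\geqslant T_{0}$, with $H=\frac{1}{\pi}\ln\ln\ln T+c_{0}$, \[ \min_{|t-T|\leqslant H}\bigl(S(t+h)-S(t-h)\bigr)<-A. \]
   Context: $S(t)=\frac{1}{\pi}\arg\zeta(0.5+it)$: for $t$ not the ordinate of a zero of $\zeta$, the argument is obtained by continuous variation along the horizontal half-line $\{\sigma+it:\sigma\geqslant 0.5\}$ starting from the value $0$ at $\sigma=+\infty$; at ordinates of zeros, $S(t)=\frac12(S(t+0)+S(t-0))$. *)

theory Defs
  imports "HOL-Complex_Analysis.Complex_Analysis"
begin

text \<open>
  The Riemann zeta function is the analytic continuation of the Dirichlet series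
  \<open>1 + 1/2\<^sup>s + 1/3\<^sup>s + \<dots>\<close> from \<open>Re s > 1\<close> to the punctured plane. The value at the pole is
  fixed to \<open>0\<close> only to make the description unique; existence and uniqueness are proved in
  \<open>is_zeta_ex1\<close> below.
\<close>

definition is_zeta :: "(complex \<Rightarrow> complex) \<Rightarrow> bool" where
  "is_zeta f \<longleftrightarrow> f holomorphic_on (- {1}) \<and>
     (\<forall>s. Re s > 1 \<longrightarrow> f s = (\<Sum>n. 1 / of_nat (Suc n) powr s)) \<and> f 1 = 0"

definition zeta :: "complex \<Rightarrow> complex" where
  "zeta = (THE f. is_zeta f)"

definition riemann_hypothesis :: bool where
  "riemann_hypothesis \<longleftrightarrow>
     (\<forall>s. 0 < Re s \<and> Re s < 1 \<and> zeta s = 0 \<longrightarrow> Re s = 1 / 2)"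

text \<open>
  The ordinate \<open>0\<close> of the pole is also the ordinate of the zeros \<open>-2, -4, \<dots>\<close>, so the horizontal
  half-lines used to define the argument never meet the pole.
\<close>

definition zeta_zero_ordinate :: "real \<Rightarrow> bool" where
  "zeta_zero_ordinate t \<longleftrightarrow> (\<exists>s. zeta s = 0 \<and> Im s = t)"

text \<open>
  \<open>is_arg_zeta t \<theta>\<close>: \<open>\<theta> \<sigma>\<close> is the argument of \<open>\<zeta>(\<sigma> + it)\<close>, \<open>\<sigma> \<ge> 1/2\<close>, obtained by
  continuous variation from the value \<open>0\<close> at \<open>\<sigma> = +\<infinity>\<close>.
\<close>

definition is_arg_zeta :: "real \<Rightarrow> (real \<Rightarrow> real) \<Rightarrow> bool" where
  "is_arg_zeta t \<theta> \<longleftrightarrow>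
     continuous_on {1 / 2..} \<theta> \<and>
     (\<forall>\<sigma>\<ge>1 / 2. zeta (Complex \<sigma> t) = of_real (cmod (zeta (Complex \<sigma> t))) * cis (\<theta> \<sigma>)) \<and>
     (\<theta> \<longlongrightarrow> 0) at_top"

definition S_regular :: "real \<Rightarrow> real" where
  "S_regular t = (THE x. \<exists>\<theta>. is_arg_zeta t \<theta> \<and> x = \<theta> (1 / 2) / pi)"

text \<open>
  Ordinates of zeros are isolated, so the one-sided limits \<open>S(t \<plusminus> 0)\<close> only involve
  values of \<open>S\<close> at points that are not ordinates of zeros.
\<close>

definition S :: "real \<Rightarrow> real" where
  "S t = (if zeta_zero_ordinate t
          then (Lim (at_right t) S_regular + Lim (at_left t) S_regular) / 2
          else S_regular t)"

subsection \<open>Existence and uniqueness of the analytic continuation\<close>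

definition ffact :: "nat \<Rightarrow> complex \<Rightarrow> complex" where
  "ffact j a = (\<Prod>k<j. a - of_nat k)"

lemma ffact_holomorphic: "f holomorphic_on A \<Longrightarrow> (\<lambda>s. ffact j (f s)) holomorphic_on A"
  unfolding ffact_def by (intro holomorphic_intros)

lemma norm_ffact_le: "cmod a \<le> R \<Longrightarrow> cmod (ffact j a) \<le> (R + real j) ^ j"
proof -
  assume a: "cmod a \<le> R"
  have "cmod (ffact j a) = (\<Prod>k<j. cmod (a - of_nat k))"
    by (simp add: ffact_def prod_norm)
  also have "\<dots> \<le> (\<Prod>k<j. R + real j)"
  proof (intro prod_mono conjI)
    fix k assume "k \<in> {..<j}"
    then have "cmod (a - of_nat k) \<le> cmod a + real k" "real k \<le> real j"
      using norm_triangle_ineq4[of a "of_nat k"] by auto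
    with a show "cmod (a - of_nat k) \<le> R + real j" by linarith
  qed auto
  finally show ?thesis by simp
qed

lemma binomial_remainder:
  assumes a: "cmod a \<le> R" and x: "0 \<le> x" "x \<le> 1"
  shows "cmod ((1 + of_real x) powr a - (\<Sum>j\<le>N. ffact j a / fact j * of_real x ^ j))
           \<le> (R + real (Suc N)) ^ Suc N * 2 powr R * x ^ Suc N"
proof -
  define f where "f = (\<lambda>i z. ffact i a * (1 + z) powr (a - of_nat i))"
  define B where "B = (R + real (Suc N)) ^ Suc N * 2 powr R"
  have R: "R \<ge> 0" using a norm_ge_zero order_trans by blast
  then have B0: "B \<ge> 0" by (simp add: B_def)
  let ?S = "complex_of_real ` {0..1}"
  have "cmod (f 0 (of_real x) - (\<Sum>i\<le>N. f i 0 * (of_real x - 0) ^ i / fact i))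
          \<le> B * cmod (of_real x - 0) ^ Suc N / fact N"
  proof (rule complex_Taylor[where S = ?S])
    show "convex ?S"
      by (intro convex_linear_image) (auto intro: linearI simp: scaleR_conv_of_real)
    show "(f i has_field_derivative f (Suc i) z) (at z within ?S)" if z: "z \<in> ?S" for i z
    proof -
      from z obtain y where y: "z = of_real y" "y \<ge> 0" by auto
      have "1 + z \<notin> \<real>\<^sub>\<le>\<^sub>0"
        using y by (auto simp: complex_nonpos_Reals_iff)
      then have "(f i has_field_derivative
          ffact i a * ((a - of_nat i) * (1 + z) powr (a - of_nat i - 1))) (at z within ?S)"
        unfolding f_def by (auto intro!: derivative_eq_intros)
      then show ?thesis
        by (simp add: f_def ffact_def algebra_simps)
    qed
    show "cmod (f (Suc N) z) \<le> B" if z: "z \<in> ?S" for z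
    proof -
      from z obtain y where y: "z = of_real y" "y \<ge> 0" "y \<le> 1" by auto
      have eq: "1 + z = of_real (1 + y)" using y by simp
      have "cmod ((1 + z) powr (a - of_nat (Suc N))) = (1 + y) powr (Re a - real (Suc N))"
        unfolding eq by (subst norm_powr_real_powr) (use y in auto)
      also have "\<dots> \<le> (1 + y) powr R"
        using y a complex_Re_le_cmod[of a] by (intro powr_mono) auto
      also have "\<dots> \<le> 2 powr R"
        using y R by (intro powr_mono2) auto
      finally have 1: "cmod ((1 + z) powr (a - of_nat (Suc N))) \<le> 2 powr R" .
      show ?thesis
        unfolding f_def B_def norm_mult
        using R by (intro mult_mono 1 norm_ffact_le a) auto
    qed
    show "0 \<in> ?S" by (auto intro!: image_eqI[of _ _ 0])
    show "of_real x \<in> ?S" using x by auto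
  qed
  moreover have "B * cmod (of_real x - 0) ^ Suc N / fact N \<le> B * x ^ Suc N"
  proof -
    have "B * x ^ Suc N / fact N \<le> B * x ^ Suc N / 1"
      using B0 x by (intro divide_left_mono) (auto simp: fact_ge_1)
    then show ?thesis using x by simp
  qed
  ultimately show ?thesis
    by (simp add: f_def B_def ffact_def mult.commute mult.left_commute)
qed

lemma suminf_holomorphic:
  fixes f :: "nat \<Rightarrow> complex \<Rightarrow> complex"
  assumes S: "open A" and hol: "\<And>n. f n holomorphic_on A"
    and bd: "\<And>x. x \<in> A \<Longrightarrow>
      \<exists>d h. 0 < d \<and> summable h \<and> (\<forall>n. \<forall>y\<in>ball x d \<inter> A. norm (f n y) \<le> h n)"
  shows "(\<lambda>s. \<Sum>n. f n s) holomorphic_on A" "\<And>s. s \<in> A \<Longrightarrow> summable (\<lambda>n. f n s)"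
proof -
  have "\<exists>g g'. \<forall>x\<in>A. ((\<lambda>n. f n x) sums g x) \<and> ((\<lambda>n. deriv (f n) x) sums g' x) \<and>
      (g has_field_derivative g' x) (at x)"
  proof (rule series_and_derivative_comparison_local[OF S])
    show "(f n has_field_derivative deriv (f n) x) (at x)" if "x \<in> A" for n x
      using holomorphic_derivI[OF hol S that] .
    show "\<exists>d h. 0 < d \<and> summable h \<and>
        (\<forall>\<^sub>F n in sequentially. \<forall>y\<in>ball x d \<inter> A. norm (f n y) \<le> h n)" if x: "x \<in> A" for x
    proof -
      obtain d h where "0 < d" "summable h" "\<forall>n. \<forall>y\<in>ball x d \<inter> A. norm (f n y) \<le> h n"
        using bd[OF x] by blast
      then show ?thesis by (intro exI[of _ d] exI[of _ h]) auto
    qed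
  qed
  then obtain g g' where g: "\<And>x. x \<in> A \<Longrightarrow> (\<lambda>n. f n x) sums g x"
    "\<And>x. x \<in> A \<Longrightarrow> (g has_field_derivative g' x) (at x)" by blast
  then have "g holomorphic_on A"
    by (auto simp: holomorphic_on_open[OF S])
  then show "(\<lambda>s. \<Sum>n. f n s) holomorphic_on A"
    by (rule holomorphic_transform) (use g(1) sums_unique in blast)
  show "summable (\<lambda>n. f n s)" if "s \<in> A" for s
    using g(1)[OF that] by (rule sums_summable)
qed

lemma summable_Suc_powr: "s < -1 \<Longrightarrow> summable (\<lambda>n. real (Suc n) powr s)"
  using summable_real_powr_iff[of s] summable_Suc_iff[of "\<lambda>n. real n powr s"] by simp

definition dseries :: "complex \<Rightarrow> complex" where
  "dseries s = (\<Sum>n. 1 / of_nat (Suc n) powr s)"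

definition zrem :: "nat \<Rightarrow> nat \<Rightarrow> complex \<Rightarrow> complex" where
  "zrem N n s = of_nat (Suc n) powr (1 - s) *
     ((1 + of_real (1 / real (Suc n))) powr (1 - s)
        - (\<Sum>j\<le>N. ffact j (1 - s) / fact j * of_real (1 / real (Suc n)) ^ j))"

lemma norm_of_nat_Suc_powr: "cmod (of_nat (Suc n) powr s) = real (Suc n) powr Re s"
proof -
  have "of_nat (Suc n) = complex_of_real (real (Suc n))" by simp
  then show ?thesis by (simp only: norm_powr_real_powr of_nat_0_le_iff) (simp add: norm_powr_real_powr)
qed

lemma open_half: "open {s::complex. Re s > c}"
  by (rule open_halfspace_Re_gt)

lemma zrem_sum:
  shows "(\<lambda>s. \<Sum>n. zrem N n s) holomorphic_on {s. Re s > 1 - real N}"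
    and "Re s > 1 - real N \<Longrightarrow> summable (\<lambda>n. zrem N n s)"
proof -
  let ?A = "{s. Re s > 1 - real N}"
  have hol: "zrem N n holomorphic_on ?A" for n
  proof -
    have "1 + complex_of_real (1 / real (Suc n)) \<noteq> 0"
      by (metis add_pos_pos less_irrefl of_nat_0_less_iff of_real_1 of_real_add of_real_eq_0_iff
          zero_less_Suc zero_less_divide_1_iff zero_less_one)
    then show ?thesis
      unfolding zrem_def by (intro holomorphic_intros ffact_holomorphic) auto
  qed
  have bd: "\<exists>d h. 0 < d \<and> summable h \<and> (\<forall>n. \<forall>y\<in>ball s d \<inter> ?A. norm (zrem N n y) \<le> h n)"
    if s: "s \<in> ?A" for s
  proof -
    define d where "d = (Re s - (1 - real N)) / 2"
    have d: "d > 0" using s by (simp add: d_def)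
    define R where "R = cmod (1 - s) + d"
    define C where "C = (R + real (Suc N)) ^ Suc N * 2 powr R"
    have C: "C \<ge> 0" using d by (simp add: C_def R_def)
    define e where "e = d - Re s - real N"
    have "e < -1" using s by (simp add: e_def d_def field_simps)
    then have sm: "summable (\<lambda>n. C * real (Suc n) powr e)"
      by (intro summable_mult summable_Suc_powr)
    have "cmod (zrem N n y) \<le> C * real (Suc n) powr e" if y: "y \<in> ball s d" for n y
    proof -
      have "cmod (1 - y) \<le> cmod (1 - s) + cmod (s - y)"
        using norm_triangle_ineq[of "1 - s" "s - y"] by simp
      then have R: "cmod (1 - y) \<le> R" using y by (simp add: R_def dist_norm)
      have "\<bar>Re (s - y)\<bar> \<le> cmod (s - y)" by (rule abs_Re_le_cmod)
      then have re: "Re s - d \<le> Re y" using y by (simp add: dist_norm)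
      have "cmod (zrem N n y) \<le> real (Suc n) powr (1 - Re y) * (C * (1 / real (Suc n)) ^ Suc N)"
        unfolding zrem_def norm_mult norm_of_nat_Suc_powr C_def
        using binomial_remainder[OF R, of "1 / real (Suc n)" N]
        by (intro mult_mono) auto
      also have "(1 / real (Suc n)) ^ Suc N = real (Suc n) powr (- real (Suc N))"
        by (simp only: powr_minus powr_realpow of_nat_0_less_iff zero_less_Suc)
           (simp add: power_one_over inverse_eq_divide)
      also have "real (Suc n) powr (1 - Re y) * (C * real (Suc n) powr (- real (Suc N)))
          = C * real (Suc n) powr (- Re y - real N)"
        by (simp add: powr_add[symmetric] algebra_simps)
      also have "\<dots> \<le> C * real (Suc n) powr e"
        using re C by (intro mult_left_mono powr_mono) (auto simp: e_def)
      finally show ?thesis .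
    qed
    then show ?thesis using d sm by blast
  qed
  show "(\<lambda>s. \<Sum>n. zrem N n s) holomorphic_on ?A"
    by (rule suminf_holomorphic(1)[OF open_half hol bd])
  show "Re s > 1 - real N \<Longrightarrow> summable (\<lambda>n. zrem N n s)"
    using suminf_holomorphic(2)[OF open_half hol bd] by blast
qed

lemma dseries_term: "1 / of_nat (Suc n) powr s = of_nat (Suc n) powr (- s :: complex)"
  by (simp add: powr_minus divide_inverse)

lemma dseries:
  shows "dseries holomorphic_on {s. Re s > 1}"
    and "Re s > 1 \<Longrightarrow> (\<lambda>n. of_nat (Suc n) powr (- s)) sums dseries s"
proof -
  let ?f = "\<lambda>n s. of_nat (Suc n) powr (- s) :: complex"
  let ?A = "{s. Re s > 1}"
  have hol: "?f n holomorphic_on ?A" for n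
    by (intro holomorphic_intros)
  have bd: "\<exists>d h. 0 < d \<and> summable h \<and> (\<forall>n. \<forall>y\<in>ball s d \<inter> ?A. norm (?f n y) \<le> h n)"
    if s: "s \<in> ?A" for s
  proof -
    define d where "d = (Re s - 1) / 2"
    have d: "d > 0" using s by (simp add: d_def)
    have sm: "summable (\<lambda>n. real (Suc n) powr (d - Re s))"
      by (intro summable_Suc_powr) (use s in \<open>simp add: d_def field_simps\<close>)
    have "cmod (?f n y) \<le> real (Suc n) powr (d - Re s)" if y: "y \<in> ball s d" for n y
    proof -
      have "\<bar>Re (s - y)\<bar> \<le> cmod (s - y)" by (rule abs_Re_le_cmod)
      then have "Re s - d \<le> Re y" using y by (simp add: dist_norm)
      then show ?thesis
        unfolding norm_of_nat_Suc_powr by (intro powr_mono) auto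
    qed
    then show ?thesis using d sm by blast
  qed
  have eq: "dseries = (\<lambda>s. \<Sum>n. ?f n s)"
    by (simp only: dseries_def[abs_def] dseries_term)
  show "dseries holomorphic_on ?A"
    unfolding eq by (rule suminf_holomorphic(1)[OF open_half hol bd])
  show "Re s > 1 \<Longrightarrow> (\<lambda>n. of_nat (Suc n) powr (- s)) sums dseries s"
    unfolding eq using suminf_holomorphic(2)[OF open_half hol bd] by blast
qed

lemma zrem_eq:
  "zrem N n s = of_nat (Suc (Suc n)) powr (1 - s) - of_nat (Suc n) powr (1 - s)
     - (\<Sum>j=1..N. ffact j (1 - s) / fact j * of_nat (Suc n) powr (- (s + of_nat j - 1)))"
proof -
  have p1: "of_nat (Suc n) powr (1 - s) * (1 + of_real (1 / real (Suc n))) powr (1 - s)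
      = of_nat (Suc (Suc n)) powr (1 - s)"
  proof -
    have "complex_of_real (real (Suc n)) powr (1 - s) * of_real (1 + 1 / real (Suc n)) powr (1 - s)
        = (of_real (real (Suc n)) * of_real (1 + 1 / real (Suc n))) powr (1 - s)"
      by (rule powr_times_real[symmetric]) auto
    also have "complex_of_real (real (Suc n)) * of_real (1 + 1 / real (Suc n))
        = of_real (real (Suc (Suc n)))"
      unfolding of_real_mult[symmetric] by (intro arg_cong[of _ _ of_real]) (simp add: field_simps)
    finally show ?thesis by simp
  qed
  have p2: "of_nat (Suc n) powr (1 - s) * (c * of_real (1 / real (Suc n)) ^ j)
      = c * of_nat (Suc n) powr (- (s + of_nat j - 1))" for c j
  proof -
    have nz: "of_nat (Suc n) \<noteq> (0::complex)" by (simp del: of_nat_Suc)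
    have "- (s + of_nat j - 1) = (1 - s) + (- of_nat j)" by simp
    then have "of_nat (Suc n) powr (- (s + of_nat j - 1))
        = of_nat (Suc n) powr (1 - s) * of_nat (Suc n) powr (- of_nat j :: complex)"
      by (simp only: powr_add)
    also have "of_nat (Suc n) powr (- of_nat j :: complex) = of_real (1 / real (Suc n)) ^ j"
      using nz by (simp add: powr_minus powr_nat' power_one_over inverse_eq_divide del: of_nat_Suc)
    finally show ?thesis by simp
  qed
  have "zrem N n s = of_nat (Suc (Suc n)) powr (1 - s)
      - (\<Sum>j\<le>N. ffact j (1 - s) / fact j * of_nat (Suc n) powr (- (s + of_nat j - 1)))"
    unfolding zrem_def right_diff_distrib p1 sum_distrib_left p2 ..
  also have "{..N} = insert 0 {1..N}" by auto
  finally show ?thesis by (simp add: ffact_def algebra_simps)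
qed

lemma zrem_dseries:
  assumes s: "Re s > 1"
  shows "(\<Sum>n. zrem N n s) = - 1 - (\<Sum>j=1..N. ffact j (1 - s) / fact j * dseries (s + of_nat j - 1))"
proof -
  have "(\<lambda>n. of_nat (Suc n) powr (1 - s) :: complex) \<longlonglongrightarrow> 0"
  proof (rule tendsto_norm_zero_cancel)
    have "(\<lambda>n. real (Suc n) powr (1 - Re s)) \<longlonglongrightarrow> 0"
      by (rule tendsto_neg_powr[OF _ filterlim_compose[OF filterlim_real_sequentially filterlim_Suc]])
         (use s in auto)
    then show "(\<lambda>n. cmod (of_nat (Suc n) powr (1 - s))) \<longlonglongrightarrow> 0"
      by (simp only: norm_of_nat_Suc_powr minus_complex.sel one_complex.sel)
  qed
  from telescope_sums[OF this]
  have 1: "(\<lambda>n. of_nat (Suc (Suc n)) powr (1 - s) - of_nat (Suc n) powr (1 - s)) sums (- 1 :: complex)"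
    by simp
  have 2: "(\<lambda>n. \<Sum>j=1..N. ffact j (1 - s) / fact j * of_nat (Suc n) powr (- (s + of_nat j - 1)))
      sums (\<Sum>j=1..N. ffact j (1 - s) / fact j * dseries (s + of_nat j - 1))"
    by (intro sums_sum sums_mult dseries(2)) (use s in auto)
  from sums_diff[OF 1 2] show ?thesis
    unfolding zrem_eq[symmetric] by (rule sums_unique[symmetric])
qed

lemma continuation_step:
  "\<exists>f. f holomorphic_on {s. Re s > 1 - real k} \<and> (\<forall>s. Re s > 1 \<longrightarrow> f s = (s - 1) * dseries s)"
proof (induction k)
  case 0
  show ?case
    by (rule exI[of _ "\<lambda>s. (s - 1) * dseries s"]) (auto intro!: holomorphic_intros dseries(1))
next
  case (Suc k)
  then obtain f where f: "f holomorphic_on {s. Re s > 1 - real k}"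
    "\<And>s. Re s > 1 \<Longrightarrow> f s = (s - 1) * dseries s" by blast
  let ?A = "{s. Re s > 1 - real (Suc k)}"
  define g where "g = (\<lambda>s. 1 + (\<Sum>n. zrem (Suc k) n s)
      - (\<Sum>j=2..Suc k. ffact (j - 1) (1 - s) / fact j * f (s + of_nat j - 1)))"
  have "g holomorphic_on ?A"
    unfolding g_def
  proof (intro holomorphic_intros zrem_sum(1) ffact_holomorphic)
    fix j assume j: "j \<in> {2..Suc k}"
    have "(f \<circ> (\<lambda>s. s + of_nat j - 1)) holomorphic_on ?A"
      by (rule holomorphic_on_compose_gen[OF _ f(1)]) (use j in \<open>auto intro!: holomorphic_intros\<close>)
    then show "(\<lambda>s. f (s + of_nat j - 1)) holomorphic_on ?A" by (simp add: o_def)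
  qed auto
  moreover have "g s = (s - 1) * dseries s" if s: "Re s > 1" for s
  proof -
    have "ffact j (1 - s) / fact j * dseries (s + of_nat j - 1)
        = - (ffact (j - 1) (1 - s) / fact j * f (s + of_nat j - 1))"
      if j: "j \<in> {2..Suc k}" for j
    proof -
      have f': "f (s + of_nat j - 1) = (s + of_nat j - 2) * dseries (s + of_nat j - 1)"
        by (subst f(2)) (use s j in auto)
      obtain i where i: "j = Suc i" using j by (cases j) auto
      have "ffact j (1 - s) = - (ffact (j - 1) (1 - s) * (s + of_nat j - 2))"
        by (simp add: i ffact_def algebra_simps)
      then show ?thesis unfolding f' by simp
    qed
    then have "(\<Sum>j=2..Suc k. ffact j (1 - s) / fact j * dseries (s + of_nat j - 1))
        = - (\<Sum>j=2..Suc k. ffact (j - 1) (1 - s) / fact j * f (s + of_nat j - 1))"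
      by (simp add: sum_negf[symmetric])
    moreover have "{1..Suc k} = insert 1 {2..Suc k}" by auto
    ultimately have "(\<Sum>n. zrem (Suc k) n s) = - 1 - ((1 - s) * dseries s
        - (\<Sum>j=2..Suc k. ffact (j - 1) (1 - s) / fact j * f (s + of_nat j - 1)))"
      using zrem_dseries[OF s, of "Suc k"] by (simp add: ffact_def)
    then show ?thesis unfolding g_def by (simp add: algebra_simps)
  qed
  ultimately show ?case by blast
qed

lemma continuation_exists:
  "\<exists>F. F holomorphic_on UNIV \<and> (\<forall>s. Re s > 1 \<longrightarrow> F s = (s - 1) * dseries s)"
proof -
  define H where "H = (\<lambda>k::nat. {s::complex. Re s > 1 - real k})"
  obtain f where f: "\<And>k. f k holomorphic_on H k"
    "\<And>k s. Re s > 1 \<Longrightarrow> f k s = (s - 1) * dseries s"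
    using continuation_step unfolding H_def by metis
  have oH: "open (H k)" for k unfolding H_def by (rule open_half)
  have cH: "connected (H k)" for k
    unfolding H_def by (intro convex_connected convex_halfspace_Re_gt)
  have mono: "H k \<subseteq> H l" if "k \<le> l" for k l using that by (auto simp: H_def)
  have eq: "f k s = f l s" if kl: "k \<le> l" and s: "s \<in> H k" for k l s
  proof -
    have "f k s - f l s = 0"
    proof (rule analytic_continuation_open[of "H 0" "H k" "\<lambda>s. f k s - f l s" "\<lambda>_. 0"])
      have "(2::complex) \<in> H 0" by (simp add: H_def)
      then show "H 0 \<noteq> {}" by blast
      show "(\<lambda>s. f k s - f l s) holomorphic_on H k"
        using f(1)[of k] f(1)[of l] mono[OF kl] by (intro holomorphic_intros) (auto intro: holomorphic_on_subset)
      show "f k z - f l z = 0" if "z \<in> H 0" for z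
        using that f(2)[of z] by (simp add: H_def)
    qed (use oH cH mono s in auto)
    then show ?thesis by simp
  qed
  define m where "m = (\<lambda>s::complex. LEAST k. s \<in> H k)"
  have mH: "s \<in> H (m s)" for s
  proof -
    obtain k :: nat where "1 - Re s < real k" using reals_Archimedean2 by blast
    then have "s \<in> H k" by (simp add: H_def)
    then show ?thesis unfolding m_def by (rule LeastI)
  qed
  define F where "F = (\<lambda>s. f (m s) s)"
  have Ff: "F s = f k s" if "s \<in> H k" for k s
  proof -
    have "m s \<le> k" using that unfolding m_def by (rule Least_le)
    then show ?thesis unfolding F_def by (rule eq[OF _ mH])
  qed
  have "F holomorphic_on (\<Union>k\<in>UNIV. H k)"
    by (rule holomorphic_on_UN_open)
       (use oH Ff in \<open>auto intro: holomorphic_transform[OF f(1)]\<close>)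
  moreover have "(\<Union>k\<in>UNIV. H k) = UNIV" using mH by blast
  moreover have "F s = (s - 1) * dseries s" if "Re s > 1" for s
    using Ff[of s 0] f(2)[OF that] that by (simp add: H_def)
  ultimately show ?thesis by auto
qed

lemma is_zeta_ex1: "\<exists>!f. is_zeta f"
proof (rule ex_ex1I)
  obtain F where F: "F holomorphic_on UNIV" "\<And>s. Re s > 1 \<Longrightarrow> F s = (s - 1) * dseries s"
    using continuation_exists by blast
  define f where "f = (\<lambda>s. F s / (s - 1))"
  have "is_zeta f"
    unfolding is_zeta_def
  proof (intro conjI allI impI)
    show "f holomorphic_on - {1}"
      unfolding f_def by (intro holomorphic_intros holomorphic_on_subset[OF F(1)]) auto
    fix s :: complex assume s: "Re s > 1"
    then have "s \<noteq> 1" by auto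
    then show "f s = (\<Sum>n. 1 / of_nat (Suc n) powr s)"
      unfolding dseries_def[symmetric] f_def F(2)[OF s] by simp
  qed (simp add: f_def)
  then show "\<exists>f. is_zeta f" by blast
next
  fix f g assume f: "is_zeta f" and g: "is_zeta g"
  show "f = g"
  proof
    fix s :: complex
    show "f s = g s"
    proof (cases "s = 1")
      case True
      then show ?thesis using f g by (simp add: is_zeta_def)
    next
      case False
      show ?thesis
      proof (rule analytic_continuation_open[of "{s. Re s > 1}" "- {1}" f g])
        have "(2::complex) \<in> {s. Re s > 1}" by simp
        then show "{s::complex. Re s > 1} \<noteq> {}" by blast
        show "connected (- {1::complex})"
          by (rule connected_punctured_universe) simp
        show "f z = g z" if "z \<in> {s. Re s > 1}" for z
          using that f g by (simp add: is_zeta_def)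
      qed (use f g False in \<open>auto simp: is_zeta_def open_half\<close>)
    qed
  qed
qed

lemma is_zeta_zeta: "is_zeta zeta"
  unfolding zeta_def by (rule theI'[OF is_zeta_ex1])

end

theory Submission
  imports Defs "HOL-Number_Theory.Prime_Powers" "HOL-Probability.Sinc_Integral" "HOL-Real_Asymp.Real_Asymp"
begin

text \<open>
  Let \<open>K = \<phi> * \<phi>\<close> with \<open>\<phi>(v) = exp (- c (cosh 2\<pi>v + cosh \<pi>v))\<close>. Then \<open>K \<ge> 0\<close>, its Fourier transform
  \<open>K\<^sup>^ = (\<phi>\<^sup>^)\<^sup>2\<close> is nonnegative and \<open>O(exp (- x/2) / (1 + x\<^sup>2))\<close>, and \<open>K(u)\<close> is at most
  \<open>B exp (- c exp (\<pi> |u|))\<close>. This decay of \<open>K\<^sup>^\<close> is just enough to continue, under the Riemann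
  hypothesis, the identity obtained by integrating the Dirichlet series of \<open>log \<zeta>\<close> against \<open>K\<close> down
  to the critical line: up to \<open>O(1)\<close> and a term from the pole that vanishes as \<open>t \<rightarrow> \<infinity>\<close>, the average of
  \<open>\<pi> (S(t + u + h) - S(t + u - h))\<close> over \<open>u\<close> with weight \<open>K(u)\<close> is
  \<open>- 2 \<Sum> \<Lambda>(n) / (log n \<surd>n) sin (h log n) K\<^sup>^(log n) cos (t log n)\<close>.

  At an almost period \<open>t\<close> of the first \<open>n\<^sup>i\<^sup>t\<close> all the cosines are close to \<open>1\<close>; such \<open>t\<close> exist within a
  bounded distance of every \<open>T\<close>. Averaging the resulting sum over \<open>h\<close> with weight \<open>exp (- h)\<close> replaces
  \<open>sin (h log n)\<close> by the positive number \<open>log n / (1 + log\<^sup>2 n)\<close>. As \<open>c \<rightarrow> \<infinity>\<close> the transform \<open>K\<^sup>^\<close>, divided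
  by \<open>K\<^sup>^(0)\<close>, tends to \<open>1\<close> and the sum diverges because \<open>\<Sum> \<Lambda>(n) / (n log n)\<close> does. So some \<open>h\<close>
  makes the average smaller than \<open>- A\<close>.

  For \<open>|u|\<close> beyond \<open>\<pi>\<^sup>-\<^sup>1 log log log T + O(1)\<close> the weight \<open>K(u)\<close> is smaller than \<open>(log T)\<^sup>-\<^sup>2\<close>, so there it
  suffices that the increments of \<open>S\<close> are at least \<open>- O(log T)\<close>. This one-sided bound holds because the
  zeros lie on or to the left of the critical line and hence contribute positively to
  \<open>Re (\<zeta>'/\<zeta>)\<close> on its right.
\<close>

section \<open>Tools from complex analysis\<close>

text \<open>The constants in \<phi> balance two opposite demands. On the critical line the pole
  integrand, and in the same way the density of the Dirichlet terms, grows like exp (x/2), so the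
  transform of K has to decay like exp (- x/2), which asks for analyticity of K in a strip of
  half-width 1/2. The short window asks for K(u) of size exp (- c exp (pi |u|)). The function exp (-
  c cosh (pi u)) has both properties, but the sign of its transform is not evident, and the final
  sum needs nonnegative terms. Starting from frequency 2 pi, with a strip of half-width 1/4, and
  convolving with itself restores both rates and makes the transform a square; one integration by
  parts in each factor supplies the 1 / (1 + x^2).

  The order of choices matters: A determines the number N of terms, N determines c, these determine
  h, and only then come the almost-period bound l and the constants \<open>c0\<close> and
  \<open>T0\<close>. Nothing depends on T.

  Near the critical line log zeta is controlled uniformly in \<sigma> from one side only, so the
  limit \<sigma> \<rightarrow> 1/2 can only yield an inequality; this is the direction in which a
  lower bound for the increments leads to a contradiction.\<close>

lemma Borel_Caratheodory:
  assumes hol: "q holomorphic_on ball z\<^sub>0 R" and R: "R > 0" and q0: "q z\<^sub>0 = 0" and A: "A > 0"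
    and Re: "\<And>z. z \<in> ball z\<^sub>0 R \<Longrightarrow> Re (q z) < A" and z: "z \<in> ball z\<^sub>0 R"
  shows "cmod (q z) \<le> 2 * A * cmod (z - z\<^sub>0) / (R - cmod (z - z\<^sub>0))"
proof -
  define p where "p = (\<lambda>w. q (z\<^sub>0 + of_real R * w))"
  \<comment> \<open>The Moebius map p / (2A - p) carries the half-plane Re < A into the unit disc
    and fixes 0, so the Schwarz lemma bounds f by |w|; solving back for p gives the
    estimate.\<close>
  define f where "f = (\<lambda>w. p w / (2 * of_real A - p w))"
  have inb: "z\<^sub>0 + of_real R * w \<in> ball z\<^sub>0 R" if "cmod w < 1" for w
    using that R by (simp add: dist_norm norm_mult)
  have ReP: "Re (p w) < A" if "cmod w < 1" for w
    unfolding p_def using Re[OF inb[OF that]] .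
  have nz: "2 * of_real A - p w \<noteq> 0" if "cmod w < 1" for w
  proof
    assume "2 * of_real A - p w = 0"
    then have "Re (2 * of_real A - p w) = 0" by simp
    then show False using ReP[OF that] A by simp
  qed
  have "(q \<circ> (\<lambda>w. z\<^sub>0 + of_real R * w)) holomorphic_on ball 0 1"
    by (rule holomorphic_on_compose_gen[OF _ hol]) (auto intro!: holomorphic_intros inb)
  then have hp: "p holomorphic_on ball 0 1" by (simp add: p_def o_def)
  have hf: "f holomorphic_on ball 0 1"
    unfolding f_def using nz by (intro holomorphic_intros hp) auto
  have lt: "cmod (f w) < 1" if w: "cmod w < 1" for w
  proof -
    have "(cmod (p w))\<^sup>2 < (cmod (2 * of_real A - p w))\<^sup>2"
    proof -
      have "A * Re (p w) < A * A" using ReP[OF w] A by simp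
      then show ?thesis unfolding cmod_power2 by (simp add: power2_eq_square algebra_simps)
    qed
    then have "cmod (p w) < cmod (2 * of_real A - p w)"
      by (rule power_less_imp_less_base) simp
    then show ?thesis unfolding f_def norm_divide using nz[OF w] by simp
  qed
  have f0: "f 0 = 0" by (simp add: f_def p_def q0)
  define w where "w = (z - z\<^sub>0) / of_real R"
  have w: "cmod w < 1" "cmod w = cmod (z - z\<^sub>0) / R"
    using z R by (auto simp: w_def norm_divide dist_norm norm_minus_commute)
  have pw: "p w = q z" using R by (simp add: p_def w_def)
  have sl: "cmod (f w) \<le> cmod w"
    by (rule Schwarz_Lemma(1)[OF hf f0 lt w(1)]) auto
  have "p w = f w * (2 * of_real A - p w)"
    using nz[OF w(1)] by (simp add: f_def)
  then have "cmod (p w) = cmod (f w) * cmod (2 * of_real A - p w)"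
    by (metis norm_mult)
  also have "\<dots> \<le> cmod w * (2 * A + cmod (p w))"
  proof (rule mult_mono[OF sl])
    show "cmod (2 * of_real A - p w) \<le> 2 * A + cmod (p w)"
      using norm_triangle_ineq4[of "2 * of_real A" "p w"] A by simp
  qed auto
  finally have *: "cmod (p w) * (1 - cmod w) \<le> 2 * A * cmod w"
    by (simp add: algebra_simps)
  then have "cmod (p w) \<le> 2 * A * cmod w / (1 - cmod w)"
    using w(1) by (simp add: pos_le_divide_eq)
  also have "\<dots> = 2 * A * cmod (z - z\<^sub>0) / (R - cmod (z - z\<^sub>0))"
  proof -
    have "cmod (z - z\<^sub>0) = R * cmod w" using R w by simp
    moreover have "R - R * cmod w = R * (1 - cmod w)" by (simp add: algebra_simps)
    ultimately show ?thesis using R by simp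
  qed
  finally show ?thesis by (simp add: pw)
qed

section \<open>Removing zeros, and a one-sided bound for logarithmic derivatives\<close>

lemma factor_out_zeros:
  fixes f :: "complex \<Rightarrow> complex"
  assumes "finite F" and f: "f holomorphic_on UNIV" and nz: "f z\<^sub>0 \<noteq> 0"
  shows "\<exists>m g. g holomorphic_on UNIV \<and> (\<forall>\<rho>\<in>F. g \<rho> \<noteq> 0) \<and> (\<forall>s. f s = g s * (\<Prod>\<rho>\<in>F. (s - \<rho>) ^ m \<rho>))"
  using assms(1)
proof (induction F)
  case empty
  then show ?case using f by auto
next
  case (insert \<rho> F)
  then obtain m g where g: "g holomorphic_on UNIV" "\<And>\<rho>. \<rho> \<in> F \<Longrightarrow> g \<rho> \<noteq> 0"
      "\<And>s. f s = g s * (\<Prod>\<rho>\<in>F. (s - \<rho>) ^ m \<rho>)" by blast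
  show ?case
  proof (cases "g \<rho> = 0")
    case False
    have "(\<Prod>\<sigma>\<in>insert \<rho> F. (s - \<sigma>) ^ (m(\<rho> := 0)) \<sigma>) = (\<Prod>\<rho>\<in>F. (s - \<rho>) ^ m \<rho>)" for s
      using insert.hyps by (auto intro!: prod.cong)
    then have "g holomorphic_on UNIV \<and> (\<forall>\<rho>\<in>insert \<rho> F. g \<rho> \<noteq> 0) \<and> (\<forall>s. f s = g s * (\<Prod>\<sigma>\<in>insert \<rho> F. (s - \<sigma>) ^ (m(\<rho> := 0)) \<sigma>))"
      using g False by auto
    then show ?thesis by blast
  next
    case True
    \<comment> \<open>The nonzero value at \<open>z\<^sub>0\<close> rules out that g vanishes
      identically, so its zero at \<rho> has a finite order n.\<close>
    have gz0: "g z\<^sub>0 \<noteq> 0" using nz g(3)[of z\<^sub>0] by auto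
    have nc: "\<not> g constant_on UNIV" using gz0 True unfolding constant_on_def by (metis UNIV_I)
    obtain k r n where k: "0 < n" "0 < r" "k holomorphic_on ball \<rho> r"
        "\<And>w. w \<in> ball \<rho> r \<Longrightarrow> g w = (w - \<rho>) ^ n * k w" "\<And>w. w \<in> ball \<rho> r \<Longrightarrow> k w \<noteq> 0"
      using holomorphic_factor_zero_nonconstant[OF g(1) open_UNIV connected_UNIV UNIV_I True nc] by metis
    \<comment> \<open>The singularity of the quotient at \<rho> is filled by the value of k; g'
      agrees with k on the ball and with the quotient elsewhere, and these two open sets cover the
      plane.\<close>
    define g' where "g' = (\<lambda>s. if s = \<rho> then k \<rho> else g s / (s - \<rho>) ^ n)"
    have e: "g' s = k s" if "s \<in> ball \<rho> r" for s
      using that k(4)[OF that] by (simp add: g'_def)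
    have h1: "g' holomorphic_on ball \<rho> r"
      by (rule holomorphic_transform[OF k(3)]) (simp add: e)
    have "(\<lambda>s. g s / (s - \<rho>) ^ n) holomorphic_on (- {\<rho>})"
      by (intro holomorphic_intros holomorphic_on_subset[OF g(1)]) auto
    then have h2: "g' holomorphic_on (- {\<rho>})"
      by (rule holomorphic_transform) (simp add: g'_def)
    have "g' holomorphic_on (ball \<rho> r \<union> - {\<rho>})"
      by (rule holomorphic_on_Un[OF h1 h2]) auto
    moreover have "ball \<rho> r \<union> - {\<rho>} = UNIV" using k(2) by auto
    ultimately have h: "g' holomorphic_on UNIV" by simp
    have gg: "g s = g' s * (s - \<rho>) ^ n" for s
      using True k(1) by (cases "s = \<rho>") (auto simp: g'_def)
    have "(\<Prod>\<sigma>\<in>insert \<rho> F. (s - \<sigma>) ^ (m(\<rho> := n)) \<sigma>) = (s - \<rho>) ^ n * (\<Prod>\<rho>\<in>F. (s - \<rho>) ^ m \<rho>)" for s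
    proof -
      have "(\<Prod>\<sigma>\<in>F. (s - \<sigma>) ^ (m(\<rho> := n)) \<sigma>) = (\<Prod>\<rho>\<in>F. (s - \<rho>) ^ m \<rho>)"
        using insert.hyps by (intro prod.cong) auto
      then show ?thesis using insert.hyps by simp
    qed
    then have "\<forall>s. f s = g' s * (\<Prod>\<sigma>\<in>insert \<rho> F. (s - \<sigma>) ^ (m(\<rho> := n)) \<sigma>)"
      using g(3) gg by (simp add: mult.assoc)
    moreover have "\<forall>\<rho>'\<in>insert \<rho> F. g' \<rho>' \<noteq> 0"
      using g(2) gg e[of \<rho>] k(2,5) by (metis centre_in_ball insert_iff mult_zero_left)
    ultimately show ?thesis using h by blast
  qed
qed

lemma has_field_derivative_prod_power:
  fixes s :: complex
  assumes "finite F" "s \<notin> F"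
  shows "((\<lambda>s. \<Prod>\<rho>\<in>F. (s - \<rho>) ^ m \<rho>) has_field_derivative
            (\<Prod>\<rho>\<in>F. (s - \<rho>) ^ m \<rho>) * (\<Sum>\<rho>\<in>F. of_nat (m \<rho>) / (s - \<rho>))) (at s)"
  using assms
proof (induction F)
  case empty
  then show ?case by simp
next
  case (insert \<rho> F)
  have IH: "((\<lambda>s. \<Prod>\<rho>\<in>F. (s - \<rho>) ^ m \<rho>) has_field_derivative
            (\<Prod>\<rho>\<in>F. (s - \<rho>) ^ m \<rho>) * (\<Sum>\<rho>\<in>F. of_nat (m \<rho>) / (s - \<rho>))) (at s)"
    using insert by auto
  have nz: "s - \<rho> \<noteq> 0" using insert by auto
  have "((\<lambda>s. (s - \<rho>) ^ m \<rho>) has_field_derivative of_nat (m \<rho>) * (s - \<rho>) ^ (m \<rho> - 1)) (at s)"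
    by (auto intro!: derivative_eq_intros)
  moreover have "of_nat (m \<rho>) * (s - \<rho>) ^ (m \<rho> - 1) = (s - \<rho>) ^ m \<rho> * (of_nat (m \<rho>) / (s - \<rho>))"
    using nz by (cases "m \<rho>") (auto simp: field_simps)
  ultimately have "((\<lambda>s. (s - \<rho>) ^ m \<rho>) has_field_derivative (s - \<rho>) ^ m \<rho> * (of_nat (m \<rho>) / (s - \<rho>))) (at s)"
    by simp
  from DERIV_mult[OF this IH] show ?case
    using insert.hyps by (simp add: algebra_simps)
qed

text \<open>Dividing out the zeros in the unit disc leaves a zero-free factor with bounded
  logarithmic derivative, while each removed zero adds m / (s - \<rho>), whose real part is
  nonnegative because s lies to its right. So the bound is one-sided, but uniform as s approaches
  the zeros. The constant is 2 * 2A * (7/8) / (1/8) = 28A from Borel-Caratheodory, times 8 from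
  Cauchy's inequality on radius 1/8.\<close>

lemma Re_logderiv_lower_bound:
  fixes f :: "complex \<Rightarrow> complex"
  assumes f: "f holomorphic_on UNIV" and nz: "f s\<^sub>0 \<noteq> 0" and A: "A > 0"
    and bd: "\<And>s. s \<in> cball s\<^sub>0 2 \<Longrightarrow> cmod (f s) \<le> exp A * cmod (f s\<^sub>0)"
    and zeros: "\<And>\<rho>. \<rho> \<in> cball s\<^sub>0 1 \<Longrightarrow> f \<rho> = 0 \<Longrightarrow> Re \<rho> \<le> \<beta>"
    and s: "s \<in> cball s\<^sub>0 (3/4)" "Re s > \<beta>"
  shows "Re (deriv f s / f s) \<ge> - 224 * A"
proof -
  define F where "F = {\<rho> \<in> cball s\<^sub>0 1. f \<rho> = 0}"
  have fin: "finite F"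
  proof (cases "f constant_on UNIV")
    case True
    then have "F = {}" using nz unfolding F_def constant_on_def by auto
    then show ?thesis by simp
  next
    case False
    then show ?thesis unfolding F_def
      by (intro holomorphic_compact_finite_zeros[OF f]) auto
  qed
  obtain m g where g: "g holomorphic_on UNIV" "\<And>\<rho>. \<rho> \<in> F \<Longrightarrow> g \<rho> \<noteq> 0"
      "\<And>s. f s = g s * (\<Prod>\<rho>\<in>F. (s - \<rho>) ^ m \<rho>)"
    using factor_out_zeros[OF fin f nz] by blast
  define P where "P = (\<lambda>s. \<Prod>\<rho>\<in>F. (s - \<rho>) ^ m \<rho>)"
  have fP: "f s = g s * P s" for s using g(3) by (simp add: P_def)
  have gnz: "g w \<noteq> 0" if "w \<in> cball s\<^sub>0 1" for w
    using that g(2)[of w] fP[of w] by (cases "w \<in> F") (auto simp: F_def)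
  have Pnz: "P s\<^sub>0 \<noteq> 0" using nz fP[of s\<^sub>0] by auto
  \<comment> \<open>On the circle of radius 2 every factor satisfies |z - \<rho>| \<ge> 1 \<ge>
    \<open>cmod (s\<^sub>0 - \<rho>)\<close>, so division by P preserves the bound relative to the
    centre; the maximum principle carries it inside.\<close>
  have bd_g: "cmod (g w) \<le> exp A * cmod (g s\<^sub>0)" if w: "w \<in> cball s\<^sub>0 2" for w
  proof (rule maximum_modulus_frontier[of g "cball s\<^sub>0 2"])
    show "g holomorphic_on interior (cball s\<^sub>0 2)"
      by (rule holomorphic_on_subset[OF g(1)]) auto
    show "continuous_on (closure (cball s\<^sub>0 2)) g"
      by (intro holomorphic_on_imp_continuous_on holomorphic_on_subset[OF g(1)]) auto
    fix z assume "z \<in> frontier (cball s\<^sub>0 2)"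
    then have z: "cmod (z - s\<^sub>0) = 2" by (simp add: dist_norm norm_minus_commute)
    have "cmod (P s\<^sub>0) \<le> cmod (P z)"
      unfolding P_def prod_norm[symmetric] norm_power
    proof (intro prod_mono conjI power_mono)
      fix \<rho> assume "\<rho> \<in> F"
      then have r: "cmod (s\<^sub>0 - \<rho>) \<le> 1" by (auto simp: F_def dist_norm)
      have "cmod (z - s\<^sub>0) \<le> cmod (z - \<rho>) + cmod (s\<^sub>0 - \<rho>)"
        using norm_triangle_ineq4[of "z - \<rho>" "s\<^sub>0 - \<rho>"] by simp
      then show "cmod (s\<^sub>0 - \<rho>) \<le> cmod (z - \<rho>)" using r z by linarith
    qed auto
    then have "cmod (g z) * cmod (P s\<^sub>0) \<le> cmod (g z) * cmod (P z)"
      by (intro mult_left_mono) auto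
    also have "\<dots> = cmod (f z)" by (simp add: fP norm_mult)
    also have "\<dots> \<le> exp A * cmod (f s\<^sub>0)" by (rule bd) (metis z dist_norm dist_commute mem_cball order_refl)
    also have "\<dots> = exp A * cmod (g s\<^sub>0) * cmod (P s\<^sub>0)" by (simp add: fP norm_mult)
    finally show "cmod (g z) \<le> exp A * cmod (g s\<^sub>0)" using Pnz by simp
  qed (use w in auto)
  obtain l where l: "l holomorphic_on ball s\<^sub>0 1" "\<And>z. z \<in> ball s\<^sub>0 1 \<Longrightarrow> g z = exp (l z)"
  proof (rule holomorphic_logarithm_exists[of "ball s\<^sub>0 1" g s\<^sub>0])
    show "g holomorphic_on ball s\<^sub>0 1" by (rule holomorphic_on_subset[OF g(1)]) auto
  qed (use gnz in \<open>auto simp: convex_ball\<close>)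
  define q where "q = (\<lambda>z. l z - l s\<^sub>0)"
  have q: "q holomorphic_on ball s\<^sub>0 1" unfolding q_def by (intro holomorphic_intros l)
  \<comment> \<open>A is doubled only to make the inequality strict, as Borel-Caratheodory
    requires.\<close>
  have Req: "Re (q z) < 2 * A" if z: "z \<in> ball s\<^sub>0 1" for z
  proof -
    have "exp (Re (l z)) = cmod (g z)" using l(2)[OF z] by simp
    also have "\<dots> \<le> exp A * cmod (g s\<^sub>0)" using bd_g[of z] z by auto
    also have "\<dots> = exp (A + Re (l s\<^sub>0))" using l(2)[of s\<^sub>0] by (simp add: exp_add)
    finally show ?thesis using A by (simp add: q_def)
  qed
  have bq: "cmod (q z) \<le> 28 * A" if z: "z \<in> cball s\<^sub>0 (7/8)" for z
  proof -
    have zz: "cmod (z - s\<^sub>0) \<le> 7/8" using z by (simp add: dist_norm norm_minus_commute)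
    have "cmod (q z) \<le> 2 * (2 * A) * cmod (z - s\<^sub>0) / (1 - cmod (z - s\<^sub>0))"
      by (rule Borel_Caratheodory[OF q]) (use A Req z in \<open>auto simp: q_def\<close>)
    also have "\<dots> \<le> 2 * (2 * A) * (7/8) / (1/8)"
      using A zz by (intro frac_le mult_left_mono) auto
    finally show ?thesis by simp
  qed
  have sb: "s \<in> ball s\<^sub>0 1" using s by auto
  have sub: "cball s (1/8) \<subseteq> cball s\<^sub>0 (7/8)"
  proof
    fix w assume "w \<in> cball s (1/8)"
    then show "w \<in> cball s\<^sub>0 (7/8)" using s dist_triangle[of s\<^sub>0 w s] by auto
  qed
  have sub': "cball s (1/8) \<subseteq> ball s\<^sub>0 1" using sub by force
  have "cmod ((deriv ^^ 1) q s) \<le> fact 1 * (28 * A) / (1/8) ^ 1"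
  proof (rule Cauchy_inequality)
    show "q holomorphic_on ball s (1/8)" by (rule holomorphic_on_subset[OF q]) (use sub' in force)
    show "continuous_on (cball s (1/8)) q"
      by (intro holomorphic_on_imp_continuous_on holomorphic_on_subset[OF q] sub')
    fix x assume "cmod (s - x) = 1/8"
    then have "x \<in> cball s (1/8)" by (simp add: dist_norm)
    then show "cmod (q x) \<le> 28 * A" using sub bq by blast
  qed auto
  then have dq: "cmod (deriv q s) \<le> 224 * A" by simp
  have sF: "s \<notin> F" using zeros s(2) by (force simp: F_def)
  have dl: "(l has_field_derivative deriv q s) (at s)"
  proof -
    have "((\<lambda>z. q z + l s\<^sub>0) has_field_derivative deriv q s + 0) (at s)"
      by (intro DERIV_add holomorphic_derivI[OF q _ sb]) auto
    then show ?thesis by (simp add: q_def)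
  qed
  have "((\<lambda>z. exp (l z)) has_field_derivative exp (l s) * deriv q s) (at s)"
    by (intro DERIV_fun_exp dl)
  then have dg: "(g has_field_derivative g s * deriv q s) (at s)"
    using l(2) sb by (auto intro!: has_field_derivative_transform_within_open[of "\<lambda>z. exp (l z)" _ _ "ball s\<^sub>0 1" g])
  have dP: "(P has_field_derivative P s * (\<Sum>\<rho>\<in>F. of_nat (m \<rho>) / (s - \<rho>))) (at s)"
    unfolding P_def by (rule has_field_derivative_prod_power[OF fin sF])
  from DERIV_mult[OF dg dP] have "deriv (\<lambda>s. g s * P s) s = g s * P s * (deriv q s + (\<Sum>\<rho>\<in>F. of_nat (m \<rho>) / (s - \<rho>)))"
    by (intro DERIV_imp_deriv) (simp add: algebra_simps)
  then have eq: "deriv f s = f s * (deriv q s + (\<Sum>\<rho>\<in>F. of_nat (m \<rho>) / (s - \<rho>)))"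
    using fP by (metis (no_types, lifting) ext)
  have fs: "f s \<noteq> 0" using zeros[of s] s by force
  have "Re (deriv f s / f s) = Re (deriv q s) + (\<Sum>\<rho>\<in>F. Re (of_nat (m \<rho>) / (s - \<rho>)))"
    using fs by (simp add: eq)
  moreover have "(\<Sum>\<rho>\<in>F. Re (of_nat (m \<rho>) / (s - \<rho>))) \<ge> 0"
  proof (rule sum_nonneg)
    fix \<rho> assume "\<rho> \<in> F"
    then have "Re \<rho> < Re s" using zeros[of \<rho>] s by (auto simp: F_def)
    then show "Re (of_nat (m \<rho>) / (s - \<rho>)) \<ge> 0"
      by (simp add: Re_divide')
  qed
  moreover have "Re (deriv q s) \<ge> - 224 * A"
    using dq abs_Re_le_cmod[of "deriv q s"] by linarith
  ultimately show ?thesis by linarith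
qed

text \<open>Cauchy's inequality on discs of half the radius bounds the derivative in s, hence the
  difference quotients, by 2 h / r; dominated convergence along sequences then moves the limit
  inside the integral.\<close>

lemma holomorphic_integral:
  fixes f :: "complex \<Rightarrow> 'a \<Rightarrow> complex"
  assumes U: "open U" and hol: "\<And>x. x \<in> space M \<Longrightarrow> (\<lambda>s. f s x) holomorphic_on U"
    and meas: "\<And>s. s \<in> U \<Longrightarrow> f s \<in> borel_measurable M"
    and dom: "\<And>s. s \<in> U \<Longrightarrow> \<exists>r>0. \<exists>h. cball s r \<subseteq> U \<and> integrable M h \<and>
                (\<forall>w\<in>cball s r. \<forall>x\<in>space M. cmod (f w x) \<le> h x)"
  shows "(\<lambda>s. \<integral>x. f s x \<partial>M) holomorphic_on U"
proof -
  have "\<exists>D. ((\<lambda>s. \<integral>x. f s x \<partial>M) has_field_derivative D) (at s)" if s: "s \<in> U" for s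
  proof -
    obtain r h where r: "r > 0" "cball s r \<subseteq> U" and h: "integrable M h"
      and bd: "\<And>w x. w \<in> cball s r \<Longrightarrow> x \<in> space M \<Longrightarrow> cmod (f w x) \<le> h x"
      using dom[OF s] by blast
    have int: "integrable M (f w)" if "w \<in> cball s r" for w
      using that r bd[OF that] by (intro Bochner_Integration.integrable_bound[OF h] meas)
        (auto intro!: AE_I2 order_trans[OF _ abs_ge_self])
    define D where "D = (\<lambda>x. deriv (\<lambda>s. f s x) s)"
    have dD: "((\<lambda>s. f s x) has_field_derivative D x) (at s)" if "x \<in> space M" for x
      unfolding D_def by (rule holomorphic_derivI[OF hol[OF that] U s])
    define B where "B = ball s (r/2) - {s}"
    have quot: "cmod ((f w x - f s x) / (w - s)) \<le> 2 / r * h x" if w: "w \<in> B" and x: "x \<in> space M" for w x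
    proof -
      have "cmod (f w x - f s x) \<le> (2 / r * h x) * cmod (w - s)"
      proof (rule field_differentiable_bound[of "cball s (r/2)"])
        fix z assume z: "z \<in> cball s (r/2)"
        have sub: "cball z (r/2) \<subseteq> cball s r"
        proof
          fix v assume "v \<in> cball z (r/2)"
          then show "v \<in> cball s r" using z dist_triangle[of s v z] by auto
        qed
        have "z \<in> cball z (r/2)" using r by simp
        then have zU: "z \<in> U" using r sub by blast
        show "((\<lambda>w. f w x) has_field_derivative deriv (\<lambda>s. f s x) z) (at z within cball s (r/2))"
          by (rule has_field_derivative_at_within, rule holomorphic_derivI[OF hol[OF x] U zU])
        have "cmod ((deriv ^^ 1) (\<lambda>s. f s x) z) \<le> fact 1 * h x / (r/2) ^ 1"
        proof (rule Cauchy_inequality)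
          show "(\<lambda>s. f s x) holomorphic_on ball z (r/2)"
            by (rule holomorphic_on_subset[OF hol[OF x]]) (use sub r ball_subset_cball in blast)
          show "continuous_on (cball z (r/2)) (\<lambda>s. f s x)"
            by (intro holomorphic_on_imp_continuous_on holomorphic_on_subset[OF hol[OF x]]) (use sub r in blast)
          fix v assume "cmod (z - v) = r/2"
          then have "v \<in> cball z (r/2)" by (simp add: dist_norm)
          then show "cmod (f v x) \<le> h x" using sub bd x by blast
        qed (use r in auto)
        then show "cmod (deriv (\<lambda>s. f s x) z) \<le> 2 / r * h x" by (simp add: mult.commute)
      qed (use w r in \<open>auto simp: B_def\<close>)
      moreover have "w \<noteq> s" using w by (simp add: B_def)
      ultimately show ?thesis by (simp add: norm_divide pos_divide_le_eq)
    qed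
    have "((\<lambda>w. ((\<integral>x. f w x \<partial>M) - (\<integral>x. f s x \<partial>M)) / (w - s)) \<longlongrightarrow> (\<integral>x. D x \<partial>M)) (at s within B)"
      unfolding tendsto_at_iff_sequentially o_def
    proof (intro allI impI)
      fix X :: "nat \<Rightarrow> complex" assume X: "\<forall>i. X i \<in> B - {s}" "X \<longlonglongrightarrow> s"
      have X1: "X i \<in> B" "X i \<noteq> s" "X i \<in> cball s r" for i
        using X(1)[rule_format, of i] r by (auto simp: B_def)
      have lim: "(\<lambda>i. (f (X i) x - f s x) / (X i - s)) \<longlonglongrightarrow> D x" if x: "x \<in> space M" for x
      proof -
        have "((\<lambda>w. (f w x - f s x) / (w - s)) \<longlongrightarrow> D x) (at s)"
          using dD[OF x] by (simp add: has_field_derivative_iff)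
        then show ?thesis using X(2) X1(2)
          unfolding tendsto_at_iff_sequentially o_def by auto
      qed
      have ms: "(\<lambda>x. (f (X i) x - f s x) / (X i - s)) \<in> borel_measurable M" for i
        using meas[OF s] meas[of "X i"] X1(3)[of i] r by (intro borel_measurable_divide borel_measurable_diff) auto
      have "(\<lambda>i. \<integral>x. (f (X i) x - f s x) / (X i - s) \<partial>M) \<longlonglongrightarrow> (\<integral>x. D x \<partial>M)"
      proof (rule integral_dominated_convergence[where w = "\<lambda>x. 2 / r * h x"])
        show "D \<in> borel_measurable M"
          by (rule borel_measurable_LIMSEQ_metric[OF ms lim])
        show "AE x in M. (\<lambda>i. (f (X i) x - f s x) / (X i - s)) \<longlonglongrightarrow> D x"
          using lim by auto
        show "AE x in M. cmod ((f (X i) x - f s x) / (X i - s)) \<le> 2 / r * h x" for i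
          using quot[OF X1(1)] by auto
      qed (use ms h in auto)
      moreover have "(\<integral>x. (f (X i) x - f s x) / (X i - s) \<partial>M) = ((\<integral>x. f (X i) x \<partial>M) - (\<integral>x. f s x \<partial>M)) / (X i - s)" for i
        using int[OF X1(3)] int[of s] r by simp
      ultimately show "(\<lambda>i. ((\<integral>x. f (X i) x \<partial>M) - (\<integral>x. f s x \<partial>M)) / (X i - s)) \<longlonglongrightarrow> (\<integral>x. D x \<partial>M)"
        by (simp only:)
    qed
    moreover have "at s within B = at s"
      unfolding B_def by (rule at_within_nhd[of _ "ball s (r/2)"]) (use r in auto)
    ultimately show ?thesis by (auto simp: has_field_derivative_iff)
  qed
  then show ?thesis using U by (simp add: holomorphic_on_open)
qed

section \<open>The Dirichlet series of the logarithm of zeta\<close>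

text \<open>One statement serves zeta, with coefficients 1, and its logarithm, with coefficients
  \<open>lcoef\<close>. The coefficient \<open>c n\<close> belongs to the integer n + 1.\<close>

lemma bounded_dirichlet_series:
  fixes c :: "nat \<Rightarrow> complex"
  assumes c: "\<And>n. cmod (c n) \<le> 1"
  shows "\<exists>D D'. \<forall>s. Re s > 1 \<longrightarrow> (\<lambda>n. c n * of_nat (Suc n) powr (- s)) sums D s \<and>
      (\<lambda>n. - c n * of_real (ln (real (Suc n))) * of_nat (Suc n) powr (- s)) sums D' s \<and>
      (D has_field_derivative D' s) (at s)"
proof -
  let ?f = "\<lambda>n s. c n * of_nat (Suc n) powr (- s)"
  let ?f' = "\<lambda>n s. - c n * of_real (ln (real (Suc n))) * of_nat (Suc n) powr (- s)"
  have "\<exists>g g'. \<forall>x\<in>{s. Re s > 1}. ((\<lambda>n. ?f n x) sums g x) \<and> ((\<lambda>n. ?f' n x) sums g' x) \<and>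
      (g has_field_derivative g' x) (at x)"
  proof (rule series_and_derivative_comparison_local[OF open_half])
    fix n s
    have nz: "of_nat (Suc n) \<noteq> (0::complex)" by (simp del: of_nat_Suc)
    have ln: "Ln (of_nat (Suc n)) = of_real (ln (real (Suc n)))"
      using Ln_of_real[of "real (Suc n)"] by (simp del: of_nat_Suc)
    show "(?f n has_field_derivative ?f' n s) (at s)"
    proof -
      have "((\<lambda>z. of_nat (Suc n) powr z) has_field_derivative Ln (of_nat (Suc n)) * of_nat (Suc n) powr (- s)) (at (- s))"
        by (rule has_field_derivative_powr_right[OF nz])
      from DERIV_chain2[OF this DERIV_minus[OF DERIV_ident]]
      have "((\<lambda>s. of_nat (Suc n) powr (- s)) has_field_derivative Ln (of_nat (Suc n)) * of_nat (Suc n) powr (- s) * (-1)) (at s)"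
        by simp
      from DERIV_cmult[OF this, of "c n"] show ?thesis unfolding ln by (simp add: mult.assoc)
    qed
  next
    fix s :: complex assume s: "s \<in> {s. Re s > 1}"
    define d where "d = (Re s - 1) / 2"
    have d: "d > 0" using s by (simp add: d_def)
    have sm: "summable (\<lambda>n. real (Suc n) powr (d - Re s))"
      by (intro summable_Suc_powr) (use s in \<open>simp add: d_def field_simps\<close>)
    have "cmod (?f n y) \<le> real (Suc n) powr (d - Re s)" if y: "y \<in> ball s d" for n y
    proof -
      have "\<bar>Re (s - y)\<bar> \<le> cmod (s - y)" by (rule abs_Re_le_cmod)
      then have "Re s - d \<le> Re y" using y by (simp add: dist_norm)
      then have "cmod (of_nat (Suc n) powr (- y)) \<le> real (Suc n) powr (d - Re s)"
        unfolding norm_of_nat_Suc_powr by (intro powr_mono) auto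
      then show ?thesis unfolding norm_mult using c[of n]
        by (meson mult_left_le_one_le norm_ge_zero order_trans)
    qed
    then show "\<exists>d h. 0 < d \<and> summable h \<and>
        (\<forall>\<^sub>F n in sequentially. \<forall>y\<in>ball s d \<inter> {s. Re s > 1}. cmod (?f n y) \<le> h n)"
      using d sm by (intro exI[of _ d] exI[of _ "\<lambda>n. real (Suc n) powr (d - Re s)"]) auto
  qed
  then show ?thesis by auto
qed

text \<open>For integers m \<ge> 2 the factor m powr (2 - x) is at most 2 powr (2 - x), and m powr
  (- 2) remains to be summed. Letting Re s tend to infinity in this bound fixes the additive
  constants of logarithms.\<close>

lemma dirichlet_series_at_infinity:
  fixes c :: "nat \<Rightarrow> complex" and s :: complex
  assumes c: "\<And>n. cmod (c n) \<le> 1" and s: "Re s \<ge> 2"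
    and D: "(\<lambda>n. c n * of_nat (Suc n) powr (- s)) sums D"
  shows "cmod (D - c 0) \<le> 2 powr (2 - Re s) * (\<Sum>n. real (Suc n) powr (-2))"
proof -
  define x where "x = Re s"
  have x: "x \<ge> 2" using s by (simp add: x_def)
  have sm: "summable (\<lambda>n. real (Suc n) powr (-2))" by (intro summable_Suc_powr) auto
  let ?f = "\<lambda>n. c n * of_nat (Suc n) powr (- s)"
  have "(\<lambda>n. ?f (Suc n)) sums (D - ?f 0)"
    using D by (subst sums_Suc_iff) simp
  then have D': "(\<lambda>n. ?f (Suc n)) sums (D - c 0)" by simp
  have bd: "cmod (?f (Suc n)) \<le> 2 powr (2 - x) * real (Suc (Suc n)) powr (-2)" for n
  proof -
    have "cmod (?f (Suc n)) \<le> 1 * real (Suc (Suc n)) powr (- x)"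
      unfolding norm_mult norm_of_nat_Suc_powr x_def using c[of "Suc n"] by (intro mult_mono) auto
    also have "- x = (2 - x) + (- 2)" by simp
    also have "1 * real (Suc (Suc n)) powr ((2 - x) + (-2)) = real (Suc (Suc n)) powr (2 - x) * real (Suc (Suc n)) powr (-2)"
      unfolding powr_add by simp
    also have "\<dots> \<le> 2 powr (2 - x) * real (Suc (Suc n)) powr (-2)"
      using x by (intro mult_right_mono powr_mono2') auto
    finally show ?thesis .
  qed
  have sm': "summable (\<lambda>n. real (Suc (Suc n)) powr (-2))"
    using sm by (subst summable_Suc_iff[of "\<lambda>n. real (Suc n) powr (-2)"])
  have "cmod (D - c 0) = cmod (\<Sum>n. ?f (Suc n))" using sums_unique[OF D'] by simp
  also have "\<dots> \<le> (\<Sum>n. 2 powr (2 - x) * real (Suc (Suc n)) powr (-2))"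
    by (rule norm_suminf_le[OF bd summable_mult[OF sm']])
  also have "\<dots> = 2 powr (2 - x) * (\<Sum>n. real (Suc (Suc n)) powr (-2))"
    by (rule suminf_mult[OF sm'])
  also have "(\<Sum>n. real (Suc (Suc n)) powr (-2)) \<le> (\<Sum>n. real (Suc n) powr (-2))"
    using suminf_split_head[OF sm] by simp
  finally show ?thesis by (simp add: mult_left_mono x_def)
qed

text \<open>The sum of \<Lambda> over the divisors of n is log n; absolute convergence permits
  regrouping the pairs (d, m) by their product n = d m.\<close>

lemma mangoldt_dirichlet_product:
  fixes s :: complex
  assumes M: "(\<lambda>n. mangoldt n * of_nat n powr (- s)) sums a" "summable (\<lambda>n. cmod (mangoldt n * of_nat n powr (- s)))"
    and Z: "(\<lambda>n. of_nat n powr (- s)) sums b" "summable (\<lambda>n. cmod (of_nat n powr (- s)))"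
  shows "(\<lambda>n. of_real (ln (real n)) * of_nat n powr (- s)) sums (a * b)"
proof -
  let ?f = "\<lambda>n. mangoldt n * of_nat n powr (- s)" and ?g = "\<lambda>n::nat. of_nat n powr (- s)"
  have F: "(?f has_sum a) UNIV" and G: "(?g has_sum b) UNIV"
    using M Z by (auto intro: norm_summable_imp_has_sum)
  have aF: "(\<lambda>n. cmod (?f n)) summable_on UNIV" and aG: "(\<lambda>n. cmod (?g n)) summable_on UNIV"
    using M(2) Z(2) by (auto intro!: norm_summable_imp_summable_on)
  let ?h = "\<lambda>(d,m). ?f d * ?g m"
  have "(\<lambda>p. norm (?h p)) summable_on (UNIV \<times> UNIV)"
  proof (rule summable_on_SigmaI[where g = "\<lambda>d. cmod (?f d) * infsum (\<lambda>m. cmod (?g m)) UNIV"])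
    show "((\<lambda>y. norm (?h (x, y))) has_sum cmod (?f x) * infsum (\<lambda>m. cmod (?g m)) UNIV) UNIV" for x
      using has_sum_cmult_right[OF has_sum_infsum[OF aG], of "cmod (?f x)"]
      by (simp add: norm_mult)
    show "(\<lambda>d. cmod (?f d) * infsum (\<lambda>m. cmod (?g m)) UNIV) summable_on UNIV"
      by (intro summable_on_cmult_left aF)
  qed auto
  then have "?h summable_on (UNIV \<times> UNIV)" by (rule abs_summable_summable)
  then have H: "(?h has_sum (a * b)) (UNIV \<times> UNIV)"
  proof (rule has_sum_SigmaI[rotated 2, where g = "\<lambda>d. ?f d * b"])
    show "((\<lambda>y. ?h (x, y)) has_sum ?f x * b) UNIV" for x
      using has_sum_cmult_right[OF G] by simp
    show "((\<lambda>d. ?f d * b) has_sum a * b) UNIV" by (rule has_sum_cmult_left[OF F])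
  qed
  \<comment> \<open>Index 0 contributes nothing because \<open>0 powr z = 0\<close>. On positive
    integers (d, m) \<mapsto> (d m, d) is a bijection onto the pairs of an integer and one of its
    divisors.\<close>
  let ?P = "{n::nat. n > 0}"
  have "(?h has_sum (a * b)) (?P \<times> ?P)"
    using H by (rule has_sum_cong_neutral[THEN iffD1, rotated -1]) auto
  also have "?this \<longleftrightarrow> ((\<lambda>(n,d). mangoldt d * of_nat n powr (- s)) has_sum (a * b)) (Sigma ?P (\<lambda>n. {d. d dvd n}))"
  proof (rule has_sum_reindex_bij_witness[of _ "\<lambda>(n,d). (d, n div d)" "\<lambda>(d,m). (d * m, d)"])
    fix p :: "nat \<times> nat" assume "p \<in> ?P \<times> ?P"
    then obtain d m where p: "p = (d, m)" "d > 0" "m > 0" by auto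
    have "of_nat (d * m) powr (- s) = of_nat d powr (- s) * of_nat m powr (- s)"
      using powr_times_real[of "of_nat d" "of_nat m" "- s"] by simp
    then show "(case case p of (d, m) \<Rightarrow> (d * m, d) of (n, d) \<Rightarrow> mangoldt d * of_nat n powr (- s)) = ?h p"
      by (simp add: p)
  qed (auto intro: dvd_pos_nat simp: div_greater_zero_iff dvd_imp_le)
  finally have "((\<lambda>n. of_real (ln (real n)) * of_nat n powr (- s)) has_sum (a * b)) ?P"
  proof (rule has_sum_SigmaD)
    fix n assume n: "n \<in> ?P"
    have "((\<lambda>d. mangoldt d * of_nat n powr (- s)) has_sum (\<Sum>d | d dvd n. mangoldt d * of_nat n powr (- s))) {d. d dvd n}"
      using n by (intro has_sum_finite) auto
    also have "(\<Sum>d | d dvd n. mangoldt d * of_nat n powr (- s)) = of_real (ln (real n)) * of_nat n powr (- s)"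
      using n by (subst sum_distrib_right[symmetric], subst mangoldt_sum) auto
    finally show "((\<lambda>d. case (n, d) of (n, d) \<Rightarrow> mangoldt d * of_nat n powr (- s)) has_sum of_real (ln (real n)) * of_nat n powr (- s)) {d. d dvd n}"
      by simp
  qed
  then have "((\<lambda>n. of_real (ln (real n)) * of_nat n powr (- s)) has_sum (a * b)) UNIV"
    by (rule has_sum_cong_neutral[THEN iffD1, rotated -1]) auto
  then show ?thesis by (rule has_sum_imp_sums)
qed

text \<open>The coefficients of log zeta: 1 / k at a prime power p^k and 0 elsewhere. At 0 and 1 the
  von Mangoldt function vanishes, so the division by 0 there gives the right value.\<close>

definition lcoef :: "nat \<Rightarrow> real" where
  "lcoef n = mangoldt n / ln (real n)"

lemma lcoef_nonneg: "lcoef n \<ge> 0"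
  unfolding lcoef_def by (cases "n = 0") (auto intro!: divide_nonneg_nonneg mangoldt_nonneg ln_ge_zero)

lemma lcoef_le_1: "lcoef n \<le> 1"
proof (cases "n \<le> 1")
  case True
  then have "n = 0 \<or> n = 1" by auto
  then show ?thesis by (auto simp: lcoef_def)
next
  case False
  then show ?thesis using mangoldt_le[of n] by (simp add: lcoef_def)
qed

lemma lcoef_mult_ln: "lcoef n * ln (real n) = mangoldt n"
proof (cases "n \<le> 1")
  case True
  then have "n = 0 \<or> n = 1" by auto
  then show ?thesis by (auto simp: lcoef_def)
next
  case False
  then show ?thesis by (simp add: lcoef_def)
qed

lemma norm_lcoef: "cmod (of_real (lcoef n)) \<le> 1"
  using lcoef_nonneg[of n] lcoef_le_1[of n] by simp

definition log_dseries :: "complex \<Rightarrow> complex" where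
  "log_dseries s = (\<Sum>n. of_real (lcoef (Suc n)) * of_nat (Suc n) powr (- s))"

lemma log_dseries_sums:
  assumes "Re s > 1"
  shows "(\<lambda>n. of_real (lcoef (Suc n)) * of_nat (Suc n) powr (- s)) sums log_dseries s"
  using bounded_dirichlet_series[of "\<lambda>n. of_real (lcoef (Suc n))", OF norm_lcoef] assms
  unfolding log_dseries_def by (metis (no_types, lifting) sums_summable summable_sums)

lemma summable_norm_log_dseries:
  assumes "Re s > 1"
  shows "summable (\<lambda>n. cmod (of_real (lcoef (Suc n)) * of_nat (Suc n) powr (- s)))"
proof (rule summable_comparison_test'[of "\<lambda>n. real (Suc n) powr (- Re s)" 0])
  show "summable (\<lambda>n. real (Suc n) powr (- Re s))" using assms by (intro summable_Suc_powr) auto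
  fix n
  show "norm (cmod (of_real (lcoef (Suc n)) * of_nat (Suc n) powr (- s))) \<le> real (Suc n) powr (- Re s)"
    using norm_lcoef[of "Suc n"] unfolding norm_mult norm_of_nat_Suc_powr
    by (simp add: mult_left_le_one_le)
qed

text \<open>A single D, the series of \<Lambda>(n) n^(-s), serves both derivatives: termwise for
  \<open>log_dseries\<close>, and for \<open>dseries\<close> through
  \<open>mangoldt_dirichlet_product\<close>, which reads zeta' = - D zeta.\<close>

lemma log_dseries_deriv:
  assumes s: "Re s > 1"
  shows "\<exists>D. (log_dseries has_field_derivative - D) (at s) \<and> (dseries has_field_derivative - (D * dseries s)) (at s)"
proof -
  have "\<exists>L L'. \<forall>s. Re s > 1 \<longrightarrow> (\<lambda>n. of_real (lcoef (Suc n)) * of_nat (Suc n) powr (- s)) sums L s \<and>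
      (\<lambda>n. - of_real (lcoef (Suc n)) * of_real (ln (real (Suc n))) * of_nat (Suc n) powr (- s)) sums L' s \<and>
      (L has_field_derivative L' s) (at s)"
    by (rule bounded_dirichlet_series[OF norm_lcoef])
  then obtain L L' where L: "\<And>s. Re s > 1 \<Longrightarrow> (\<lambda>n. of_real (lcoef (Suc n)) * of_nat (Suc n) powr (- s)) sums L s"
      "\<And>s. Re s > 1 \<Longrightarrow> (\<lambda>n. - of_real (lcoef (Suc n)) * of_real (ln (real (Suc n))) * of_nat (Suc n) powr (- s)) sums L' s"
      "\<And>s. Re s > 1 \<Longrightarrow> (L has_field_derivative L' s) (at s)"
    by blast
  have "\<exists>Z Z'. \<forall>s. Re s > 1 \<longrightarrow> (\<lambda>n. 1 * of_nat (Suc n) powr (- s)) sums Z s \<and>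
      (\<lambda>n. - 1 * of_real (ln (real (Suc n))) * of_nat (Suc n) powr (- s)) sums Z' s \<and>
      (Z has_field_derivative Z' s) (at s)"
    by (rule bounded_dirichlet_series) simp
  then obtain Z Z' where Z: "\<And>s. Re s > 1 \<Longrightarrow> (\<lambda>n. of_nat (Suc n) powr (- s)) sums Z s"
      "\<And>s. Re s > 1 \<Longrightarrow> (\<lambda>n. - 1 * of_real (ln (real (Suc n))) * of_nat (Suc n) powr (- s)) sums Z' s"
      "\<And>s. Re s > 1 \<Longrightarrow> (Z has_field_derivative Z' s) (at s)"
    unfolding mult_1_left by blast
  have eL: "L s = log_dseries s" and eZ: "Z s = dseries s" if "Re s > 1" for s
    using L(1)[OF that] Z(1)[OF that] log_dseries_sums[OF that] dseries(2)[OF that]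
    by (auto intro: sums_unique2)
  have dL: "(log_dseries has_field_derivative L' s) (at s)"
    by (rule has_field_derivative_transform_within_open[OF L(3)[OF s] open_half[of 1]]) (use s eL in auto)
  have dZ: "(dseries has_field_derivative Z' s) (at s)"
    by (rule has_field_derivative_transform_within_open[OF Z(3)[OF s] open_half[of 1]]) (use s eZ in auto)
  have "(\<lambda>n. - (- of_real (lcoef (Suc n)) * of_real (ln (real (Suc n))) * of_nat (Suc n) powr (- s))) sums (- L' s)"
    by (rule sums_minus[OF L(2)[OF s]])
  moreover have "- (- of_real (lcoef (Suc n)) * of_real (ln (real (Suc n))) * of_nat (Suc n) powr (- s))
      = mangoldt (Suc n) * of_nat (Suc n) powr (- s)" for n
  proof -
    have "of_real (lcoef (Suc n)) * of_real (ln (real (Suc n))) = (mangoldt (Suc n) :: complex)"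
      unfolding of_real_mult[symmetric] lcoef_mult_ln by simp
    then show ?thesis by simp
  qed
  ultimately have "(\<lambda>n. mangoldt (Suc n) * of_nat (Suc n) powr (- s)) sums (- L' s)" by (simp only:)
  then have M: "(\<lambda>n. mangoldt n * of_nat n powr (- s)) sums (- L' s)"
    by (subst (asm) sums_Suc_iff) simp
  have "(\<lambda>n. of_nat (Suc n) powr (- s)) sums dseries s" by (rule dseries(2)[OF s])
  then have ZZ: "(\<lambda>n. of_nat n powr (- s)) sums dseries s"
    by (subst (asm) sums_Suc_iff) simp
  have sZ: "summable (\<lambda>n. cmod (of_nat n powr (- s)))"
  proof -
    have "summable (\<lambda>n. cmod (of_nat (Suc n) powr (- s)))"
      unfolding norm_of_nat_Suc_powr using s by (intro summable_Suc_powr) auto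
    then show ?thesis by (subst (asm) summable_Suc_iff)
  qed
  \<comment> \<open>Here \<Lambda>(n) \<le> log n \<le> n^d / d, with d half the distance of Re s
    from 1, so a convergent exponent is left.\<close>
  have sM: "summable (\<lambda>n. cmod (mangoldt n * of_nat n powr (- s)))"
  proof -
    define d where "d = (Re s - 1) / 2"
    have d: "d > 0" using s by (simp add: d_def)
    have "summable (\<lambda>n. cmod (mangoldt (Suc n) * of_nat (Suc n) powr (- s)))"
    proof (rule summable_comparison_test'[of "\<lambda>n. 1 / d * real (Suc n) powr (d - Re s)" 0])
      show "summable (\<lambda>n. 1 / d * real (Suc n) powr (d - Re s))"
        by (intro summable_mult summable_Suc_powr) (use s in \<open>simp add: d_def field_simps\<close>)
      fix n
      have "cmod (mangoldt (Suc n) * of_nat (Suc n) powr (- s)) = mangoldt (Suc n) * real (Suc n) powr (- Re s)"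
        unfolding norm_mult norm_of_nat_Suc_powr by simp
      also have "\<dots> \<le> (real (Suc n) powr d / d) * real (Suc n) powr (- Re s)"
      proof (rule mult_right_mono)
        have "ln (real (Suc n)) \<le> real (Suc n) powr d / d" using d by (intro ln_powr_bound) auto
        then show "mangoldt (Suc n) \<le> real (Suc n) powr d / d" using mangoldt_le[of "Suc n"] by linarith
      qed simp
      also have "\<dots> = 1 / d * real (Suc n) powr (d - Re s)"
        by (simp add: powr_add[symmetric] del: of_nat_Suc)
      finally show "norm (cmod (mangoldt (Suc n) * of_nat (Suc n) powr (- s))) \<le> 1 / d * real (Suc n) powr (d - Re s)"
        by simp
    qed
    then show ?thesis by (subst (asm) summable_Suc_iff)
  qed
  have "(\<lambda>n. of_real (ln (real n)) * of_nat n powr (- s)) sums (- L' s * dseries s)"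
    by (rule mangoldt_dirichlet_product[OF M sM ZZ sZ])
  then have "(\<lambda>n. of_real (ln (real (Suc n))) * of_nat (Suc n) powr (- s)) sums (- L' s * dseries s)"
    by (subst sums_Suc_iff) simp
  from sums_minus[OF this] Z(2)[OF s] have "Z' s = L' s * dseries s"
    by (intro sums_unique2[of _ "Z' s"]) auto
  then show ?thesis using dL dZ by (intro exI[of _ "- L' s"]) auto
qed

text \<open>Both sides satisfy the same first-order linear equation, so the quotient W is constant;
  its limit along the integers is 1.\<close>

lemma exp_log_dseries:
  assumes s: "Re s > 1"
  shows "exp (log_dseries s) = dseries s"
proof -
  define W where "W = (\<lambda>s. dseries s * exp (- log_dseries s))"
  have dW: "(W has_field_derivative 0) (at s)" if s: "Re s > 1" for s
  proof -
    obtain D where D: "(log_dseries has_field_derivative - D) (at s)" "(dseries has_field_derivative - (D * dseries s)) (at s)"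
      using log_dseries_deriv[OF s] by blast
    have "(W has_field_derivative - (D * dseries s) * exp (- log_dseries s)
        + exp (- log_dseries s) * (- (- D)) * dseries s) (at s)"
      unfolding W_def by (intro DERIV_mult DERIV_fun_exp DERIV_minus D)
    then show ?thesis by (simp add: algebra_simps)
  qed
  have "\<exists>k. \<forall>s\<in>{s. Re s > 1}. W s = k"
    by (rule has_field_derivative_zero_constant)
       (use dW in \<open>auto intro: convex_halfspace_Re_gt has_field_derivative_at_within\<close>)
  then obtain k where k: "\<And>s. Re s > 1 \<Longrightarrow> W s = k" by auto
  define C where "C = (\<Sum>n. real (Suc n) powr (-2))"
  have lim0: "(\<lambda>n. 2 powr (2 - real (n + 2)) * C) \<longlonglongrightarrow> 0"
    by real_asymp
  have L: "(\<lambda>n. log_dseries (of_real (real (n + 2)))) \<longlonglongrightarrow> 0"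
  proof (rule Lim_null_comparison[OF always_eventually lim0], rule allI)
    fix n
    have "cmod (log_dseries (of_real (real (n+2))) - of_real (lcoef (Suc 0))) \<le> 2 powr (2 - real (n+2)) * C"
      unfolding C_def using log_dseries_sums[of "of_real (real (n+2))"] norm_lcoef
      dirichlet_series_at_infinity[where c = "\<lambda>n. of_real (lcoef (Suc n))" and s = "of_real (real (n+2))"] by auto
    then show "cmod (log_dseries (of_real (real (n+2)))) \<le> 2 powr (2 - real (n+2)) * C"
      by (simp add: lcoef_def)
  qed
  have "(\<lambda>n. dseries (of_real (real (n + 2))) - 1) \<longlonglongrightarrow> 0"
  proof (rule Lim_null_comparison[OF always_eventually lim0], rule allI)
    fix n
    show "cmod (dseries (of_real (real (n+2))) - 1) \<le> 2 powr (2 - real (n+2)) * C"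
      unfolding C_def using dseries(2)[of "of_real (real (n+2))"]
      dirichlet_series_at_infinity[where c = "\<lambda>n. 1" and s = "of_real (real (n+2))"] by auto
  qed
  then have Z: "(\<lambda>n. dseries (of_real (real (n + 2)))) \<longlonglongrightarrow> 1"
    by (simp add: LIM_zero_iff)
  have "(\<lambda>n. W (of_real (real (n + 2)))) \<longlonglongrightarrow> 1 * exp (- 0)"
    unfolding W_def by (intro tendsto_intros L Z)
  moreover have "(\<lambda>n. W (of_real (real (n + 2)))) = (\<lambda>n. k)"
    by (intro ext k) auto
  ultimately have "k = 1" by (simp add: LIMSEQ_const_iff)
  then have "dseries s * exp (- log_dseries s) = 1" using k[OF s] by (simp add: W_def)
  then show ?thesis by (simp add: exp_minus field_simps)
qed

lemma log_dseries_holomorphic: "log_dseries holomorphic_on {s. Re s > 1}"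
  using log_dseries_deriv by (auto simp: holomorphic_on_open[OF open_half])

lemma log_dseries_bound:
  assumes "\<sigma> > 1" "Re s \<ge> \<sigma>"
  shows "cmod (log_dseries s) \<le> (\<Sum>n. real (Suc n) powr (- \<sigma>))"
proof -
  have s: "Re s > 1" using assms by simp
  have "cmod (log_dseries s) = cmod (\<Sum>n. of_real (lcoef (Suc n)) * of_nat (Suc n) powr (- s))"
    by (simp add: log_dseries_def)
  also have "\<dots> \<le> (\<Sum>n. real (Suc n) powr (- \<sigma>))"
  proof (rule norm_suminf_le)
    fix n
    have "cmod (of_real (lcoef (Suc n)) * of_nat (Suc n) powr (- s)) \<le> 1 * real (Suc n) powr (- Re s)"
      unfolding norm_mult norm_of_nat_Suc_powr
      using norm_lcoef[of "Suc n"] by (intro mult_mono) auto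
    also have "\<dots> \<le> real (Suc n) powr (- \<sigma>)" using assms by (simp add: powr_mono)
    finally show "cmod (of_real (lcoef (Suc n)) * of_nat (Suc n) powr (- s)) \<le> real (Suc n) powr (- \<sigma>)" .
    show "summable (\<lambda>n. real (Suc n) powr (- \<sigma>))" using assms by (intro summable_Suc_powr) auto
  qed
  finally show ?thesis .
qed

section \<open>The entire function \<open>(s - 1) \<zeta>(s)\<close>\<close>

lemma nat_powr_exp: "of_nat (Suc n) powr (- s :: complex) = exp (- s * of_real (ln (real (Suc n))))"
proof -
  have "of_nat (Suc n) \<noteq> (0::complex)" by (simp del: of_nat_Suc)
  moreover have "Ln (of_nat (Suc n)) = of_real (ln (real (Suc n)))"
    using Ln_of_real[of "real (Suc n)"] by (simp del: of_nat_Suc)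
  ultimately show ?thesis by (simp add: powr_def del: of_nat_Suc)
qed

definition zreg :: "complex \<Rightarrow> complex" where
  "zreg = (SOME F. F holomorphic_on UNIV \<and> (\<forall>s. Re s > 1 \<longrightarrow> F s = (s - 1) * dseries s))"

lemma zreg:
  shows zreg_holomorphic: "zreg holomorphic_on UNIV"
    and zreg_dseries: "Re s > 1 \<Longrightarrow> zreg s = (s - 1) * dseries s"
  using someI_ex[OF continuation_exists] unfolding zreg_def by auto

text \<open>At s = 1 division by 0 gives 0, which is the value prescribed in \<open>is_zeta\<close>;
  the rest is uniqueness of the continuation.\<close>

lemma zeta_eq_zreg: "zeta s = zreg s / (s - 1)"
proof -
  have "is_zeta (\<lambda>s. zreg s / (s - 1))"
    unfolding is_zeta_def
  proof (intro conjI allI impI)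
    show "(\<lambda>s. zreg s / (s - 1)) holomorphic_on - {1}"
      by (intro holomorphic_intros holomorphic_on_subset[OF zreg_holomorphic]) auto
    fix s :: complex assume s: "Re s > 1"
    then have "s \<noteq> 1" by auto
    then show "zreg s / (s - 1) = (\<Sum>n. 1 / of_nat (Suc n) powr s)"
      unfolding dseries_def[symmetric] zreg_dseries[OF s] by simp
  qed simp
  then have "zeta = (\<lambda>s. zreg s / (s - 1))" using is_zeta_ex1 is_zeta_zeta by blast
  then show ?thesis by (rule fun_cong)
qed

section \<open>Polynomial growth in vertical strips\<close>

lemma binomial_remainder_sharp:
  assumes a: "Re a \<le> real (Suc N)" and x: "0 \<le> x" "x \<le> 1"
  shows "cmod ((1 + of_real x) powr a - (\<Sum>j\<le>N. ffact j a / fact j * of_real x ^ j))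
           \<le> cmod (ffact (Suc N) a) * x ^ Suc N"
proof -
  define f where "f = (\<lambda>i z. ffact i a * (1 + z) powr (a - of_nat i))"
  define B where "B = cmod (ffact (Suc N) a)"
  have B0: "B \<ge> 0" by (simp add: B_def)
  let ?S = "complex_of_real ` {0..1}"
  have "cmod (f 0 (of_real x) - (\<Sum>i\<le>N. f i 0 * (of_real x - 0) ^ i / fact i))
          \<le> B * cmod (of_real x - 0) ^ Suc N / fact N"
  proof (rule complex_Taylor[where S = ?S])
    show "convex ?S"
      by (intro convex_linear_image) (auto intro: linearI simp: scaleR_conv_of_real)
    show "(f i has_field_derivative f (Suc i) z) (at z within ?S)" if z: "z \<in> ?S" for i z
    proof -
      from z obtain y where y: "z = of_real y" "y \<ge> 0" by auto
      have "1 + z \<notin> \<real>\<^sub>\<le>\<^sub>0"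
        using y by (auto simp: complex_nonpos_Reals_iff)
      then have "(f i has_field_derivative
          ffact i a * ((a - of_nat i) * (1 + z) powr (a - of_nat i - 1))) (at z within ?S)"
        unfolding f_def by (auto intro!: derivative_eq_intros)
      then show ?thesis
        by (simp add: f_def ffact_def algebra_simps)
    qed
    show "cmod (f (Suc N) z) \<le> B" if z: "z \<in> ?S" for z
    proof -
      from z obtain y where y: "z = of_real y" "y \<ge> 0" "y \<le> 1" by auto
      have eq: "1 + z = of_real (1 + y)" using y by simp
      have "cmod ((1 + z) powr (a - of_nat (Suc N))) = (1 + y) powr (Re a - real (Suc N))"
        unfolding eq by (subst norm_powr_real_powr) (use y in auto)
      \<comment> \<open>Since Re a \<le> N + 1, the exponent is nonpositive. This avoids the factor
        \<open>2 powr R\<close> of \<open>binomial_remainder\<close>, exponential in |a|, and leaves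
        a bound polynomial in |a|.\<close>
      also have "\<dots> \<le> (1 + y) powr 0"
        using y a by (intro powr_mono) auto
      finally have 1: "cmod ((1 + z) powr (a - of_nat (Suc N))) \<le> 1" using y by simp
      show ?thesis
        unfolding f_def B_def norm_mult
        using mult_left_mono[OF 1, of "cmod (ffact (Suc N) a)"] by simp
    qed
    show "0 \<in> ?S" by (auto intro!: image_eqI[of _ _ 0])
    show "of_real x \<in> ?S" using x by auto
  qed
  moreover have "B * cmod (of_real x - 0) ^ Suc N / fact N \<le> B * x ^ Suc N"
  proof -
    have "B * x ^ Suc N / fact N \<le> B * x ^ Suc N / 1"
      using B0 x by (intro divide_left_mono) (auto simp: fact_ge_1)
    then show ?thesis using x by simp
  qed
  ultimately show ?thesis
    by (simp add: f_def B_def ffact_def mult.commute mult.left_commute)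
qed

text \<open>The margin in 5/4 - N leaves the exponent - 5/4, so the sum converges with a constant
  independent of s, and |s| enters only through a polynomial of degree N + 1.\<close>

lemma zrem_suminf_bound:
  assumes s: "Re s \<ge> 5/4 - real N"
  shows "cmod (\<Sum>n. zrem N n s) \<le> (cmod (1 - s) + real (Suc N)) ^ Suc N * (\<Sum>n. real (Suc n) powr (- (5/4)))"
proof -
  define C where "C = (cmod (1 - s) + real (Suc N)) ^ Suc N"
  have sm: "summable (\<lambda>n. real (Suc n) powr (- (5/4)))" by (intro summable_Suc_powr) auto
  have "cmod (\<Sum>n. zrem N n s) \<le> (\<Sum>n. C * real (Suc n) powr (- (5/4)))"
  proof (rule norm_suminf_le[OF _ summable_mult[OF sm]])
    fix n
    have "cmod ((1 + of_real (1 / real (Suc n))) powr (1 - s)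
        - (\<Sum>j\<le>N. ffact j (1 - s) / fact j * of_real (1 / real (Suc n)) ^ j))
        \<le> cmod (ffact (Suc N) (1 - s)) * (1 / real (Suc n)) ^ Suc N"
    proof (rule binomial_remainder_sharp)
      show "Re (1 - s) \<le> real (Suc N)" using s by simp
    qed auto
    also have "\<dots> \<le> C * (1 / real (Suc n)) ^ Suc N"
      unfolding C_def by (intro mult_right_mono norm_ffact_le) auto
    finally have "cmod (zrem N n s) \<le> real (Suc n) powr (1 - Re s) * (C * (1 / real (Suc n)) ^ Suc N)"
      unfolding zrem_def norm_mult norm_of_nat_Suc_powr minus_complex.sel one_complex.sel by (rule mult_left_mono) simp
    also have "(1 / real (Suc n)) ^ Suc N = real (Suc n) powr (- real (Suc N))"
      by (simp only: powr_minus powr_realpow of_nat_0_less_iff zero_less_Suc)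
         (simp add: power_one_over inverse_eq_divide)
    also have "real (Suc n) powr (1 - Re s) * (C * real (Suc n) powr (- real (Suc N)))
        = C * real (Suc n) powr (- Re s - real N)"
      by (simp add: powr_add[symmetric] algebra_simps)
    also have "\<dots> \<le> C * real (Suc n) powr (- (5/4))"
      using s by (intro mult_left_mono powr_mono) (auto simp: C_def)
    finally show "cmod (zrem N n s) \<le> C * real (Suc n) powr (- (5/4))" .
  qed
  also have "\<dots> = C * (\<Sum>n. real (Suc n) powr (- (5/4)))" by (rule suminf_mult[OF sm])
  finally show ?thesis by (simp add: C_def)
qed

lemma zreg_eq_zrem_1:
  assumes s: "Re s > 0"
  shows "zreg s = 1 + (\<Sum>n. zrem 1 n s)"
proof (rule analytic_continuation_open[of "{s. Re s > 1}" "{s. Re s > 0}" zreg "\<lambda>s. 1 + (\<Sum>n. zrem 1 n s)"])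
  have "(2::complex) \<in> {s. Re s > 1}" by simp
  then show "{s::complex. Re s > 1} \<noteq> {}" by blast
  show "zreg holomorphic_on {s. Re s > 0}" by (rule holomorphic_on_subset[OF zreg_holomorphic]) auto
  show "(\<lambda>s. 1 + (\<Sum>n. zrem 1 n s)) holomorphic_on {s. Re s > 0}"
    using zrem_sum(1)[of 1] by (intro holomorphic_intros) auto
  show "zreg z = 1 + (\<Sum>n. zrem 1 n z)" if "z \<in> {s. Re s > 1}" for z
  proof -
    have e: "(\<Sum>n. zrem 1 n z) = - 1 - (1 - z) * dseries z"
      using that zrem_dseries[of z 1] by (simp add: ffact_def)
    have "zreg z = (z - 1) * dseries z" using that zreg_dseries by simp
    then show ?thesis unfolding e by (simp add: algebra_simps)
  qed
qed (use s in \<open>auto simp: open_half intro: convex_connected convex_halfspace_Re_gt\<close>)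

lemma zreg_eq_zrem_2:
  assumes s: "Re s > - 1"
  shows "zreg s = 1 + (\<Sum>n. zrem 2 n s) - (1 - s) / 2 * zreg (s + 1)"
proof (rule analytic_continuation_open[of "{s. Re s > 1}" "{s. Re s > - 1}" zreg
      "\<lambda>s. 1 + (\<Sum>n. zrem 2 n s) - (1 - s) / 2 * zreg (s + 1)"])
  have "(2::complex) \<in> {s. Re s > 1}" by simp
  then show "{s::complex. Re s > 1} \<noteq> {}" by blast
  show "zreg holomorphic_on {s. Re s > - 1}" by (rule holomorphic_on_subset[OF zreg_holomorphic]) auto
  have "(zreg \<circ> (\<lambda>s. s + 1)) holomorphic_on {s. Re s > - 1}"
    by (rule holomorphic_on_compose_gen[OF _ zreg_holomorphic]) (auto intro!: holomorphic_intros)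
  then show "(\<lambda>s. 1 + (\<Sum>n. zrem 2 n s) - (1 - s) / 2 * zreg (s + 1)) holomorphic_on {s. Re s > - 1}"
    using zrem_sum(1)[of 2] by (intro holomorphic_intros) (auto simp: o_def)
  show "zreg z = 1 + (\<Sum>n. zrem 2 n z) - (1 - z) / 2 * zreg (z + 1)" if "z \<in> {s. Re s > 1}" for z
  proof -
    have *: "(\<Sum>j=1..2. f j) = f 1 + f 2" for f :: "nat \<Rightarrow> complex" by (simp add: numeral_2_eq_2)
    have "ffact 1 (1 - z) = 1 - z" by (simp add: ffact_def)
    moreover
    have "ffact 2 (1 - z) = (1 - z) * (- z)" by (simp add: ffact_def numeral_2_eq_2)
    ultimately have e: "(\<Sum>n. zrem 2 n z) = - 1 - ((1 - z) * dseries z + (1 - z) * (- z) / 2 * dseries (z + 1))"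
      using that zrem_dseries[of z 2] unfolding * by (simp add: add.commute)
    have e': "zreg z = (z - 1) * dseries z" "zreg (z + 1) = z * dseries (z + 1)"
      using that zreg_dseries[of z] zreg_dseries[of "z + 1"] by auto
    show ?thesis unfolding e e' by (simp add: field_simps)
  qed
qed (use s in \<open>auto simp: open_half intro: convex_connected convex_halfspace_Re_gt\<close>)

text \<open>The abscissa - 3/4 = 5/4 - 2 is the leftmost one in the disc of radius 2 about 5/4 + it
  used in \<open>Re_g'_lower\<close>. It is also the exact limit of \<open>zrem_suminf_bound\<close>
  for N = 2, and s + 1 then meets the limit for N = 1.\<close>

lemma zreg_bound:
  obtains C where "C \<ge> 1" "\<And>s. Re s \<ge> - 3/4 \<Longrightarrow> cmod (zreg s) \<le> C * (cmod s + 4) ^ 3"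
proof -
  define C where "C = (\<Sum>n. real (Suc n) powr (- (5/4)))"
  have sm: "summable (\<lambda>n. real (Suc n) powr (- (5/4)))" by (intro summable_Suc_powr) auto
  have "(\<Sum>n<1. real (Suc n) powr (- (5/4))) \<le> C"
    unfolding C_def by (rule sum_le_suminf[OF sm]) auto
  then have C: "C \<ge> 1" by simp
  have "cmod (zreg s) \<le> 3 * C * (cmod s + 4) ^ 3" if s: "Re s \<ge> - 3/4" for s
  proof -
    define x where "x = cmod s + 4"
    have x: "x \<ge> 4" by (simp add: x_def)
    have 1: "cmod (zreg (s + 1)) \<le> 2 * C * x\<^sup>2"
    proof -
      have "cmod (zreg (s + 1)) \<le> 1 + cmod (\<Sum>n. zrem 1 n (s + 1))"
        using s norm_triangle_ineq[of 1 "\<Sum>n. zrem 1 n (s + 1)"] by (subst zreg_eq_zrem_1) auto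
      also have "cmod (\<Sum>n. zrem 1 n (s + 1)) \<le> (cmod s + 2)\<^sup>2 * C"
        using zrem_suminf_bound[of 1 "s + 1"] s by (simp add: C_def numeral_2_eq_2)
      also have "\<dots> \<le> x\<^sup>2 * C" using C by (intro mult_right_mono power_mono) (auto simp: x_def)
      also have "1 \<le> x\<^sup>2 * C"
        using mult_mono[of 1 "x\<^sup>2" 1 C] C x by simp
      finally show ?thesis by simp
    qed
    have 2: "cmod (\<Sum>n. zrem 2 n s) \<le> x ^ 3 * C"
    proof -
      have "cmod (\<Sum>n. zrem 2 n s) \<le> (cmod (1 - s) + 3) ^ 3 * C"
        using zrem_suminf_bound[of 2 s] s by (simp add: C_def numeral_3_eq_3)
      also have "\<dots> \<le> x ^ 3 * C"
        using C norm_triangle_ineq4[of 1 s] by (intro mult_right_mono power_mono) (auto simp: x_def)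
      finally show ?thesis .
    qed
    have 3: "cmod ((1 - s) / 2 * zreg (s + 1)) \<le> x / 2 * (2 * C * x\<^sup>2)"
      unfolding norm_mult norm_divide
      using C x norm_triangle_ineq4[of 1 s] 1 by (intro mult_mono) (auto simp: x_def)
    have "cmod (zreg s) \<le> 1 + cmod (\<Sum>n. zrem 2 n s) + cmod ((1 - s) / 2 * zreg (s + 1))"
      using s norm_triangle_ineq4[of "1 + (\<Sum>n. zrem 2 n s)" "(1 - s) / 2 * zreg (s + 1)"]
        norm_triangle_ineq[of 1 "\<Sum>n. zrem 2 n s"]
      by (subst zreg_eq_zrem_2) auto
    also have "\<dots> \<le> x ^ 3 * C + x ^ 3 * C + x / 2 * (2 * C * x\<^sup>2)"
      using 2 3 mult_mono[of 1 "x ^ 3" 1 C] C x by (intro add_mono) auto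
    also have "\<dots> = 3 * C * x ^ 3" by (simp add: power2_eq_square power3_eq_cube)
    finally show ?thesis by (simp add: x_def)
  qed
  then show ?thesis using that[of "3 * C"] C by auto
qed

section \<open>Zeros of (s - 1) zeta(s) to the right of the critical line\<close>

lemma zreg_1: "zreg 1 = 1"
proof -
  \<comment> \<open>At s = 1 the powers with exponent 1 - s are all 1 and the correction term has
    the factor 1 - s, so every remainder vanishes; zeta has residue 1.\<close>
  have "zrem 1 n 1 = 0" for n
    unfolding zrem_eq by (simp add: ffact_def powr_def del: of_nat_Suc)
  then show ?thesis by (subst zreg_eq_zrem_1) auto
qed

lemma zreg_nonzero_gt1: "Re s > 1 \<Longrightarrow> zreg s \<noteq> 0"
  using exp_log_dseries[of s] zreg_dseries[of s] exp_not_eq_zero[of "log_dseries s"] by force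

text \<open>Mertens' inequality: the terms of the three logarithms combine with weight 3 + 4 cos y +
  cos 2y = 2 (1 + cos y)^2, where y = t log n.\<close>

lemma three_four_one:
  assumes x: "x > 1"
  shows "cmod (dseries (Complex x 0)) ^ 3 * cmod (dseries (Complex x t)) ^ 4 * cmod (dseries (Complex x (2 * t))) \<ge> 1"
proof -
  define v where "v = (\<lambda>n u. Re (of_real (lcoef (Suc n)) * of_nat (Suc n) powr (- Complex x u)))"
  have v: "(\<lambda>n. v n u) sums Re (log_dseries (Complex x u))" for u
    unfolding v_def by (rule sums_Re[OF log_dseries_sums]) (use x in auto)
  have "v n u = lcoef (Suc n) * real (Suc n) powr (- x) * cos (u * ln (real (Suc n)))" for n u
    unfolding v_def nat_powr_exp by (simp add: Re_exp powr_def mult.assoc del: of_nat_Suc)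
  then have eq: "3 * v n 0 + 4 * v n t + v n (2 * t)
      = lcoef (Suc n) * real (Suc n) powr (- x) * (3 + 4 * cos (t * ln (real (Suc n))) + cos (2 * (t * ln (real (Suc n)))))" for n
    by (simp add: distrib_left mult.commute mult.left_commute mult.assoc del: of_nat_Suc)
  have nn: "0 \<le> 3 * v n 0 + 4 * v n t + v n (2 * t)" for n
  proof -
    have sq: "3 + 4 * cos y + cos (2 * y) = 2 * (1 + cos y)\<^sup>2" for y :: real
      unfolding cos_double_cos by (simp add: power2_eq_square algebra_simps)
    show ?thesis unfolding eq sq by (intro mult_nonneg_nonneg lcoef_nonneg) auto
  qed
  have sm: "(\<lambda>n. 3 * v n 0 + 4 * v n t + v n (2 * t)) sums
      (3 * Re (log_dseries (Complex x 0)) + 4 * Re (log_dseries (Complex x t)) + Re (log_dseries (Complex x (2 * t))))"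
    by (intro sums_add sums_mult v)
  have ge: "3 * Re (log_dseries (Complex x 0)) + 4 * Re (log_dseries (Complex x t)) + Re (log_dseries (Complex x (2 * t))) \<ge> 0"
    by (rule sums_le[OF nn sums_zero sm])
  have n: "cmod (dseries (Complex x u)) = exp (Re (log_dseries (Complex x u)))" for u
    using exp_log_dseries[of "Complex x u"] x norm_exp_eq_Re[of "log_dseries (Complex x u)"] by simp
  have "cmod (dseries (Complex x 0)) ^ 3 * cmod (dseries (Complex x t)) ^ 4 * cmod (dseries (Complex x (2 * t)))
     = exp (3 * Re (log_dseries (Complex x 0)) + 4 * Re (log_dseries (Complex x t)) + Re (log_dseries (Complex x (2 * t))))"
    unfolding n exp_add exp_of_nat_mult[symmetric] by simp
  also have "\<dots> \<ge> 1" using ge by simp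
  finally show ?thesis .
qed

lemma zreg_nonzero_1_line: "zreg (Complex 1 t) \<noteq> 0"
proof (cases "t = 0")
  case True
  then show ?thesis using zreg_1 by (simp add: one_complex.code[symmetric])
next
  case t: False
  show ?thesis
  proof
    assume z: "zreg (Complex 1 t) = 0"
    have dz: "(zreg has_field_derivative deriv zreg s) (at s)" for s
      by (rule holomorphic_derivI[OF zreg_holomorphic]) auto
    have cz: "isCont zreg s" for s using dz by (rule DERIV_isCont)
    have line: "((\<lambda>x. Complex x u) \<longlongrightarrow> Complex 1 u) (at_right 1)" for u
      by (auto intro!: tendsto_eq_intros simp: Complex_eq)
    have lim: "((\<lambda>x. zreg (Complex x u)) \<longlongrightarrow> zreg (Complex 1 u)) (at_right 1)" for u
      by (rule isCont_tendsto_compose[OF cz line])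
    have ne: "\<forall>\<^sub>F x in at_right 1. Complex x t \<noteq> Complex 1 t"
      by (auto simp: eventually_at_filter)
    have "filterlim (\<lambda>x. Complex x t) (at (Complex 1 t)) (at_right 1)"
      using line ne by (simp add: filterlim_at)
    moreover have "((\<lambda>s. (zreg s - zreg (Complex 1 t)) / (s - Complex 1 t)) \<longlongrightarrow> deriv zreg (Complex 1 t)) (at (Complex 1 t))"
      using dz by (simp add: has_field_derivative_iff)
    ultimately have lim': "((\<lambda>x. (zreg (Complex x t) - zreg (Complex 1 t)) / (Complex x t - Complex 1 t)) \<longlongrightarrow> deriv zreg (Complex 1 t)) (at_right 1)"
      by (rule filterlim_compose[rotated])
    \<comment> \<open>Q is the product of \<open>three_four_one\<close> rewritten: three factors 1 /
      (x - 1) from the pole against four factors x - 1 from the supposed zero leave one x - 1. So Q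
      tends to 0, although it can never be less than 1.\<close>
    define Q where "Q = (\<lambda>x. (x - 1) * (cmod (zreg (Complex x 0)) ^ 3 *
        (cmod ((zreg (Complex x t) - zreg (Complex 1 t)) / (Complex x t - Complex 1 t)) / cmod (Complex x t - 1)) ^ 4 *
        (cmod (zreg (Complex x (2 * t))) / cmod (Complex x (2 * t) - 1))))"
    have nz: "Complex 1 t - 1 \<noteq> 0" "Complex 1 (2 * t) - 1 \<noteq> 0" using t by (auto simp: complex_eq_iff)
    have "(Q \<longlongrightarrow> (1 - 1) * (cmod (zreg (Complex 1 0)) ^ 3 *
        (cmod (deriv zreg (Complex 1 t)) / cmod (Complex 1 t - 1)) ^ 4 *
        (cmod (zreg (Complex 1 (2 * t))) / cmod (Complex 1 (2 * t) - 1)))) (at_right 1)"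
      unfolding Q_def using nz by (intro tendsto_intros lim lim' line) auto
    then have "(Q \<longlongrightarrow> 0) (at_right 1)" by simp
    then have "\<forall>\<^sub>F x in at_right 1. Q x < 1"
      by (rule order_tendstoD) simp
    moreover have "\<forall>\<^sub>F x in at_right 1. x > (1::real)" by (simp add: eventually_at_filter)
    ultimately have "\<forall>\<^sub>F x in at_right (1::real). False"
    proof eventually_elim
      case (elim x)
      have ds: "dseries (Complex x u) = zreg (Complex x u) / (Complex x u - 1)" for u
      proof -
        have "Complex x u - 1 \<noteq> 0" using elim by (auto simp: complex_eq_iff)
        then show ?thesis using zreg_dseries[of "Complex x u"] elim by simp
      qed
      have c: "Complex x t - Complex 1 t = of_real (x - 1)" "Complex x 0 - 1 = of_real (x - 1)"
        by (auto simp: complex_eq_iff)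
      have c': "cmod (of_real (x - 1)) = x - 1" using elim by (simp only: norm_of_real)
      have "Q x = cmod (dseries (Complex x 0)) ^ 3 * cmod (dseries (Complex x t)) ^ 4 * cmod (dseries (Complex x (2 * t)))"
      proof -
        have X: "e * (a ^ 3 * (b / e / d) ^ 4 * r) = (a / e) ^ 3 * (b / d) ^ 4 * r" if "e \<noteq> 0" for a b d e r :: real
        proof -
          have "(b / e / d) ^ 4 = (b / d) ^ 4 / e ^ 4" by (simp add: power_divide power_mult_distrib mult.commute)
          moreover have "(a / e) ^ 3 = a ^ 3 * (e / e ^ 4)"
            using that by (simp add: power_divide power4_eq_xxxx power3_eq_cube)
          ultimately show ?thesis by simp
        qed
        show ?thesis unfolding Q_def ds z norm_divide c c' diff_zero by (rule X) (use elim in simp)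
      qed
      then show False using three_four_one[of x t] elim by simp
    qed
    then show False by simp
  qed
qed

text \<open>\<open>riemann_hypothesis\<close> speaks only of the open critical strip; the line Re s
  = 1 and the half-plane beyond it are excluded unconditionally.\<close>

lemma zreg_zero_imp_Re_le:
  assumes RH: riemann_hypothesis and z: "zreg s = 0"
  shows "Re s \<le> 1/2"
proof (rule ccontr)
  assume "\<not> Re s \<le> 1/2"
  then have s: "Re s > 1/2" by simp
  have "Re s \<noteq> 1" using zreg_nonzero_1_line[of "Im s"] z by (metis complex.collapse)
  then consider "Re s > 1" | "Re s < 1" by linarith
  then show False
  proof cases
    case 1
    then show False using zreg_nonzero_gt1 z by blast
  next
    case 2
    have "zeta s = 0" by (simp add: zeta_eq_zreg z)
    then show False using RH s 2 unfolding riemann_hypothesis_def by force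
  qed
qed

section \<open>The smoothing kernel\<close>

lemma norm_integral_le:
  fixes f :: "'b \<Rightarrow> 'a :: {banach, second_countable_topology}"
  assumes f: "integrable M f" and g: "integrable M g" and le: "\<And>x. norm (f x) \<le> g x"
  shows "norm (\<integral>x. f x \<partial>M) \<le> (\<integral>x. g x \<partial>M)"
proof -
  have "norm (\<integral>x. f x \<partial>M) \<le> (\<integral>x. norm (f x) \<partial>M)" by (rule integral_norm_bound)
  also have "\<dots> \<le> (\<integral>x. g x \<partial>M)"
    by (rule integral_mono) (use f g le in auto)
  finally show ?thesis .
qed

lemma integrable_quadratic_decay:
  fixes f :: "real \<Rightarrow> 'a :: {banach, second_countable_topology}"
  assumes f: "f \<in> borel_measurable borel" and bd: "\<And>x. norm (f x) \<le> C / (1 + x\<^sup>2)"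
  shows "integrable lborel f"
proof -
  have "integrable lborel (\<lambda>x::real. inverse (1 + x\<^sup>2))"
    using integrable_inverse_1_plus_square by (simp add: set_integrable_def einterval_def)
  then have "integrable lborel (\<lambda>x::real. C * inverse (1 + x\<^sup>2))" by (rule integrable_mult_right)
  then show ?thesis
    by (rule Bochner_Integration.integrable_bound)
       (use f bd in \<open>auto simp: divide_inverse intro!: AE_I2 order_trans[OF _ abs_ge_self]\<close>)
qed

text \<open>Translates keep the majorant up to a factor that depends on the shift alone, which
  provides locally uniform domination.\<close>

lemma shift_quadratic_decay:
  fixes x r :: real
  shows "1 / (1 + (x + r)\<^sup>2) \<le> (2 + 2 * r\<^sup>2) / (1 + x\<^sup>2)"
proof -
  have "x\<^sup>2 \<le> 2 * (x + r)\<^sup>2 + 2 * r\<^sup>2"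
    using sum_squares_ge_zero[of "x + 2 * r" 0] by (simp add: power2_eq_square algebra_simps)
  have "0 \<le> (x + r)\<^sup>2 * r\<^sup>2" by simp
  have "1 + x\<^sup>2 \<le> (2 + 2 * r\<^sup>2) * (1 + (x + r)\<^sup>2)"
  proof -
    have e: "(2 + 2 * b) * (1 + a) = 2 + 2 * a + 2 * b + 2 * (a * b)" for a b :: real
      by (simp add: algebra_simps)
    show ?thesis unfolding e using \<open>x\<^sup>2 \<le> 2 * (x + r)\<^sup>2 + 2 * r\<^sup>2\<close> \<open>0 \<le> (x + r)\<^sup>2 * r\<^sup>2\<close> by linarith
  qed
  moreover have "1 + (x + r)\<^sup>2 > 0" "1 + x\<^sup>2 > 0" by (simp_all add: add_pos_nonneg)
  ultimately show ?thesis by (simp add: divide_le_eq pos_le_divide_eq mult.commute)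
qed

text \<open>A contour shift without contours: the integral is holomorphic in w on the strip and, by
  translation invariance, constant for real w, so the identity theorem makes it constant.\<close>

lemma integral_horizontal_shift:
  fixes \<Psi> :: "complex \<Rightarrow> complex"
  assumes hol: "\<Psi> holomorphic_on UNIV"
    and bd: "\<And>z. \<bar>Im z\<bar> \<le> a \<Longrightarrow> cmod (\<Psi> z) \<le> C / (1 + (Re z)\<^sup>2)"
    and y: "\<bar>Im w\<bar> < a"
  shows "(\<integral>v. \<Psi> (of_real v + w) \<partial>lborel) = (\<integral>v. \<Psi> (of_real v) \<partial>lborel)"
proof -
  define U where "U = {w. \<bar>Im w\<bar> < a}"
  have a: "a > 0" using y by linarith
  have U_eq: "U = {w. Im w < a} \<inter> {w. Im w > - a}" by (auto simp: U_def)
  have oU: "open U" unfolding U_eq by (intro open_Int open_halfspace_Im_lt open_halfspace_Im_gt)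
  have cU: "connected U" unfolding U_eq
    by (intro convex_connected convex_Int convex_halfspace_Im_lt convex_halfspace_Im_gt)
  have cont: "continuous_on A \<Psi>" for A
    by (rule continuous_on_subset[OF holomorphic_on_imp_continuous_on[OF hol]]) auto
  have C: "C \<ge> 0" using order_trans[OF norm_ge_zero bd[of 0]] a by simp
  define F where "F = (\<lambda>w. \<integral>v. \<Psi> (of_real v + w) \<partial>lborel)"
  have hF: "F holomorphic_on U"
    unfolding F_def
  proof (rule holomorphic_integral[OF oU])
    show "(\<lambda>s. \<Psi> (of_real x + s)) holomorphic_on U" for x
    proof -
      have "(\<Psi> \<circ> (\<lambda>s. of_real x + s)) holomorphic_on U"
        by (rule holomorphic_on_compose_gen[OF _ hol]) (auto intro!: holomorphic_intros)
      then show ?thesis by (simp add: o_def)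
    qed
    show "(\<lambda>x. \<Psi> (of_real x + s)) \<in> borel_measurable lborel" for s
    proof -
      have "continuous_on UNIV (\<lambda>x::real. \<Psi> (of_real x + s))"
        by (rule continuous_on_compose2[OF cont[of UNIV]]) (auto intro!: continuous_intros)
      then show ?thesis by (simp add: borel_measurable_continuous_onI)
    qed
    fix s assume s: "s \<in> U"
    obtain r where r: "r > 0" "cball s r \<subseteq> U" using oU s open_contains_cball by blast
    define R where "R = \<bar>Re s\<bar> + r"
    let ?h = "\<lambda>x::real. C * (2 + 2 * R\<^sup>2) / (1 + x\<^sup>2)"
    have "cmod (\<Psi> (of_real x + w)) \<le> ?h x" if w: "w \<in> cball s r" for w x
    proof -
      have "w \<in> U" using w r by blast
      then have "cmod (\<Psi> (of_real x + w)) \<le> C * (1 / (1 + (x + Re w)\<^sup>2))"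
        using bd[of "of_real x + w"] by (simp add: U_def)
      also have "\<dots> \<le> C * ((2 + 2 * (Re w)\<^sup>2) / (1 + x\<^sup>2))"
        by (intro mult_left_mono shift_quadratic_decay C)
      also have "\<dots> \<le> C * ((2 + 2 * R\<^sup>2) / (1 + x\<^sup>2))"
      proof -
        have "\<bar>Re (s - w)\<bar> \<le> r" using w abs_Re_le_cmod[of "s - w"] by (simp add: dist_norm)
        then have "\<bar>Re w\<bar> \<le> R" by (simp add: R_def)
        then have "(Re w)\<^sup>2 \<le> R\<^sup>2" by (metis power2_abs power_mono abs_ge_zero)
        then show ?thesis using C by (intro mult_left_mono divide_right_mono) auto
      qed
      finally show ?thesis by simp
    qed
    moreover have "integrable lborel ?h"
      by (rule integrable_quadratic_decay[of _ "C * (2 + 2 * R\<^sup>2)"]) (use C in auto)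
    ultimately show "\<exists>r>0. \<exists>h. cball s r \<subseteq> U \<and> integrable lborel h \<and>
        (\<forall>w\<in>cball s r. \<forall>x\<in>space lborel. cmod (\<Psi> (of_real x + w)) \<le> h x)"
      using r by blast
  qed
  have "F w - F 0 = 0"
  proof (rule analytic_continuation[of "\<lambda>w. F w - F 0" U "of_real ` {0<..<a}" 0 w])
    show "(\<lambda>w. F w - F 0) holomorphic_on U" by (intro holomorphic_intros hF)
    show "complex_of_real ` {0<..<a} \<subseteq> U" using a by (auto simp: U_def)
    show "0 islimpt complex_of_real ` {0<..<a}"
      unfolding islimpt_approachable
    proof (intro allI impI)
      fix e :: real assume "e > 0"
      define d where "d = min (e/2) (a/2)"
      have "d > 0" "d < e" "d < a" using \<open>e > 0\<close> a by (auto simp: d_def)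
      then show "\<exists>x'\<in>complex_of_real ` {0<..<a}. x' \<noteq> 0 \<and> dist x' 0 < e"
        by (intro bexI[of _ "of_real d"]) auto
    qed
    fix z assume "z \<in> complex_of_real ` {0<..<a}"
    then obtain b where b: "z = of_real b" by blast
    have "F 0 = \<bar>1\<bar> *\<^sub>R (\<integral>v. \<Psi> (of_real (b + 1 * v)) \<partial>lborel)"
      unfolding F_def using lborel_integral_real_affine[of 1 "\<lambda>v. \<Psi> (of_real v)" b] by simp
    also have "\<dots> = F z" unfolding F_def b by (simp add: add.commute)
    finally show "F z - F 0 = 0" by simp
  qed (use y a oU cU in \<open>auto simp: U_def\<close>)
  then show ?thesis by (simp add: F_def)
qed

lemma cosh_ge_quadratic: "cosh (pi * x) \<ge> 1 + (x::real)\<^sup>2"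
proof -
  \<comment> \<open>Using exp (- y) \<ge> 1 - y for one summand costs half of the quadratic term;
    the slope pi makes up for it since (pi / 2)^2 \<ge> 1.\<close>
  have *: "cosh y \<ge> 1 + y\<^sup>2 / 4" if "y \<ge> 0" for y :: real
    using exp_lower_Taylor_quadratic[OF that] exp_ge_add_one_self[of "- y"]
    by (simp add: cosh_field_def)
  have "cosh (pi * x) = cosh (pi * \<bar>x\<bar>)" by (cases "x \<ge> 0") auto
  also have "\<dots> \<ge> 1 + (pi * \<bar>x\<bar>)\<^sup>2 / 4" by (rule *) auto
  finally have "cosh (pi * x) \<ge> 1 + (pi / 2)\<^sup>2 * x\<^sup>2" by (simp add: power_mult_distrib power_divide)
  moreover have "1 * x\<^sup>2 \<le> (pi / 2)\<^sup>2 * x\<^sup>2"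
    using pi_ge_two by (intro mult_right_mono) (auto simp: one_le_power)
  ultimately show ?thesis by linarith
qed

section \<open>The function phi and its entire extension\<close>

lemma Re_cosh: "Re (cosh z) = cosh (Re z) * cos (Im z)"
  by (simp add: cosh_field_def Re_exp add_divide_distrib algebra_simps)

lemma norm_sinh_le: "cmod (sinh z) \<le> cosh (Re z)"
  using norm_triangle_ineq4[of "exp z" "exp (- z)"]
  by (simp add: sinh_field_def cosh_field_def norm_divide)

lemma cosh_complex_of_real: "cosh (complex_of_real x) = of_real (cosh x)"
  by (simp add: cosh_field_def flip: exp_of_real)

text \<open>The term \<open>cosh 2\<pi>v\<close> gives the double exponential decay but its real part vanishes on the lines
  \<open>Im v = \<plusminus>1/4\<close>; the term \<open>cosh \<pi>v\<close> keeps the integrals absolutely convergent there.\<close>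

definition phi :: "real \<Rightarrow> real \<Rightarrow> real" where
  "phi c v = exp (- c * (cosh (2 * pi * v) + cosh (pi * v)))"

definition Phi :: "real \<Rightarrow> complex \<Rightarrow> complex" where
  "Phi c z = exp (- of_real c * (cosh (of_real (2 * pi) * z) + cosh (of_real pi * z)))"

definition Phi' :: "real \<Rightarrow> complex \<Rightarrow> complex" where
  "Phi' c z = Phi c z * (- of_real c * (sinh (of_real (2 * pi) * z) * of_real (2 * pi) + sinh (of_real pi * z) * of_real pi))"

lemma Phi_of_real: "Phi c (of_real v) = of_real (phi c v)"
proof -
  have "of_real (2 * pi) * complex_of_real v = of_real (2 * pi * v)" "of_real pi * complex_of_real v = of_real (pi * v)"
    by simp_all
  then show ?thesis unfolding Phi_def phi_def
    by (simp only: cosh_complex_of_real of_real_add[symmetric] of_real_mult[symmetric] of_real_minus[symmetric] exp_of_real)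
qed

lemma Phi_deriv: "(Phi c has_field_derivative Phi' c z) (at z)"
  unfolding Phi_def[abs_def] Phi'_def Phi_def by (auto intro!: derivative_eq_intros)

lemma phi_pos: "phi c v > 0"
  by (simp add: phi_def)

lemma phi_even: "phi c (- v) = phi c v"
  by (simp add: phi_def)

lemma norm_Phi_le:
  assumes c: "c > 0" and z: "\<bar>Im z\<bar> \<le> 1/4"
  shows "cmod (Phi c z) \<le> exp (- c / 2 * cosh (pi * Re z))"
proof -
  have "cos (2 * pi * Im z) \<ge> 0"
  proof (rule cos_ge_zero)
    have "pi * (- (1/4)) \<le> pi * Im z" "pi * Im z \<le> pi * (1/4)"
      using z by (intro mult_left_mono; simp)+
    then show "- (pi / 2) \<le> 2 * pi * Im z" "2 * pi * Im z \<le> pi / 2" by auto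
  qed
  then have 1: "cosh (2 * pi * Re z) * cos (2 * pi * Im z) \<ge> 0"
    by (intro mult_nonneg_nonneg) auto
  have "cos (pi * \<bar>Im z\<bar>) \<ge> cos (pi / 4)"
    using z by (intro cos_monotone_0_pi_le) (auto simp: field_simps)
  moreover have "cos (pi / 4) \<ge> 1 / 2"
    by (simp add: cos_45 real_le_rsqrt)
  ultimately have "cos (pi * Im z) \<ge> 1 / 2"
    by (metis abs_if cos_minus minus_mult_right order_trans)
  then have 2: "cosh (pi * Re z) * cos (pi * Im z) \<ge> cosh (pi * Re z) * (1 / 2)"
    by (intro mult_left_mono) auto
  have "cmod (Phi c z) = exp (- c * (cosh (2 * pi * Re z) * cos (2 * pi * Im z) + cosh (pi * Re z) * cos (pi * Im z)))"
    unfolding Phi_def norm_exp_eq_Re by (simp add: Re_cosh)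
  also have "\<dots> \<le> exp (- c * (cosh (pi * Re z) * (1 / 2)))"
  proof -
    have "c * (cosh (pi * Re z) * (1 / 2))
        \<le> c * (cosh (2 * pi * Re z) * cos (2 * pi * Im z) + cosh (pi * Re z) * cos (pi * Im z))"
      using 1 2 c by (intro mult_left_mono) linarith+
    then show ?thesis unfolding exp_le_cancel_iff mult_minus_left by linarith
  qed
  finally show ?thesis by simp
qed

lemma exp_neg_le_power4: "x > 0 \<Longrightarrow> exp (- x) \<le> 256 / x ^ 4" for x :: real
proof -
  assume x: "x > 0"
  have "(x / 4) ^ 4 \<le> exp (x / 4) ^ 4"
    using x exp_ge_add_one_self[of "x / 4"] by (intro power_mono) linarith+
  also have "exp (x / 4) ^ 4 = exp x" using exp_of_nat_mult[of 4 "x / 4"] by simp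
  finally show ?thesis using x by (simp add: exp_minus field_simps)
qed

text \<open>The fourth power leaves room for the derivative: the sinh factors cost q^2, by cosh 2y
  \<le> 2 cosh^2 y, and the remaining q^(-2) is still at most 1 / (1 + (Re z)^2).\<close>

lemma norm_Phi_le_quadratic:
  assumes c: "c > 0" and z: "\<bar>Im z\<bar> \<le> 1/4"
  shows "cmod (Phi c z) \<le> 4096 / c ^ 4 / (1 + (Re z)\<^sup>2)"
    and "cmod (Phi' c z) \<le> 4096 / c ^ 4 * (c * (5 * pi)) / (1 + (Re z)\<^sup>2)"
proof -
  define q where "q = cosh (pi * Re z)"
  have q: "q \<ge> 1 + (Re z)\<^sup>2" unfolding q_def by (rule cosh_ge_quadratic)
  have q1: "q \<ge> 1" using q zero_le_power2[of "Re z"] by linarith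
  have "cmod (Phi c z) \<le> exp (- (c / 2 * q))" using norm_Phi_le[OF assms] by (simp add: q_def)
  also have "\<dots> \<le> 256 / (c / 2 * q) ^ 4" using c q1 by (intro exp_neg_le_power4) auto
  also have "\<dots> = 4096 / c ^ 4 / q ^ 4" by (simp add: field_simps power_mult_distrib)
  finally have P: "cmod (Phi c z) \<le> 4096 / c ^ 4 / q ^ 4" .
  have pos: "1 + (Re z)\<^sup>2 > 0" by (simp add: add_pos_nonneg)
  have "4096 / c ^ 4 / q ^ 4 \<le> 4096 / c ^ 4 / (1 + (Re z)\<^sup>2)"
    using c q q1 pos power_increasing[of 1 4 q] by (intro divide_left_mono) auto
  then show "cmod (Phi c z) \<le> 4096 / c ^ 4 / (1 + (Re z)\<^sup>2)" using P by linarith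
  have "cosh (2 * pi * Re z) \<le> 2 * q\<^sup>2"
    using cosh_double_cosh[of "pi * Re z"] by (simp add: q_def mult.assoc)
  moreover have "q \<le> q\<^sup>2" using q1 by (simp add: self_le_power)
  moreover have "cmod (sinh (of_real (2 * pi) * z)) \<le> cosh (2 * pi * Re z)" "cmod (sinh (of_real pi * z)) \<le> q"
    using norm_sinh_le[of "of_real (2 * pi) * z"] norm_sinh_le[of "of_real pi * z"] by (auto simp: q_def)
  ultimately have s: "cmod (sinh (of_real (2 * pi) * z)) \<le> 2 * q\<^sup>2" "cmod (sinh (of_real pi * z)) \<le> q\<^sup>2" by linarith+
  have "cmod (sinh (of_real (2 * pi) * z) * of_real (2 * pi) + sinh (of_real pi * z) * of_real pi)
      \<le> cmod (sinh (of_real (2 * pi) * z)) * (2 * pi) + cmod (sinh (of_real pi * z)) * pi"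
    using norm_triangle_ineq[of "sinh (of_real (2 * pi) * z) * of_real (2 * pi)" "sinh (of_real pi * z) * of_real pi"]
    by (simp add: norm_mult)
  also have "\<dots> \<le> 2 * q\<^sup>2 * (2 * pi) + q\<^sup>2 * pi"
    using s by (intro add_mono mult_right_mono) auto
  finally have D: "cmod (sinh (of_real (2 * pi) * z) * of_real (2 * pi) + sinh (of_real pi * z) * of_real pi) \<le> 5 * pi * q\<^sup>2"
    by simp
  have "cmod (Phi' c z) \<le> (4096 / c ^ 4 / q ^ 4) * (c * (5 * pi * q\<^sup>2))"
    unfolding Phi'_def norm_mult using P D c q1 by (intro mult_mono) auto
  also have "\<dots> = 4096 / c ^ 4 * (c * (5 * pi)) / q\<^sup>2"
    using q1 by (simp add: field_simps power2_eq_square power4_eq_xxxx)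
  also have "\<dots> \<le> 4096 / c ^ 4 * (c * (5 * pi)) / (1 + (Re z)\<^sup>2)"
    using c q q1 pos power_increasing[of 1 2 q] by (intro divide_left_mono mult_nonneg_nonneg) auto
  finally show "cmod (Phi' c z) \<le> 4096 / c ^ 4 * (c * (5 * pi)) / (1 + (Re z)\<^sup>2)" .
qed

lemma phi_measurable [measurable]: "phi c \<in> borel_measurable borel"
  unfolding phi_def[abs_def]
  by (intro borel_measurable_continuous_onI continuous_intros)

lemma phi_bound:
  assumes "c > 0"
  shows "phi c v \<le> 4096 / c ^ 4 / (1 + v\<^sup>2)"
  using norm_Phi_le_quadratic(1)[OF assms, of "of_real v"] phi_pos[of c v] by (simp add: Phi_of_real)

lemma phi_integrable:
  assumes "c > 0"
  shows "integrable lborel (phi c)"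
  by (rule integrable_quadratic_decay[of _ "4096 / c ^ 4"])
     (use phi_bound[OF assms] phi_pos[of c] in \<open>auto simp: abs_of_pos\<close>)

section \<open>The Fourier transform of phi\<close>

definition phat :: "real \<Rightarrow> real \<Rightarrow> real" where
  "phat c x = (\<integral>v. phi c v * cos (x * v) \<partial>lborel)"

lemma phi_cos_integrable:
  assumes "c > 0"
  shows "integrable lborel (\<lambda>v. phi c v * cos (x * v))" "integrable lborel (\<lambda>v. phi c v * sin (x * v))"
  using phi_pos[of c]
  by (auto intro!: Bochner_Integration.integrable_bound[OF phi_integrable[OF assms]] AE_I2
      simp: abs_mult mult_left_le abs_of_pos)

lemma phat_complex:
  assumes c: "c > 0"
  shows "(\<integral>v. of_real (phi c v) * cis (- (x * v)) \<partial>lborel) = of_real (phat c x)"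
proof -
  have odd: "(\<integral>v. phi c v * sin (x * v) \<partial>lborel) = 0"
    using lborel_integral_real_affine[of "-1" "\<lambda>v. phi c v * sin (x * v)" 0] by (simp add: phi_even)
  have "(\<lambda>v. of_real (phi c v) * cis (- (x * v))) = (\<lambda>v. of_real (phi c v * cos (x * v)) - \<i> * of_real (phi c v * sin (x * v)))"
    by (auto simp: complex_eq_iff)
  then have "(\<integral>v. of_real (phi c v) * cis (- (x * v)) \<partial>lborel)
      = (\<integral>v. of_real (phi c v * cos (x * v)) \<partial>lborel) - (\<integral>v. \<i> * of_real (phi c v * sin (x * v)) \<partial>lborel)"
    using phi_cos_integrable[OF c, of x] by (simp only: Bochner_Integration.integral_diff integrable_mult_right integrable_of_real)
  also have "\<dots> = of_real (phat c x)"
    using odd by (simp only: integral_mult_right_zero integral_complex_of_real phat_def) simp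
  finally show ?thesis .
qed

text \<open>Moving the line of integration down to Im z = - 1/4 gains exp (- x / 4), and one
  integration by parts gains 1 / x. Squared, these give the decay demanded by the locale
  \<open>kernel\<close> away from 0.\<close>

lemma phat_decay:
  assumes c: "c > 0"
  obtains C where "C \<ge> 0" "\<And>x. x > 0 \<Longrightarrow> \<bar>phat c x\<bar> \<le> C * exp (- x / 4) / x"
proof -
  define B where "B = 4096 / c ^ 4 * (c * (5 * pi))"
  have B: "B \<ge> 0" using c by (simp add: B_def)
  define C where "C = (\<integral>v. B / (1 + v\<^sup>2) \<partial>lborel)"
  have Bint: "integrable lborel (\<lambda>v::real. B / (1 + v\<^sup>2))"
    by (rule integrable_quadratic_decay[of _ B]) (use B in auto)
  have "C \<ge> 0" unfolding C_def using B by (intro Bochner_Integration.integral_nonneg) auto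
  have hP: "Phi c holomorphic_on UNIV"
    using Phi_deriv by (auto simp: holomorphic_on_open)
  have hP': "Phi' c holomorphic_on UNIV"
  proof -
    have "(\<lambda>z. sinh (of_real a * z)) holomorphic_on UNIV" for a :: real
      unfolding sinh_field_def by (intro holomorphic_intros) auto
    then show ?thesis unfolding Phi'_def[abs_def] by (intro holomorphic_intros hP)
  qed
  have "\<bar>phat c x\<bar> \<le> C * exp (- x / 4) / x" if x: "x > 0" for x
  proof -
    define \<Psi> where "\<Psi> = (\<lambda>z. Phi' c z * exp (- \<i> * of_real x * z))"
    have h\<Psi>: "\<Psi> holomorphic_on UNIV" unfolding \<Psi>_def by (intro holomorphic_intros hP')
    have n\<Psi>: "cmod (\<Psi> z) = cmod (Phi' c z) * exp (x * Im z)" for z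
      by (simp add: \<Psi>_def norm_mult)
    have bd: "cmod (\<Psi> z) \<le> (B * exp x) / (1 + (Re z)\<^sup>2)" if z: "\<bar>Im z\<bar> \<le> 1/4" for z
    proof -
      have "cmod (\<Psi> z) \<le> (B / (1 + (Re z)\<^sup>2)) * exp x"
        unfolding n\<Psi>
      proof (intro mult_mono)
        show "cmod (Phi' c z) \<le> B / (1 + (Re z)\<^sup>2)"
          unfolding B_def by (rule norm_Phi_le_quadratic(2)[OF c z])
        have "x * Im z \<le> x * 1" using x z by (intro mult_left_mono) auto
        then show "exp (x * Im z) \<le> exp x" by simp
      qed (use B in auto)
      then show ?thesis by simp
    qed
    define I where "I = (\<integral>v. \<Psi> (of_real v) \<partial>lborel)"
    \<comment> \<open>The shift lemma works in the open strip, so y stays below 1/4 with a constant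
      independent of y; the endpoint is reached by a limit.\<close>
    have Ib: "cmod I \<le> C * exp (- x * y)" if y: "0 \<le> y" "y < 1/4" for y
    proof -
      have "I = (\<integral>v. \<Psi> (of_real v + (- \<i> * of_real y)) \<partial>lborel)"
        unfolding I_def by (rule integral_horizontal_shift[where a = "1/4", OF h\<Psi> bd, symmetric]) (use y in auto)
      also have "cmod \<dots> \<le> (\<integral>v. exp (- x * y) * (B / (1 + v\<^sup>2)) \<partial>lborel)"
      proof (rule norm_integral_le)
        have "continuous_on UNIV (\<lambda>v::real. \<Psi> (of_real v + (- \<i> * of_real y)))"
          by (rule continuous_on_compose2[OF holomorphic_on_imp_continuous_on[OF h\<Psi>]])
             (auto intro!: continuous_intros)
        then have m: "(\<lambda>v::real. \<Psi> (of_real v + (- \<i> * of_real y))) \<in> borel_measurable borel"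
          by (rule borel_measurable_continuous_onI)
        show "integrable lborel (\<lambda>v. \<Psi> (of_real v + (- \<i> * of_real y)))"
        proof (rule integrable_quadratic_decay[OF m])
          show "cmod (\<Psi> (of_real v + (- \<i> * of_real y))) \<le> B * exp x / (1 + v\<^sup>2)" for v
            using bd[of "of_real v + (- \<i> * of_real y)"] y by simp
        qed
        show "integrable lborel (\<lambda>v. exp (- x * y) * (B / (1 + v\<^sup>2)))"
          by (rule integrable_mult_right[OF Bint])
        show "cmod (\<Psi> (of_real v + (- \<i> * of_real y))) \<le> exp (- x * y) * (B / (1 + v\<^sup>2))" for v
        proof -
          have P: "cmod (Phi' c (of_real v + (- \<i> * of_real y))) \<le> B / (1 + v\<^sup>2)"
            using norm_Phi_le_quadratic(2)[OF c, of "of_real v + (- \<i> * of_real y)"] y by (simp add: B_def)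
          have "Im (of_real v + (- \<i> * of_real y)) = - y" by simp
          then show ?thesis
            unfolding n\<Psi> using mult_left_mono[OF P, of "exp (- x * y)"] by (simp add: mult.commute)
        qed
      qed
      also have "\<dots> = exp (- x * y) * C" unfolding C_def by (rule integral_mult_right_zero)
      finally show ?thesis by (simp add: mult.commute)
    qed
    have "((\<lambda>y. C * exp (- x * y)) \<longlongrightarrow> C * exp (- x * (1/4))) (at_left (1/4))"
      by (intro tendsto_intros)
    then have Ib': "cmod I \<le> C * exp (- x * (1/4))"
    proof (rule tendsto_lowerbound)
      have "\<forall>\<^sub>F y in at_left (1/4::real). 0 < y" by (rule eventually_at_left_real[of 0, THEN eventually_mono]) auto
      moreover have "\<forall>\<^sub>F y in at_left (1/4::real). y < 1/4" by (simp add: eventually_at_filter)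
      ultimately show "\<forall>\<^sub>F y in at_left (1/4). cmod I \<le> C * exp (- x * y)"
        by eventually_elim (use Ib in auto)
    qed auto
    define F where "F = (\<lambda>v::real. Phi c (of_real v) * exp (- \<i> * of_real x * of_real v))"
    define f where "f = (\<lambda>v::real. \<Psi> (of_real v) - \<i> * of_real x * F v)"
    have dF: "(F has_vector_derivative f v) (at v)" for v
    proof -
      have "((\<lambda>z. Phi c z * exp (- \<i> * of_real x * z)) has_field_derivative
          Phi' c (of_real v) * exp (- \<i> * of_real x * of_real v) + exp (- \<i> * of_real x * of_real v) * (- \<i> * of_real x * 1) * Phi c (of_real v)) (at (of_real v))"
        by (intro DERIV_mult Phi_deriv DERIV_fun_exp DERIV_cmult DERIV_ident)
      from has_vector_derivative_real_field[OF this] show ?thesis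
        unfolding F_def f_def \<Psi>_def by (simp add: o_def algebra_simps)
    qed
    have eF: "F v = of_real (phi c v) * cis (- (x * v))" for v
      by (simp add: F_def Phi_of_real cis_conv_exp mult.assoc)
    have nF: "cmod (F v) = phi c v" for v using phi_pos[of c v] by (simp add: eF norm_mult)
    have contF: "continuous_on UNIV F" unfolding F_def
      by (intro continuous_intros continuous_on_compose2[OF holomorphic_on_imp_continuous_on[OF hP]]) auto
    have cont\<Psi>: "continuous_on UNIV (\<lambda>v::real. \<Psi> (of_real v))"
      by (rule continuous_on_compose2[OF holomorphic_on_imp_continuous_on[OF h\<Psi>]]) (auto intro!: continuous_intros)
    have contf: "continuous_on UNIV f" unfolding f_def by (intro continuous_intros contF cont\<Psi>)
    have iF: "integrable lborel F"
      by (rule integrable_quadratic_decay[of _ "4096 / c ^ 4"])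
         (use contF phi_bound[OF c] in \<open>auto simp: nF borel_measurable_continuous_onI\<close>)
    have i\<Psi>: "integrable lborel (\<lambda>v. \<Psi> (of_real v))"
      by (rule integrable_quadratic_decay[of _ "B * exp x"])
         (use cont\<Psi> bd[of "of_real v" for v] in \<open>auto simp: borel_measurable_continuous_onI\<close>)
    have if': "integrable lborel f" unfolding f_def using iF i\<Psi> by auto
    have lim: "(F \<longlongrightarrow> 0) at_top" "(F \<longlongrightarrow> 0) at_bot"
    proof -
      have b: "cmod (F v) \<le> 4096 / c ^ 4 / (1 + v\<^sup>2)" for v using phi_bound[OF c, of v] by (simp add: nF)
      have "((\<lambda>v::real. 4096 / c ^ 4 / (1 + v\<^sup>2)) \<longlongrightarrow> 0) at_top" by real_asymp
      then show "(F \<longlongrightarrow> 0) at_top" by (rule Lim_null_comparison[rotated]) (use b in auto)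
      have "((\<lambda>v::real. 4096 / c ^ 4 / (1 + v\<^sup>2)) \<longlongrightarrow> 0) at_bot" by real_asymp
      then show "(F \<longlongrightarrow> 0) at_bot" by (rule Lim_null_comparison[rotated]) (use b in auto)
    qed
    \<comment> \<open>f is the derivative of F, and F vanishes at both ends; hence I, the part of
      the integral containing \<open>Phi'\<close>, equals ix times the transform.\<close>
    have "(LBINT v=-\<infinity>..\<infinity>. f v) = 0 - 0"
    proof (rule interval_integral_FTC_integrable)
      show "((F \<circ> real_of_ereal) \<longlongrightarrow> 0) (at_right (- \<infinity>))" "((F \<circ> real_of_ereal) \<longlongrightarrow> 0) (at_left \<infinity>)"
        using lim by (simp_all add: ereal_tendsto_simps)
      show "isCont f v" for v using contf by (simp add: continuous_on_eq_continuous_at)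
    qed (use dF if' in \<open>auto simp: set_integrable_def einterval_def\<close>)
    then have "(\<integral>v. f v \<partial>lborel) = 0"
      by (simp add: interval_lebesgue_integral_def einterval_def set_lebesgue_integral_def)
    then have "I = \<i> * of_real x * (\<integral>v. F v \<partial>lborel)"
      unfolding f_def I_def using iF i\<Psi> by simp
    also have "(\<integral>v. F v \<partial>lborel) = of_real (phat c x)"
      unfolding eF by (rule phat_complex[OF c])
    finally have "cmod I = x * \<bar>phat c x\<bar>" using x by (simp add: norm_mult)
    then show ?thesis using Ib' x by (simp add: field_simps)
  qed
  then show ?thesis using that \<open>C \<ge> 0\<close> by blast
qed

lemma phat_continuous:
  assumes c: "c > 0"
  shows "continuous_on UNIV (phat c)"
proof (rule continuous_at_imp_continuous_on, rule ballI)
  fix x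
  show "isCont (phat c) x"
    unfolding continuous_at_sequentially o_def phat_def
  proof (intro allI impI)
    fix X :: "nat \<Rightarrow> real" assume X: "X \<longlonglongrightarrow> x"
    show "(\<lambda>n. \<integral>v. phi c v * cos (X n * v) \<partial>lborel) \<longlonglongrightarrow> (\<integral>v. phi c v * cos (x * v) \<partial>lborel)"
    proof (rule integral_dominated_convergence[where w = "phi c"])
      show "AE v in lborel. (\<lambda>n. phi c v * cos (X n * v)) \<longlonglongrightarrow> phi c v * cos (x * v)"
        by (intro AE_I2 tendsto_intros X)
      show "AE v in lborel. norm (phi c v * cos (X n * v)) \<le> phi c v" for n
        using phi_pos[of c] by (intro AE_I2) (simp add: abs_mult mult_left_le abs_of_pos)
    qed (use phi_integrable[OF c] in auto)
  qed
qed

lemma phat_0: "phat c 0 = (\<integral>v. phi c v \<partial>lborel)"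
  by (simp add: phat_def)

lemma abs_phat_le:
  assumes c: "c > 0"
  shows "\<bar>phat c x\<bar> \<le> phat c 0"
proof -
  have "norm (phat c x) \<le> (\<integral>v. phi c v \<partial>lborel)"
    unfolding phat_def
    by (rule norm_integral_le[OF phi_cos_integrable(1)[OF c] phi_integrable[OF c]])
       (use phi_pos[of c] in \<open>simp add: abs_mult mult_left_le abs_of_pos\<close>)
  then show ?thesis by (simp add: phat_0)
qed

text \<open>Laplace's method: the exponent m has minimum 2 at 0 and m v \<ge> 2 + v^2, so for large
  c the mass of phi sits near 0 and the transform is nearly constant on bounded sets.\<close>

lemma phat_concentration:
  assumes X: "X \<ge> 0"
  obtains c where "c > 0" "phat c 0 > 0" "\<And>x. 0 \<le> x \<Longrightarrow> x \<le> X \<Longrightarrow> phat c x \<ge> phat c 0 / 2"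
proof -
  define m where "m = (\<lambda>v::real. cosh (2 * pi * v) + cosh (pi * v))"
  have phi_m: "phi c v = exp (- c * m v)" for c v by (simp add: phi_def m_def)
  have m_ge: "m v \<ge> 2 + v\<^sup>2" for v
    using cosh_ge_quadratic[of v] cosh_real_ge_1[of "2 * pi * v"] by (simp add: m_def)
  \<comment> \<open>This makes |x v| \<le> 1/2 for |v| < \<delta> and x \<le> X, where the cosine is
    at least 3/4.\<close>
  define \<delta> where "\<delta> = 1 / (2 * (X + 1))"
  have \<delta>: "\<delta> > 0" using X by (simp add: \<delta>_def)
  have "isCont m 0" unfolding m_def by (intro continuous_intros)
  moreover have "m 0 = 2" by (simp add: m_def)
  ultimately have "\<exists>d>0. \<forall>v. dist v 0 < d \<longrightarrow> dist (m v) 2 < \<delta>\<^sup>2 / 2"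
    using \<delta> unfolding continuous_at_eps_delta by (metis half_gt_zero zero_less_power)
  then obtain d where d: "d > 0" "\<And>v. \<bar>v\<bar> < d \<Longrightarrow> \<bar>m v - 2\<bar> < \<delta>\<^sup>2 / 2"
    by (auto simp: dist_real_def)
  define \<eta> where "\<eta> = d / 2"
  have "m v \<le> 2 + \<delta>\<^sup>2 / 2" if "\<bar>v\<bar> \<le> \<eta>" for v
  proof -
    have "\<bar>v\<bar> < d" using that d(1) by (simp add: \<eta>_def)
    from d(2)[OF this] show ?thesis by linarith
  qed
  then have \<eta>: "\<eta> > 0" "\<And>v. \<bar>v\<bar> \<le> \<eta> \<Longrightarrow> m v \<le> 2 + \<delta>\<^sup>2 / 2"
    using d(1) by (auto simp: \<eta>_def)
  define J where "J = phat 1 0"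
  have J: "J \<ge> 0" unfolding J_def phat_0 using phi_pos[of 1] by (intro Bochner_Integration.integral_nonneg) (auto intro: less_imp_le)
  \<comment> \<open>c is chosen so that exp (c \<delta>^2 / 2) \<ge> E. Then the majorant g of the
    mass outside |v| < \<delta> has integral at most 1/7 of the total, and 3/4 - (7/4)(1/7) = 1/2 is
    the claimed proportion.\<close>
  define E where "E = 7 * exp (2 + \<delta>\<^sup>2) * J / (2 * \<eta>)"
  have E: "E \<ge> 0" using J \<eta> by (simp add: E_def)
  define c where "c = 1 + 2 * E / \<delta>\<^sup>2"
  have c1: "c \<ge> 1" using E by (simp add: c_def)
  have c: "c > 0" using c1 by simp
  have expE: "E \<le> exp (c * \<delta>\<^sup>2 / 2)"
  proof -
    have "E \<le> c * \<delta>\<^sup>2 / 2" using \<delta> by (simp add: c_def field_simps)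
    also have "\<dots> \<le> exp (c * \<delta>\<^sup>2 / 2)" using exp_ge_add_one_self[of "c * \<delta>\<^sup>2 / 2"] by linarith
    finally show ?thesis .
  qed
  have low: "2 * \<eta> * exp (- c * (2 + \<delta>\<^sup>2 / 2)) \<le> phat c 0"
  proof -
    have "(\<integral>v. exp (- c * (2 + \<delta>\<^sup>2 / 2)) * indicator {-\<eta>..\<eta>} v \<partial>lborel) \<le> (\<integral>v. phi c v \<partial>lborel)"
    proof (rule integral_mono)
      show "integrable lborel (\<lambda>v. exp (- c * (2 + \<delta>\<^sup>2 / 2)) * indicator {-\<eta>..\<eta>} v)"
        by (intro integrable_mult_right integrable_real_indicator) (auto simp: emeasure_lborel_Icc_eq)
      fix v
      show "exp (- c * (2 + \<delta>\<^sup>2 / 2)) * indicator {-\<eta>..\<eta>} v \<le> phi c v"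
        using \<eta>(2)[of v] c phi_pos[of c v] by (auto simp: indicator_def phi_m)
    qed (rule phi_integrable[OF c])
    also have "(\<integral>v. exp (- c * (2 + \<delta>\<^sup>2 / 2)) * indicator {-\<eta>..\<eta>} v \<partial>lborel) = exp (- c * (2 + \<delta>\<^sup>2 / 2)) * (2 * \<eta>)"
      using \<eta>(1) by simp
    finally show ?thesis by (simp add: phat_0 mult.commute)
  qed
  have pos: "phat c 0 > 0"
    by (rule less_le_trans[OF _ low]) (use \<eta> in simp)
  \<comment> \<open>For |v| \<ge> \<delta>, split exp (- c m) as exp (- (c - 1) m) times
    \<open>phi 1\<close> and bound the first factor by its value at m = 2 + \<delta>^2; the second
    keeps g integrable.\<close>
  define g where "g = (\<lambda>v. exp (- (c - 1) * (2 + \<delta>\<^sup>2)) * phi 1 v)"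
  have gi: "integrable lborel g" unfolding g_def by (intro integrable_mult_right phi_integrable) auto
  have tail: "phi c v \<le> g v" if "\<bar>v\<bar> \<ge> \<delta>" for v
  proof -
    have "\<delta>\<^sup>2 \<le> v\<^sup>2" using that \<delta> by (metis abs_le_square_iff abs_of_pos)
    then have "m v \<ge> 2 + \<delta>\<^sup>2" using m_ge[of v] by linarith
    then have "(c - 1) * (2 + \<delta>\<^sup>2) \<le> (c - 1) * m v" using c1 by (intro mult_left_mono) auto
    then show ?thesis unfolding g_def phi_m exp_add[symmetric] by (simp add: algebra_simps)
  qed
  have gint: "7 * (\<integral>v. g v \<partial>lborel) \<le> phat c 0"
  proof -
    have "(\<integral>v. g v \<partial>lborel) = exp (- (c - 1) * (2 + \<delta>\<^sup>2)) * J"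
      unfolding g_def J_def phat_0 by (rule integral_mult_right_zero)
    also have "- (c - 1) * (2 + \<delta>\<^sup>2) = - c * (2 + \<delta>\<^sup>2 / 2) + (2 + \<delta>\<^sup>2) + - (c * \<delta>\<^sup>2 / 2)"
      by (simp add: algebra_simps)
    also have "7 * (exp (\<dots>) * J) = exp (- c * (2 + \<delta>\<^sup>2 / 2)) * (2 * \<eta>) * (E / exp (c * \<delta>\<^sup>2 / 2))"
      unfolding exp_add exp_minus E_def using \<eta>(1) by (simp add: field_simps)
    also have "\<dots> \<le> exp (- c * (2 + \<delta>\<^sup>2 / 2)) * (2 * \<eta>) * 1"
      using expE \<eta> by (intro mult_left_mono) auto
    also have "\<dots> \<le> phat c 0" using low by (simp add: mult.commute)
    finally show ?thesis .
  qed
  have "phat c x \<ge> phat c 0 / 2" if x: "0 \<le> x" "x \<le> X" for x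
  proof -
    have pt: "3/4 * phi c v - 7/4 * g v \<le> phi c v * cos (x * v)" for v
    proof (cases "\<bar>v\<bar> \<ge> \<delta>")
      case True
      have "phi c v * (-1) \<le> phi c v * cos (x * v)"
        using phi_pos[of c v] by (intro mult_left_mono) auto
      then show ?thesis using tail[OF True] by simp
    next
      case False
      have "\<bar>x * v\<bar> \<le> X * \<delta>" using x False by (simp add: abs_mult) (intro mult_mono; simp)
      also have "\<dots> \<le> 1/2" using X by (simp add: \<delta>_def field_simps)
      finally have xv: "\<bar>x * v\<bar> \<le> 1/2" .
      have "cos (x * v) = 1 - 2 * (sin (x * v / 2))\<^sup>2" using cos_double_sin[of "x * v / 2"] by simp
      moreover have "(sin (x * v / 2))\<^sup>2 \<le> (1/4)\<^sup>2"
        using abs_sin_x_le_abs_x[of "x * v / 2"] xv by (intro power2_le_iff_abs_le[THEN iffD2]) auto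
      ultimately have "3/4 \<le> cos (x * v)" by (simp add: power2_eq_square)
      then have "phi c v * (3/4) \<le> phi c v * cos (x * v)"
        using phi_pos[of c v] by (intro mult_left_mono) auto
      moreover have "g v \<ge> 0" using phi_pos[of 1 v] by (simp add: g_def)
      ultimately show ?thesis by simp
    qed
    have "(\<integral>v. 3/4 * phi c v - 7/4 * g v \<partial>lborel) \<le> phat c x"
      unfolding phat_def using phi_integrable[OF c] gi
      by (intro integral_mono pt phi_cos_integrable[OF c]) auto
    also have "(\<integral>v. 3/4 * phi c v - 7/4 * g v \<partial>lborel) = 3/4 * phat c 0 - 7/4 * (\<integral>v. g v \<partial>lborel)"
      unfolding phat_0 using phi_integrable[OF c] gi by (simp add: Bochner_Integration.integral_diff)
    finally show ?thesis using gint by linarith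
  qed
  then show ?thesis using that c pos by blast
qed

section \<open>The self-convolution of phi\<close>

definition Kc :: "real \<Rightarrow> real \<Rightarrow> real" where
  "Kc c u = (\<integral>v. phi c v * phi c (u - v) \<partial>lborel)"

lemma Kc_measurable: "Kc c \<in> borel_measurable borel"
  unfolding Kc_def[abs_def] by measurable

lemma Kc_nonneg: "Kc c u \<ge> 0"
  unfolding Kc_def using phi_pos[of c] by (intro Bochner_Integration.integral_nonneg mult_nonneg_nonneg) (auto intro: less_imp_le)

lemma exp_cosh_integrable:
  assumes c: "c > 0"
  shows "integrable lborel (\<lambda>v. exp (- c * cosh (pi * v)))"
proof (rule integrable_quadratic_decay[of _ "256 / c ^ 4"])
  show "(\<lambda>v. exp (- c * cosh (pi * v))) \<in> borel_measurable borel"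
    by (intro borel_measurable_continuous_onI continuous_intros)
  fix v
  define q where "q = cosh (pi * v)"
  have q: "q \<ge> 1 + v\<^sup>2" "q \<ge> 1" unfolding q_def by (rule cosh_ge_quadratic cosh_real_ge_1)+
  have "exp (- c * q) \<le> 256 / (c * q) ^ 4" using c q exp_neg_le_power4[of "c * q"] by simp
  also have "\<dots> = 256 / c ^ 4 / q ^ 4" by (simp add: power_mult_distrib)
  also have "\<dots> \<le> 256 / c ^ 4 / (1 + v\<^sup>2)"
    using c q power_increasing[of 1 4 q] by (intro divide_left_mono) (auto simp: add_pos_nonneg)
  finally show "norm (exp (- c * cosh (pi * v))) \<le> 256 / c ^ 4 / (1 + v\<^sup>2)" by (simp add: q_def)
qed

text \<open>By cosh (2 pi v) + cosh (2 pi (u - v)) = 2 cosh (pi u) cosh (2 pi v - pi u) \<ge> 2 cosh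
  (pi u), the convolution inherits double exponential decay, with rate pi instead of 2 pi. One
  remaining term cosh (pi v) makes the integral over v converge.\<close>

lemma Kc_decay:
  assumes c: "c > 0"
  obtains B where "B \<ge> 0" "\<And>u. Kc c u \<le> B * exp (- c * exp (pi * \<bar>u\<bar>))"
proof -
  define B where "B = (\<integral>v. exp (- c * cosh (pi * v)) \<partial>lborel)"
  have "B \<ge> 0" unfolding B_def by (intro Bochner_Integration.integral_nonneg) auto
  moreover have "Kc c u \<le> B * exp (- c * exp (pi * \<bar>u\<bar>))" for u
  proof -
    have pt: "phi c v * phi c (u - v) \<le> exp (- c * exp (pi * \<bar>u\<bar>)) * exp (- c * cosh (pi * v))" for v
    proof -
      define p q where "p = pi * u" and "q = 2 * pi * v - pi * u"
      have "cosh (2 * pi * v) + cosh (2 * pi * (u - v)) = cosh (p + q) + cosh (p - q)"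
        by (simp add: p_def q_def algebra_simps)
      also have "\<dots> = 2 * cosh p * cosh q" by (simp add: cosh_add cosh_diff)
      also have "\<dots> \<ge> 2 * cosh p * 1"
        using cosh_real_ge_1[of q] by (intro mult_left_mono) auto
      finally have "cosh (2 * pi * v) + cosh (2 * pi * (u - v)) \<ge> 2 * cosh p" by simp
      moreover have "2 * cosh p \<ge> exp (pi * \<bar>u\<bar>)"
        by (cases "u \<ge> 0") (auto simp: p_def cosh_field_def)
      moreover have "cosh (pi * (u - v)) \<ge> 0" by simp
      ultimately have "exp (pi * \<bar>u\<bar>) + cosh (pi * v)
          \<le> (cosh (2 * pi * v) + cosh (pi * v)) + (cosh (2 * pi * (u - v)) + cosh (pi * (u - v)))"
        by linarith
      then have "c * (exp (pi * \<bar>u\<bar>) + cosh (pi * v))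
          \<le> c * ((cosh (2 * pi * v) + cosh (pi * v)) + (cosh (2 * pi * (u - v)) + cosh (pi * (u - v))))"
        using c by (intro mult_left_mono) auto
      then show ?thesis unfolding phi_def exp_add[symmetric] exp_le_cancel_iff
        unfolding distrib_left mult_minus_left by linarith
    qed
    have le: "norm (phi c v * phi c (u - v)) \<le> exp (- c * exp (pi * \<bar>u\<bar>)) * exp (- c * cosh (pi * v))" for v
      using pt[of v] phi_pos[of c v] phi_pos[of c "u - v"] by simp
    have gi: "integrable lborel (\<lambda>v. exp (- c * exp (pi * \<bar>u\<bar>)) * exp (- c * cosh (pi * v)))"
      by (rule integrable_mult_right[OF exp_cosh_integrable[OF c]])
    have fi: "integrable lborel (\<lambda>v. phi c v * phi c (u - v))"
      by (rule Bochner_Integration.integrable_bound[OF gi]) (use le in auto)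
    have "Kc c u \<le> (\<integral>v. exp (- c * exp (pi * \<bar>u\<bar>)) * exp (- c * cosh (pi * v)) \<partial>lborel)"
      unfolding Kc_def by (rule integral_mono[OF fi gi pt])
    also have "\<dots> = exp (- c * exp (pi * \<bar>u\<bar>)) * B" unfolding B_def by (rule integral_mult_right_zero)
    finally show ?thesis by (simp add: mult.commute)
  qed
  ultimately show ?thesis using that by blast
qed

text \<open>Fubini and the substitution u = v + w factor the double integral. The outcome being a
  square is what makes the transform nonnegative.\<close>

lemma Kc_integrable_and_hat:
  assumes c: "c > 0"
  shows "integrable lborel (Kc c)"
    and "(\<integral>u. of_real (Kc c u) * cis (- (x * u)) \<partial>lborel) = of_real ((phat c x)\<^sup>2)"
proof -
  let ?f = "\<lambda>x v u. of_real (phi c v * phi c (u - v)) * cis (- (x * u))"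
  have cm: "(\<lambda>u::real. cis (- (x * u))) \<in> borel_measurable borel" for x
    unfolding cis_conv_exp by (intro borel_measurable_continuous_onI continuous_intros)
  have shifti: "integrable lborel (\<lambda>u. phi c (u - v))" for v
    using lborel_integrable_real_affine[OF phi_integrable[OF c], of 1 "- v"] by simp
  have fm: "(\<lambda>(v, u). ?f x v u) \<in> borel_measurable (lborel \<Otimes>\<^sub>M lborel)" for x
  proof -
    have [measurable]: "(\<lambda>u::real. cis (- (x * u))) \<in> borel_measurable borel" by (rule cm)
    show ?thesis by measurable
  qed
  have ii: "integrable lborel (\<lambda>u. ?f x v u)" for x v
    by (rule Bochner_Integration.integrable_bound[OF integrable_mult_right[OF shifti[of v], of "phi c v"]])
       (use cm[of x] in \<open>auto simp: norm_mult\<close>)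
  have sh: "(\<integral>u. phi c (u - v) \<partial>lborel) = phat c 0" for v
    using lborel_integral_real_affine[of 1 "phi c" "- v"] by (simp add: phat_0)
  have int: "integrable (lborel \<Otimes>\<^sub>M lborel) (\<lambda>(v, u). ?f x v u)" for x
  proof (rule lborel_pair.Fubini_integrable[OF fm])
    have "(\<lambda>v. \<integral>u. norm (case (v, u) of (v, u) \<Rightarrow> ?f x v u) \<partial>lborel) = (\<lambda>v. phi c v * phat c 0)"
    proof
      fix v
      have "(\<integral>u. norm (case (v, u) of (v, u) \<Rightarrow> ?f x v u) \<partial>lborel) = (\<integral>u. phi c v * phi c (u - v) \<partial>lborel)"
        using phi_pos[of c] by (intro Bochner_Integration.integral_cong) (auto simp: norm_mult abs_of_pos)
      then show "(\<integral>u. norm (case (v, u) of (v, u) \<Rightarrow> ?f x v u) \<partial>lborel) = phi c v * phat c 0"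
        by (simp add: sh)
    qed
    then show "integrable lborel (\<lambda>v. \<integral>u. norm (case (v, u) of (v, u) \<Rightarrow> ?f x v u) \<partial>lborel)"
      using phi_integrable[OF c] by simp
    show "AE v in lborel. integrable lborel (\<lambda>u. case (v, u) of (v, u) \<Rightarrow> ?f x v u)"
      using ii by simp
  qed
  have K: "(\<integral>v. ?f x v u \<partial>lborel) = of_real (Kc c u) * cis (- (x * u))" for x u
    unfolding Kc_def integral_mult_left_zero integral_complex_of_real ..
  have ci: "integrable lborel (\<lambda>u. of_real (Kc c u) * cis (- (0 * u)))"
    using lborel_pair.integrable_snd[OF int[of 0]] unfolding K by simp
  then have ri: "integrable lborel (\<lambda>u. complex_of_real (Kc c u))" by simp
  from integrable_Re[OF ri] show "integrable lborel (Kc c)" by simp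
  have "(\<integral>u. of_real (Kc c u) * cis (- (x * u)) \<partial>lborel) = (\<integral>u. (\<integral>v. ?f x v u \<partial>lborel) \<partial>lborel)"
    by (simp only: K)
  also have "\<dots> = (\<integral>v. (\<integral>u. ?f x v u \<partial>lborel) \<partial>lborel)"
    by (rule lborel_pair.Fubini_integral[OF int])
  also have "(\<lambda>v. \<integral>u. ?f x v u \<partial>lborel) = (\<lambda>v. of_real (phi c v) * cis (- (x * v)) * of_real (phat c x))"
  proof
    fix v
    have "(\<integral>u. ?f x v u \<partial>lborel) = \<bar>1\<bar> *\<^sub>R (\<integral>w. ?f x v (v + 1 * w) \<partial>lborel)"
      by (rule lborel_integral_real_affine) simp
    also have "\<dots> = (\<integral>w. (of_real (phi c v) * cis (- (x * v))) * (of_real (phi c w) * cis (- (x * w))) \<partial>lborel)"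
    proof -
      have "cis (- (x * (v + w))) = cis (- (x * v)) * cis (- (x * w))" for w
        by (simp add: cis_mult distrib_left)
      then show ?thesis by (simp add: mult.assoc mult.left_commute)
    qed
    also have "\<dots> = of_real (phi c v) * cis (- (x * v)) * of_real (phat c x)"
      unfolding integral_mult_right_zero phat_complex[OF c] ..
    finally show "(\<integral>u. ?f x v u \<partial>lborel) = of_real (phi c v) * cis (- (x * v)) * of_real (phat c x)" .
  qed
  also have "(\<integral>v. of_real (phi c v) * cis (- (x * v)) * of_real (phat c x) \<partial>lborel) = of_real (phat c x) * of_real (phat c x)"
    unfolding integral_mult_left_zero phat_complex[OF c] ..
  finally show "(\<integral>u. of_real (Kc c u) * cis (- (x * u)) \<partial>lborel) = of_real ((phat c x)\<^sup>2)"
    by (simp add: power2_eq_square)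
qed

text \<open>The decay of \<open>Kh\<close> is calibrated to the critical line: together with
  n^(-1/2) it leaves 1 / (n (1 + log^2 n)), and against the growth exp (x / 2) of the pole term it
  leaves 1 / (1 + x^2).\<close>

locale kernel =
  fixes K Kh :: "real \<Rightarrow> real" and B c C :: real
  assumes K_measurable [measurable]: "K \<in> borel_measurable borel"
    and K_nonneg: "K u \<ge> 0"
    and K_integrable: "integrable lborel K"
    and c_pos: "c > 0" and B_nonneg: "B \<ge> 0"
    and K_decay: "K u \<le> B * exp (- c * exp (pi * \<bar>u\<bar>))"
    and Kh: "(\<integral>u. of_real (K u) * cis (- (x * u)) \<partial>lborel) = of_real (Kh x)"
    and Kh_continuous: "continuous_on UNIV Kh"
    and Kh_nonneg: "Kh x \<ge> 0"
    and Kh_0: "Kh 0 > 0"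
    and Kh_decay: "x \<ge> 0 \<Longrightarrow> Kh x \<le> C * exp (- x / 2) / (1 + x\<^sup>2)"

lemma kernel_exists:
  assumes X: "X \<ge> 0"
  obtains K Kh B c C where "kernel K Kh B c C" "\<And>x. 0 \<le> x \<Longrightarrow> x \<le> X \<Longrightarrow> Kh x \<ge> Kh 0 / 4"
proof -
  obtain c where c: "c > 0" "phat c 0 > 0" "\<And>x. 0 \<le> x \<Longrightarrow> x \<le> X \<Longrightarrow> phat c x \<ge> phat c 0 / 2"
    using phat_concentration[OF X] by blast
  obtain B where B: "B \<ge> 0" "\<And>u. Kc c u \<le> B * exp (- c * exp (pi * \<bar>u\<bar>))"
    using Kc_decay[OF c(1)] by blast
  obtain D where D: "D \<ge> 0" "\<And>x. x > 0 \<Longrightarrow> \<bar>phat c x\<bar> \<le> D * exp (- x / 4) / x"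
    using phat_decay[OF c(1)] by blast
  \<comment> \<open>The decay estimate has a factor 1 / x and is useless near 0. For x \<le> 1 the
    bound |phat c x| \<le> phat c 0 replaces it, with exp 1 offsetting exp (- x / 2); C dominates
    both cases.\<close>
  define C where "C = 2 * D\<^sup>2 + 2 * exp 1 * (phat c 0)\<^sup>2"
  have "kernel (Kc c) (\<lambda>x. (phat c x)\<^sup>2) B c C"
  proof
    show "continuous_on UNIV (\<lambda>x. (phat c x)\<^sup>2)" by (intro continuous_intros phat_continuous c)
    fix x :: real assume x: "x \<ge> 0"
    show "(phat c x)\<^sup>2 \<le> C * exp (- x / 2) / (1 + x\<^sup>2)"
    proof (cases "x \<le> 1")
      case True
      have "(phat c x)\<^sup>2 \<le> (phat c 0)\<^sup>2"
        using abs_phat_le[OF c(1), of x] c(2) by (intro power2_le_iff_abs_le[THEN iffD2]) auto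
      also have "\<dots> \<le> C * exp (- x / 2) / (1 + x\<^sup>2)"
      proof -
        have "1 + x\<^sup>2 \<le> 2" using x True by (simp add: power_le_one)
        then have "(phat c 0)\<^sup>2 * (1 + x\<^sup>2) \<le> (phat c 0)\<^sup>2 * 2" by (intro mult_left_mono) auto
        also have "\<dots> \<le> (2 * exp 1 * (phat c 0)\<^sup>2) * exp (- x / 2)"
        proof -
          have "(1::real) \<le> exp 1 * exp (- x / 2)" using True x unfolding exp_add[symmetric] by simp
          then have "2 * (phat c 0)\<^sup>2 * 1 \<le> 2 * (phat c 0)\<^sup>2 * (exp 1 * exp (- x / 2))"
            by (intro mult_left_mono) auto
          then show ?thesis by (simp add: mult_ac)
        qed
        also have "\<dots> \<le> C * exp (- x / 2)" by (intro mult_right_mono) (auto simp: C_def)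
        finally show ?thesis by (simp add: pos_le_divide_eq add_pos_nonneg)
      qed
      finally show ?thesis .
    next
      case False
      then have x1: "x > 1" by simp
      have "(phat c x)\<^sup>2 \<le> (D * exp (- x / 4) / x)\<^sup>2"
        using D(2)[of x] x1 D(1) by (intro power2_le_iff_abs_le[THEN iffD2]) auto
      also have "\<dots> = D\<^sup>2 * exp (- x / 2) / x\<^sup>2"
        by (simp add: power_mult_distrib power_divide power2_eq_square exp_add[symmetric])
      also have "\<dots> \<le> C * exp (- x / 2) / (1 + x\<^sup>2)"
      proof -
        have "1 + x\<^sup>2 \<le> 2 * x\<^sup>2" using x1 by (simp add: one_le_power)
        then have "D\<^sup>2 * exp (- x / 2) * (1 + x\<^sup>2) \<le> D\<^sup>2 * exp (- x / 2) * (2 * x\<^sup>2)"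
          by (intro mult_left_mono) auto
        also have "\<dots> = (2 * D\<^sup>2) * exp (- x / 2) * x\<^sup>2" by simp
        also have "\<dots> \<le> C * exp (- x / 2) * x\<^sup>2"
          by (intro mult_right_mono) (auto simp: C_def)
        finally show ?thesis using x1 by (simp add: divide_le_eq pos_le_divide_eq add_pos_nonneg)
      qed
      finally show ?thesis .
    qed
  qed (use c B Kc_measurable Kc_nonneg Kc_integrable_and_hat[OF c(1)] in auto)
  moreover have "(phat c x)\<^sup>2 \<ge> (phat c 0)\<^sup>2 / 4" if "0 \<le> x" "x \<le> X" for x
  proof -
    have "(phat c 0 / 2)\<^sup>2 \<le> (phat c x)\<^sup>2" using c(2) c(3)[OF that] by (intro power_mono) auto
    then show ?thesis by (simp add: power_divide)
  qed
  ultimately show ?thesis using that by blast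
qed

section \<open>The logarithm of zeta to the right of the critical line\<close>

text \<open>The difference of two logarithms of one function is such an f; its derivative vanishes
  because exp f is constant.\<close>

lemma exp_eq_1_imp_constant:
  assumes hol: "f holomorphic_on U" and U: "open U" "convex U" and eq: "\<And>z. z \<in> U \<Longrightarrow> exp (f z) = 1"
  shows "\<exists>k. \<forall>z\<in>U. f z = k"
proof (rule has_field_derivative_zero_constant[OF U(2)])
  fix z assume z: "z \<in> U"
  have "((\<lambda>z. exp (f z)) has_field_derivative exp (f z) * deriv f z) (at z)"
    by (intro DERIV_fun_exp holomorphic_derivI[OF hol U(1) z])
  moreover have "((\<lambda>z. exp (f z)) has_field_derivative 0) (at z)"
    by (rule has_field_derivative_transform_within_open[of "\<lambda>_. 1" _ _ U]) (use U z eq in auto)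
  ultimately have "exp (f z) * deriv f z = 0" by (rule DERIV_unique)
  then have "deriv f z = 0" by simp
  then show "(f has_field_derivative 0) (at z within U)"
    using holomorphic_derivI[OF hol U(1) z] by (metis has_field_derivative_at_within)
qed

text \<open>The logarithm is taken of (s - 1) zeta(s), so that no cut at the pole is needed in the
  half-plane Re s > 1/2. The pole returns as the explicit term Ln (s - 1), and \<open>g_eq\<close>
  fixes the branch.\<close>

locale log_zreg =
  fixes g :: "complex \<Rightarrow> complex"
  assumes RH: riemann_hypothesis
    and g_holomorphic: "g holomorphic_on {s. Re s > 1/2}"
    and exp_g: "Re s > 1/2 \<Longrightarrow> exp (g s) = zreg s"
    and g_eq: "Re s > 1 \<Longrightarrow> g s = log_dseries s + Ln (s - 1)"

lemma log_zreg_exists: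
  assumes RH: riemann_hypothesis
  obtains g where "log_zreg g"
proof -
  let ?U = "{s. Re s > 1/2}"
  have nz: "zreg s \<noteq> 0" if "s \<in> ?U" for s using zreg_zero_imp_Re_le[OF RH, of s] that by force
  obtain l where l: "l holomorphic_on ?U" "\<And>z. z \<in> ?U \<Longrightarrow> zreg z = exp (l z)"
  proof (rule holomorphic_logarithm_exists[of ?U zreg 1])
    show "zreg holomorphic_on ?U" by (rule holomorphic_on_subset[OF zreg_holomorphic]) auto
    show "convex ?U" by (rule convex_halfspace_Re_gt)
    show "open ?U" by (rule open_half)
  qed (use nz in auto)
  have "\<exists>k. \<forall>z\<in>{s. Re s > 1}. l z - (log_dseries z + Ln (z - 1)) = k"
  proof (rule exp_eq_1_imp_constant[OF _ open_half convex_halfspace_Re_gt])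
    show "(\<lambda>z. l z - (log_dseries z + Ln (z - 1))) holomorphic_on {s. Re s > 1}"
      by (intro holomorphic_intros log_dseries_holomorphic holomorphic_on_subset[OF l(1)])
         (auto simp: complex_nonpos_Reals_iff)
    fix z :: complex assume z: "z \<in> {s. Re s > 1}"
    then have z1: "z - 1 \<noteq> 0" by auto
    have "exp (log_dseries z + Ln (z - 1)) = dseries z * (z - 1)"
      using z z1 by (simp add: exp_add exp_log_dseries)
    also have "\<dots> = exp (l z)" using z l(2)[of z] zreg_dseries[of z] by (simp add: mult.commute)
    finally show "exp (l z - (log_dseries z + Ln (z - 1))) = 1" by (simp add: exp_diff)
  qed
  then obtain k where k: "\<And>z. Re z > 1 \<Longrightarrow> l z - (log_dseries z + Ln (z - 1)) = k" by auto
  \<comment> \<open>k is thus a multiple of 2 pi i, and subtracting it from l keeps a logarithm of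
    zreg.\<close>
  have "exp k = 1"
  proof -
    have "exp (l 2) = exp (log_dseries 2 + Ln (2 - 1))"
      using l(2)[of 2] zreg_dseries[of 2] exp_log_dseries[of 2] by simp
    then have "exp (l 2 - (log_dseries 2 + Ln (2 - 1))) = 1" by (simp add: exp_diff)
    then show ?thesis using k[of 2] by simp
  qed
  then have "log_zreg (\<lambda>s. l s - k)"
    using RH l k by unfold_locales (auto intro!: holomorphic_intros simp: exp_diff algebra_simps)
  then show ?thesis by (rule that)
qed

text \<open>The shift 3 exceeds e, so the logarithm is at least 1 and absorbs additive
  constants.\<close>

lemma ln_abs_plus_3: "ln (\<bar>t\<bar> + 3) \<ge> (1::real)"
proof -
  have "exp 1 \<le> (3::real)" using exp_le by simp
  then have "exp 1 \<le> \<bar>t\<bar> + 3" by linarith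
  then show ?thesis by (subst ln_ge_iff) auto
qed

lemma ln_abs_plus_8: "ln (\<bar>t\<bar> + 8) \<le> 2 * ln (\<bar>t\<bar> + (3::real))"
proof -
  have "\<bar>t\<bar> + 8 \<le> (\<bar>t\<bar> + 3)\<^sup>2" by (simp add: power2_eq_square algebra_simps)
  then have "ln (\<bar>t\<bar> + 8) \<le> ln ((\<bar>t\<bar> + 3)\<^sup>2)" by (subst ln_le_cancel_iff) auto
  also have "\<dots> = 2 * ln (\<bar>t\<bar> + 3)" by (subst ln_realpow) auto
  finally show ?thesis .
qed

section \<open>Bounds for the logarithm and its limit on the critical line\<close>

context log_zreg
begin

lemma zreg_nonzero: "Re s > 1/2 \<Longrightarrow> zreg s \<noteq> 0"
  using exp_g[of s] by (metis exp_not_eq_zero)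

lemma g_deriv: "Re s > 1/2 \<Longrightarrow> (g has_field_derivative deriv zreg s / zreg s) (at s)"
proof -
  assume s: "Re s > 1/2"
  have d: "(g has_field_derivative deriv g s) (at s)"
    by (rule holomorphic_derivI[OF g_holomorphic open_half]) (use s in auto)
  have "((\<lambda>s. exp (g s)) has_field_derivative exp (g s) * deriv g s) (at s)"
    by (intro DERIV_fun_exp d)
  then have "(zreg has_field_derivative exp (g s) * deriv g s) (at s)"
    by (rule has_field_derivative_transform_within_open[OF _ open_half[of "1/2"]]) (use s exp_g in auto)
  then have "deriv zreg s = zreg s * deriv g s" using exp_g[OF s] by (simp add: DERIV_imp_deriv)
  then show ?thesis using d zreg_nonzero[OF s] by simp
qed

text \<open>The disc of radius 3/4 about 5/4 + it reaches the critical line, and at its centre the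
  Dirichlet series keeps zeta away from 0. All zeros satisfy Re \<rho> \<le> 1/2, so the bound is
  uniform up to the line.\<close>

lemma Re_g'_lower:
  obtains C where "C > 0"
    "\<And>\<sigma> t. 1/2 < \<sigma> \<Longrightarrow> \<sigma> \<le> 3/4 \<Longrightarrow> Re (deriv zreg (Complex \<sigma> t) / zreg (Complex \<sigma> t)) \<ge> - C * ln (\<bar>t\<bar> + 3)"
proof -
  obtain C0 where C0: "C0 \<ge> 1" "\<And>s. Re s \<ge> - 3/4 \<Longrightarrow> cmod (zreg s) \<le> C0 * (cmod s + 4) ^ 3"
    using zreg_bound by blast
  define M where "M = (\<Sum>n. real (Suc n) powr (- (5/4)))"
  have M: "M \<ge> 0" unfolding M_def by (intro suminf_nonneg summable_Suc_powr) auto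
  define D where "D = ln (4 * C0) + M + 6"
  have D: "D > 0" using C0(1) M by (simp add: D_def add_nonneg_pos)
  have "Re (deriv zreg (Complex \<sigma> t) / zreg (Complex \<sigma> t)) \<ge> - (224 * D) * ln (\<bar>t\<bar> + 3)"
    if \<sigma>: "1/2 < \<sigma>" "\<sigma> \<le> 3/4" for \<sigma> t
  proof -
    define s0 where "s0 = Complex (5/4) t"
    \<comment> \<open>exp A is the ratio of C0 (|t| + 8)^3, which bounds zreg on the disc of radius
      2, to the lower bound exp (- M) / 4 at the centre.\<close>
    define A where "A = ln (4 * C0) + M + 3 * ln (\<bar>t\<bar> + 8)"
    have l1: "ln (\<bar>t\<bar> + 3) \<ge> 1" by (rule ln_abs_plus_3)
    have A: "A > 0" "A \<le> D * ln (\<bar>t\<bar> + 3)"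
    proof -
      have "ln (\<bar>t\<bar> + 8) > 0" by (subst ln_gt_zero_iff) auto
      moreover have "ln (4 * C0) \<ge> 0" using C0(1) by simp
      ultimately show "A > 0" using M unfolding A_def by linarith
      have "(ln (4 * C0) + M) * 1 \<le> (ln (4 * C0) + M) * ln (\<bar>t\<bar> + 3)"
        using l1 M \<open>ln (4 * C0) \<ge> 0\<close> by (intro mult_left_mono) auto
      then show "A \<le> D * ln (\<bar>t\<bar> + 3)"
        using ln_abs_plus_8[of t] unfolding A_def D_def by (simp add: distrib_right)
    qed
    have expA: "exp A = 4 * C0 * exp M * (\<bar>t\<bar> + 8) ^ 3"
    proof -
      have "exp (3 * ln (\<bar>t\<bar> + 8)) = (\<bar>t\<bar> + 8) ^ 3"
        using exp_of_nat_mult[of 3 "ln (\<bar>t\<bar> + 8)"] by simp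
      then show ?thesis unfolding A_def exp_add using C0(1) by simp
    qed
    have z0: "cmod (zreg s0) \<ge> 1/4 * exp (- M)"
    proof -
      have "cmod (log_dseries s0) \<le> M" unfolding M_def by (rule log_dseries_bound) (auto simp: s0_def)
      then have "- M \<le> Re (log_dseries s0)" using abs_Re_le_cmod[of "log_dseries s0"] by linarith
      then have "exp (- M) \<le> cmod (dseries s0)"
        using exp_log_dseries[of s0] norm_exp_eq_Re[of "log_dseries s0"] by (simp add: s0_def)
      moreover have "1/4 \<le> cmod (s0 - 1)" using abs_Re_le_cmod[of "s0 - 1"] by (simp add: s0_def)
      ultimately have "1/4 * exp (- M) \<le> cmod (s0 - 1) * cmod (dseries s0)" by (intro mult_mono) auto
      then show ?thesis using zreg_dseries[of s0] by (simp add: norm_mult s0_def)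
    qed
    have "Re (deriv zreg (Complex \<sigma> t) / zreg (Complex \<sigma> t)) \<ge> - 224 * A"
    proof (rule Re_logderiv_lower_bound[OF zreg_holomorphic, of s0 _ "1/2"])
      have "1/4 * exp (- M) > 0" by simp
      then show "zreg s0 \<noteq> 0" using z0 by force
      show "A > 0" by (rule A)
      show "Complex \<sigma> t \<in> cball s0 (3/4)"
        using \<sigma> by (simp add: s0_def dist_norm complex_norm minus_complex.code)
      show "Re (Complex \<sigma> t) > 1/2" using \<sigma> by simp
      show "Re \<rho> \<le> 1/2" if "zreg \<rho> = 0" for \<rho> using zreg_zero_imp_Re_le[OF RH that] .
      fix s assume "s \<in> cball s0 2"
      then have s: "cmod (s - s0) \<le> 2" by (simp add: dist_norm norm_minus_commute)
      have "Re s \<ge> - 3/4" using s abs_Re_le_cmod[of "s - s0"] by (simp add: s0_def)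
      then have "cmod (zreg s) \<le> C0 * (cmod s + 4) ^ 3" by (rule C0(2))
      also have "\<dots> \<le> C0 * (\<bar>t\<bar> + 8) ^ 3"
      proof -
        have "cmod s \<le> cmod (s - s0) + cmod s0" using norm_triangle_ineq[of "s - s0" s0] by simp
        moreover have "cmod s0 \<le> 5/4 + \<bar>t\<bar>" using cmod_le[of s0] by (simp add: s0_def)
        ultimately show ?thesis using s C0(1) by (intro mult_left_mono power_mono) auto
      qed
      also have "\<dots> = exp A * (1/4 * exp (- M))"
        unfolding expA by (simp add: exp_minus field_simps)
      also have "\<dots> \<le> exp A * cmod (zreg s0)" using z0 by (intro mult_left_mono) auto
      finally show "cmod (zreg s) \<le> exp A * cmod (zreg s0)" .
    qed
    then show ?thesis using A(2) by simp
  qed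
  then show ?thesis using that[of "224 * D"] D by auto
qed

text \<open>The derivative of Im g(\<sigma> + iy) in y is Re g', so adding M y gives a nondecreasing
  function on the interval of length 2h. The constant is independent of \<sigma>, which lets the
  bound survive the limit \<sigma> \<rightarrow> 1/2.\<close>

lemma Im_g_increment_lower:
  obtains C where "C > 0"
    "\<And>\<sigma> t h. 1/2 < \<sigma> \<Longrightarrow> \<sigma> \<le> 3/4 \<Longrightarrow> h > 0 \<Longrightarrow>
       Im (g (Complex \<sigma> (t + h))) - Im (g (Complex \<sigma> (t - h))) \<ge> - C * h * ln (\<bar>t\<bar> + h + 3)"
proof -
  obtain C where C: "C > 0"
    "\<And>\<sigma> t. 1/2 < \<sigma> \<Longrightarrow> \<sigma> \<le> 3/4 \<Longrightarrow> Re (deriv zreg (Complex \<sigma> t) / zreg (Complex \<sigma> t)) \<ge> - C * ln (\<bar>t\<bar> + 3)"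
    using Re_g'_lower by blast
  have "Im (g (Complex \<sigma> (t + h))) - Im (g (Complex \<sigma> (t - h))) \<ge> - (2 * C) * h * ln (\<bar>t\<bar> + h + 3)"
    if \<sigma>: "1/2 < \<sigma>" "\<sigma> \<le> 3/4" and h: "h > 0" for \<sigma> t h
  proof -
    define M where "M = C * ln (\<bar>t\<bar> + h + 3)"
    define f where "f = (\<lambda>y. Im (g (Complex \<sigma> y)) + M * y)"
    have "f (t - h) \<le> f (t + h)"
    proof (rule DERIV_nonneg_imp_nondecreasing[of "t - h" "t + h" f])
      show "t - h \<le> t + h" using h by simp
      fix y assume y: "t - h \<le> y" "y \<le> t + h"
      define s where "s = Complex \<sigma> y"
      have gd: "(g has_field_derivative deriv zreg s / zreg s) (at s)"
        by (rule g_deriv) (use \<sigma> in \<open>simp add: s_def\<close>)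
      have "((\<lambda>y. Complex \<sigma> y) has_vector_derivative \<i>) (at y)"
        unfolding Complex_eq by (auto intro!: derivative_eq_intros)
      from field_vector_diff_chain_at[OF this, of g "deriv zreg s / zreg s"] gd
      have "((\<lambda>y. g (Complex \<sigma> y)) has_vector_derivative \<i> * (deriv zreg s / zreg s)) (at y)"
        by (simp add: o_def s_def)
      then have "((\<lambda>y. Im (g (Complex \<sigma> y))) has_vector_derivative Im (\<i> * (deriv zreg s / zreg s))) (at y)"
        by (rule bounded_linear.has_vector_derivative[OF bounded_linear_Im])
      then have "((\<lambda>y. Im (g (Complex \<sigma> y))) has_real_derivative Re (deriv zreg s / zreg s)) (at y)"
        by (simp add: has_real_derivative_iff_has_vector_derivative del: times_divide_eq_right)
      from DERIV_add[OF this DERIV_cmult[OF DERIV_ident, of M]]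
      have "(f has_real_derivative Re (deriv zreg s / zreg s) + M) (at y)"
        unfolding f_def by (simp only: mult_1_right)
      moreover have "Re (deriv zreg s / zreg s) + M \<ge> 0"
      proof -
        have "ln (\<bar>y\<bar> + 3) \<le> ln (\<bar>t\<bar> + h + 3)" using y h by (subst ln_le_cancel_iff) auto
        then have "C * ln (\<bar>y\<bar> + 3) \<le> M" unfolding M_def using C(1) by (intro mult_left_mono) auto
        moreover have "Re (deriv zreg s / zreg s) \<ge> - C * ln (\<bar>y\<bar> + 3)" unfolding s_def by (rule C(2)[OF \<sigma>])
        ultimately show ?thesis by simp
      qed
      ultimately show "\<exists>d. (f has_real_derivative d) (at y) \<and> 0 \<le> d" by blast
    qed
    then show ?thesis unfolding f_def M_def by (simp add: algebra_simps)
  qed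
  then show ?thesis using that[of "2 * C"] C(1) by auto
qed

text \<open>A two-sided bound, obtained only at distance \<delta> from the critical line, with a
  constant of order 1 / \<delta>. It serves the absolute convergence and the holomorphy of
  \<open>Fint\<close> to the right of the line.\<close>

lemma g_growth:
  assumes \<delta>: "\<delta> > 0"
  obtains C where "C > 0"
    "\<And>\<sigma> t. 1/2 + \<delta> \<le> \<sigma> \<Longrightarrow> \<sigma> \<le> 2 \<Longrightarrow> cmod (g (Complex \<sigma> t)) \<le> C * ln (\<bar>t\<bar> + 3)"
proof -
  obtain C0 where C0: "C0 \<ge> 1" "\<And>s. Re s \<ge> - 3/4 \<Longrightarrow> cmod (zreg s) \<le> C0 * (cmod s + 4) ^ 3"
    using zreg_bound by blast
  define M where "M = (\<Sum>n. real (Suc n) powr (- 2))"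
  have M: "M \<ge> 0" unfolding M_def by (intro suminf_nonneg summable_Suc_powr) auto
  define D where "D = M + pi + 1"
  have D: "D > 0" using M pi_gt_zero unfolding D_def by linarith
  define E where "E = ln C0 + 7 + D"
  have E: "E > 0" using C0(1) D by (simp add: E_def add_nonneg_pos)
  have "cmod (g (Complex \<sigma> t)) \<le> (D + 3 * E / \<delta>) * ln (\<bar>t\<bar> + 3)"
    if \<sigma>: "1/2 + \<delta> \<le> \<sigma>" "\<sigma> \<le> 2" for \<sigma> t
  proof -
    define s0 where "s0 = Complex 2 t"
    define l where "l = ln (\<bar>t\<bar> + 3)"
    have l1: "l \<ge> 1" unfolding l_def by (rule ln_abs_plus_3)
    have g0: "cmod (g s0) \<le> D * l"
    proof -
      have "cmod (log_dseries s0) \<le> M" unfolding M_def by (rule log_dseries_bound) (auto simp: s0_def)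
      moreover have "cmod (Ln (s0 - 1)) \<le> l + pi"
      proof -
        have nz: "s0 - 1 \<noteq> 0" by (auto simp: s0_def complex_eq_iff)
        have n1: "1 \<le> cmod (s0 - 1)" using abs_Re_le_cmod[of "s0 - 1"] by (simp add: s0_def)
        have n2: "cmod (s0 - 1) \<le> \<bar>t\<bar> + 3" using cmod_le[of "s0 - 1"] by (simp add: s0_def)
        have "cmod (Ln (s0 - 1)) \<le> \<bar>Re (Ln (s0 - 1))\<bar> + \<bar>Im (Ln (s0 - 1))\<bar>" by (rule cmod_le)
        also have "Re (Ln (s0 - 1)) = ln (cmod (s0 - 1))" using nz by (rule Re_Ln)
        also have "\<bar>ln (cmod (s0 - 1))\<bar> \<le> l"
        proof -
          have "ln (cmod (s0 - 1)) \<le> l" unfolding l_def using n1 n2 by (subst ln_le_cancel_iff) auto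
          moreover have "0 \<le> ln (cmod (s0 - 1))" using n1 by simp
          ultimately show ?thesis by simp
        qed
        also have "\<bar>Im (Ln (s0 - 1))\<bar> \<le> pi"
          using mpi_less_Im_Ln[OF nz] Im_Ln_le_pi[OF nz] by (simp add: abs_le_iff)
        finally show ?thesis by simp
      qed
      moreover have "g s0 = log_dseries s0 + Ln (s0 - 1)" by (rule g_eq) (simp add: s0_def)
      ultimately have "cmod (g s0) \<le> (M + pi) * 1 + l"
        using norm_triangle_ineq[of "log_dseries s0" "Ln (s0 - 1)"] by simp
      also have "(M + pi) * 1 \<le> (M + pi) * l" using M l1 pi_gt_zero by (intro mult_left_mono) auto
      finally show ?thesis by (simp add: D_def algebra_simps)
    qed
    define q where "q = (\<lambda>s. g s - g s0)"
    have sub: "ball s0 (3/2) \<subseteq> {s. Re s > 1/2}"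
    proof
      fix s assume "s \<in> ball s0 (3/2)"
      then have "cmod (s0 - s) < 3/2" by (simp add: dist_norm)
      then show "s \<in> {s. Re s > 1/2}" using abs_Re_le_cmod[of "s0 - s"] by (simp add: s0_def)
    qed
    have d: "cmod (Complex \<sigma> t - s0) = 2 - \<sigma>"
      using \<sigma> by (simp add: s0_def complex_norm minus_complex.code)
    have "cmod (q (Complex \<sigma> t)) \<le> 2 * (E * l) * cmod (Complex \<sigma> t - s0) / (3/2 - cmod (Complex \<sigma> t - s0))"
    proof (rule Borel_Caratheodory)
      show "q holomorphic_on ball s0 (3/2)"
        unfolding q_def by (intro holomorphic_intros holomorphic_on_subset[OF g_holomorphic sub])
      show "Complex \<sigma> t \<in> ball s0 (3/2)" using \<sigma> \<delta> d by (simp add: dist_norm norm_minus_commute)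
      show "E * l > 0" using E l1 by simp
      fix s assume s: "s \<in> ball s0 (3/2)"
      then have Re: "Re s > 1/2" and ds: "cmod (s - s0) < 3/2" using sub by (auto simp: dist_norm norm_minus_commute)
      have "exp (Re (g s)) = cmod (zreg s)" using exp_g[OF Re] by (metis norm_exp_eq_Re)
      also have "\<dots> \<le> C0 * (cmod s + 4) ^ 3" using Re by (intro C0(2)) auto
      also have "\<dots> \<le> C0 * (\<bar>t\<bar> + 8) ^ 3"
      proof -
        have "cmod s \<le> cmod (s - s0) + cmod s0" using norm_triangle_ineq[of "s - s0" s0] by simp
        moreover have "cmod s0 \<le> 2 + \<bar>t\<bar>" using cmod_le[of s0] by (simp add: s0_def)
        ultimately show ?thesis using ds C0(1) by (intro mult_left_mono power_mono) auto
      qed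
      also have "\<dots> = exp (ln C0 + 3 * ln (\<bar>t\<bar> + 8))"
        using exp_of_nat_mult[of 3 "ln (\<bar>t\<bar> + 8)"] C0(1) by (simp add: exp_add)
      finally have "Re (g s) \<le> ln C0 + 3 * ln (\<bar>t\<bar> + 8)" by simp
      also have "\<dots> \<le> ln C0 * l + 6 * l"
        using mult_left_mono[OF l1, of "ln C0"] C0(1) ln_abs_plus_8[of t] by (simp add: l_def)
      finally have "Re (g s) \<le> ln C0 * l + 6 * l" .
      moreover have "- Re (g s0) \<le> D * l" using g0 abs_Re_le_cmod[of "g s0"] by linarith
      ultimately show "Re (q s) < E * l" using l1 by (simp add: q_def E_def distrib_right)
    qed (auto simp: q_def)
    also have "\<dots> \<le> 2 * (E * l) * (3/2) / \<delta>"
      unfolding d using \<sigma> \<delta> E l1 by (intro frac_le mult_left_mono mult_nonneg_nonneg) auto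
    finally have "cmod (q (Complex \<sigma> t)) \<le> 3 * E / \<delta> * l" by simp
    moreover have "cmod (g (Complex \<sigma> t)) \<le> cmod (q (Complex \<sigma> t)) + cmod (g s0)"
      using norm_triangle_ineq[of "q (Complex \<sigma> t)" "g s0"] by (simp add: q_def)
    ultimately show ?thesis using g0 by (simp add: l_def distrib_right)
  qed
  then show ?thesis using that[of "D + 3 * E / \<delta>"] D E \<delta> by (auto simp: add_pos_nonneg)
qed

text \<open>Around a boundary point where zreg does not vanish there is a logarithm on a full disc.
  On the right half of the disc, a convex set, it differs from g by a constant, so the limit of g
  exists.\<close>

lemma g_boundary_limit:
  assumes nz: "zreg (Complex (1/2) t) \<noteq> 0"
  shows "\<exists>l. ((\<lambda>\<sigma>. g (Complex \<sigma> t)) \<longlongrightarrow> l) (at_right (1/2))"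
proof -
  define s1 where "s1 = Complex (1/2) t"
  have "isCont zreg s1"
    using holomorphic_on_imp_continuous_on[OF zreg_holomorphic] by (simp add: continuous_on_eq_continuous_at)
  then obtain r where r: "r > 0" "\<And>s. dist s1 s < r \<Longrightarrow> zreg s \<noteq> 0"
    using continuous_at_avoid[of s1 zreg 0] nz unfolding s1_def by blast
  obtain l where l: "l holomorphic_on ball s1 r" "\<And>z. z \<in> ball s1 r \<Longrightarrow> zreg z = exp (l z)"
  proof (rule holomorphic_logarithm_exists[of "ball s1 r" zreg s1])
    show "zreg holomorphic_on ball s1 r" by (rule holomorphic_on_subset[OF zreg_holomorphic]) auto
  qed (use r in auto)
  define V where "V = ball s1 r \<inter> {s. Re s > 1/2}"
  have "\<exists>k. \<forall>z\<in>V. g z - l z = k"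
  proof (rule exp_eq_1_imp_constant)
    show "(\<lambda>z. g z - l z) holomorphic_on V"
      by (intro holomorphic_intros holomorphic_on_subset[OF g_holomorphic] holomorphic_on_subset[OF l(1)])
         (auto simp: V_def)
    show "open V" unfolding V_def by (intro open_Int open_ball open_half)
    show "convex V" unfolding V_def by (intro convex_Int convex_ball convex_halfspace_Re_gt)
    show "exp (g z - l z) = 1" if "z \<in> V" for z
      using that l(2)[of z] exp_g[of z] by (simp add: V_def exp_diff)
  qed
  then obtain k where k: "\<And>z. z \<in> V \<Longrightarrow> g z = l z + k" by (force simp: algebra_simps)
  have line: "((\<lambda>\<sigma>. Complex \<sigma> t) \<longlongrightarrow> s1) (at_right (1/2))"
    unfolding s1_def Complex_eq by (auto intro!: tendsto_eq_intros)
  have "isCont l s1"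
    using holomorphic_on_imp_continuous_on[OF l(1)] r(1) by (simp add: continuous_on_eq_continuous_at)
  then have "((\<lambda>\<sigma>. l (Complex \<sigma> t) + k) \<longlongrightarrow> l s1 + k) (at_right (1/2))"
    by (intro tendsto_intros isCont_tendsto_compose[OF _ line])
  moreover have "\<forall>\<^sub>F \<sigma> in at_right (1/2). l (Complex \<sigma> t) + k = g (Complex \<sigma> t)"
  proof -
    have "\<forall>\<^sub>F \<sigma> in at_right (1/2). Complex \<sigma> t \<in> ball s1 r"
      by (rule topological_tendstoD[OF line]) (use r in auto)
    moreover have "\<forall>\<^sub>F \<sigma> in at_right (1/2::real). \<sigma> > 1/2" by (simp add: eventually_at_filter)
    ultimately show ?thesis by eventually_elim (auto simp: k V_def)
  qed
  ultimately show ?thesis by (blast intro: Lim_transform_eventually)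
qed

end

section \<open>The argument of zeta and S(t)\<close>

lemma is_arg_zeta_unique:
  assumes 1: "is_arg_zeta t \<theta>" and 2: "is_arg_zeta t \<phi>" and nz: "\<not> zeta_zero_ordinate t"
  shows "\<theta> (1/2) = \<phi> (1/2)"
proof -
  define d where "d = (\<lambda>\<sigma>. \<theta> \<sigma> - \<phi> \<sigma>)"
  have cis1: "cis (d \<sigma>) = 1" if "\<sigma> \<ge> 1/2" for \<sigma>
  proof -
    have z: "zeta (Complex \<sigma> t) \<noteq> 0" using nz by (auto simp: zeta_zero_ordinate_def)
    have "of_real (cmod (zeta (Complex \<sigma> t))) * cis (\<theta> \<sigma>) = of_real (cmod (zeta (Complex \<sigma> t))) * cis (\<phi> \<sigma>)"
      using 1 2 that unfolding is_arg_zeta_def by metis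
    then have "cis (\<theta> \<sigma>) = cis (\<phi> \<sigma>)" using z by simp
    then show ?thesis unfolding d_def by (simp add: cis_divide[symmetric])
  qed
  have int: "\<exists>n::int. d \<sigma> = 2 * pi * n" if "\<sigma> \<ge> 1/2" for \<sigma>
  proof -
    have "cos (d \<sigma>) = 1" using arg_cong[OF cis1[OF that], of Re] by simp
    then show ?thesis by (auto simp: cos_one_2pi_int)
  qed
  \<comment> \<open>d is continuous with values in the multiples of 2 pi, of which two different
    ones are at least 2 pi apart; the limit 0 at infinity then determines the constant.\<close>
  have "d constant_on {1/2..}"
  proof (rule continuous_discrete_range_constant)
    show "connected {1/2::real..}" by (intro convex_connected) auto
    show "continuous_on {1/2..} d" using 1 2 unfolding d_def is_arg_zeta_def by (intro continuous_intros) auto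
    fix x :: real assume x: "x \<in> {1/2..}"
    have "2 * pi \<le> norm (d y - d x)" if y: "y \<in> {1/2..}" "d y \<noteq> d x" for y
    proof -
      obtain m n :: int where mn: "d x = 2 * pi * m" "d y = 2 * pi * n" using int[of x] int[of y] x y by auto
      then have "n - m \<noteq> 0" using y by auto
      then have "1 \<le> \<bar>real_of_int (n - m)\<bar>" by linarith
      then have "2 * pi * 1 \<le> 2 * pi * \<bar>real_of_int (n - m)\<bar>" by (intro mult_left_mono) auto
      then show ?thesis unfolding mn by (simp add: abs_mult flip: right_diff_distrib)
    qed
    then show "\<exists>e>0. \<forall>y. y \<in> {1/2..} \<and> d y \<noteq> d x \<longrightarrow> e \<le> norm (d y - d x)"
      using pi_gt_zero by (intro exI[of _ "2 * pi"]) auto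
  qed
  then obtain k where k: "\<And>x. x \<ge> 1/2 \<Longrightarrow> d x = k" unfolding constant_on_def by auto
  have "(d \<longlongrightarrow> 0 - 0) at_top" using 1 2 unfolding d_def is_arg_zeta_def by (intro tendsto_diff) auto
  moreover have "\<forall>\<^sub>F x in at_top. d x = k" using eventually_ge_at_top[of "1/2"] by eventually_elim (rule k)
  then have "(d \<longlongrightarrow> k) at_top" by (rule tendsto_eventually)
  ultimately have "k = 0" using tendsto_unique[of at_top d] by force
  then show ?thesis using k[of "1/2"] by (simp add: d_def)
qed

text \<open>On the half-line g - Ln (s - 1) is a continuous logarithm of zeta tending to 0, so its
  imaginary part is the argument defining S. The pole term contributes the argument of s - 1 = - 1/2
  + it.\<close>

lemma (in log_zreg) Im_g_limit:
  assumes t: "\<not> zeta_zero_ordinate t"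
  shows "((\<lambda>\<sigma>. Im (g (Complex \<sigma> t))) \<longlongrightarrow> pi * S t + Im (Ln (Complex (-1/2) t))) (at_right (1/2))"
proof -
  have zz: "zeta (Complex \<sigma> t) \<noteq> 0" for \<sigma> using t by (auto simp: zeta_zero_ordinate_def)
  \<comment> \<open>The convention \<open>zeta 1 = 0\<close> makes 0 an ordinate, so t is nonzero
    and s - 1 stays off the branch cut of Ln.\<close>
  have t0: "t \<noteq> 0"
  proof
    assume "t = 0"
    then have "zeta (Complex 1 t) = 0" by (simp add: zeta_eq_zreg one_complex.code[symmetric])
    then show False using zz by blast
  qed
  have ne: "Complex a t \<notin> \<real>\<^sub>\<le>\<^sub>0" "Complex a t \<noteq> 0" for a
    using t0 by (auto simp: complex_nonpos_Reals_iff complex_eq_iff)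
  have s1: "Complex \<sigma> t - 1 = Complex (\<sigma> - 1) t" for \<sigma> by (auto simp: complex_eq_iff)
  have "zreg (Complex (1/2) t) \<noteq> 0" using zz[of "1/2"] by (auto simp: zeta_eq_zreg)
  then obtain l where l: "((\<lambda>\<sigma>. g (Complex \<sigma> t)) \<longlongrightarrow> l) (at_right (1/2))"
    using g_boundary_limit by blast
  \<comment> \<open>The limit l replaces g at the endpoint, where the locale gives no information
    about g.\<close>
  define w where "w = (\<lambda>\<sigma>. (if \<sigma> = 1/2 then l else g (Complex \<sigma> t)) - Ln (Complex (\<sigma> - 1) t))"
  have Lnc: "continuous_on A (\<lambda>\<sigma>. Ln (Complex (\<sigma> - 1) t))" for A
    unfolding Complex_eq by (intro continuous_intros) (use ne(1)[of "x - 1" for x] in \<open>auto simp: Complex_eq\<close>)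
  have gc: "continuous_on {1/2..} (\<lambda>\<sigma>. if \<sigma> = 1/2 then l else g (Complex \<sigma> t))"
  proof -
    have "((\<lambda>\<sigma>. if \<sigma> = 1/2 then l else g (Complex \<sigma> t)) \<longlongrightarrow> (if x = 1/2 then l else g (Complex x t))) (at x within {1/2..})"
      if x: "x \<in> {1/2..}" for x
    proof (cases "x = 1/2")
      case True
      have "at x within {1/2..} = at_right (1/2)" unfolding True by (rule at_within_Ici_at_right)
      moreover have "((\<lambda>\<sigma>. if \<sigma> = 1/2 then l else g (Complex \<sigma> t)) \<longlongrightarrow> l) (at_right (1/2))"
        by (rule Lim_transform_eventually[OF l]) (auto simp: eventually_at_filter)
      ultimately show ?thesis unfolding True by simp
    next
      case False
      then have x2: "x > 1/2" using x by simp
      have "isCont g (Complex x t)"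
        by (rule DERIV_isCont[OF g_deriv]) (use x2 in simp)
      moreover have "((\<lambda>\<sigma>. Complex \<sigma> t) \<longlongrightarrow> Complex x t) (at x within {1/2..})"
        unfolding Complex_eq by (auto intro!: tendsto_eq_intros)
      ultimately have "((\<lambda>\<sigma>. g (Complex \<sigma> t)) \<longlongrightarrow> g (Complex x t)) (at x within {1/2..})"
        by (rule isCont_tendsto_compose)
      moreover have "\<forall>\<^sub>F \<sigma> in at x within {1/2..}. g (Complex \<sigma> t) = (if \<sigma> = 1/2 then l else g (Complex \<sigma> t))"
      proof -
        have "\<forall>\<^sub>F \<sigma> in at x within {1/2..}. \<sigma> > 1/2"
          using x2 order_tendstoD(1)[OF tendsto_ident_at] by blast
        then show ?thesis by eventually_elim auto
      qed
      ultimately show ?thesis using False by (simp add: Lim_transform_eventually)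
    qed
    then show ?thesis by (simp add: continuous_on_def)
  qed
  have wc: "continuous_on {1/2..} w" unfolding w_def by (intro continuous_on_diff gc Lnc)
  have ew: "zeta (Complex \<sigma> t) = exp (w \<sigma>)" if "\<sigma> > 1/2" for \<sigma>
    using that exp_g[of "Complex \<sigma> t"] ne by (simp add: w_def zeta_eq_zreg exp_diff s1)
  have ew': "zeta (Complex (1/2) t) = exp (w (1/2))"
  proof -
    have "((\<lambda>\<sigma>. zreg (Complex \<sigma> t)) \<longlongrightarrow> zreg (Complex (1/2) t)) (at_right (1/2))"
    proof (rule isCont_tendsto_compose[of _ zreg])
      show "isCont zreg (Complex (1/2) t)"
        using holomorphic_on_imp_continuous_on[OF zreg_holomorphic] by (simp add: continuous_on_eq_continuous_at)
      show "((\<lambda>\<sigma>. Complex \<sigma> t) \<longlongrightarrow> Complex (1/2) t) (at_right (1/2))"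
        unfolding Complex_eq by (auto intro!: tendsto_eq_intros)
    qed
    moreover have "((\<lambda>\<sigma>. zreg (Complex \<sigma> t)) \<longlongrightarrow> exp l) (at_right (1/2))"
    proof (rule Lim_transform_eventually[OF tendsto_exp[OF l]])
      have "\<forall>\<^sub>F \<sigma> in at_right (1/2::real). \<sigma> > 1/2" by (simp add: eventually_at_filter)
      then show "\<forall>\<^sub>F \<sigma> in at_right (1/2). exp (g (Complex \<sigma> t)) = zreg (Complex \<sigma> t)"
        by eventually_elim (simp add: exp_g)
    qed
    ultimately have "zreg (Complex (1/2) t) = exp l"
      by (rule tendsto_unique[rotated]) simp
    then show ?thesis using ne by (simp add: w_def zeta_eq_zreg exp_diff s1)
  qed
  have "is_arg_zeta t (\<lambda>\<sigma>. Im (w \<sigma>))"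
    unfolding is_arg_zeta_def
  proof (intro conjI allI impI)
    show "continuous_on {1/2..} (\<lambda>\<sigma>. Im (w \<sigma>))" by (intro continuous_intros wc)
    fix \<sigma> :: real assume "\<sigma> \<ge> 1/2"
    then have "\<sigma> = 1/2 \<or> \<sigma> > 1/2" by linarith
    then have "zeta (Complex \<sigma> t) = exp (w \<sigma>)" using ew ew' by blast
    then show "zeta (Complex \<sigma> t) = of_real (cmod (zeta (Complex \<sigma> t))) * cis (Im (w \<sigma>))"
      by (metis exp_eq_polar norm_exp_eq_Re)
  next
    define C where "C = (\<Sum>n. real (Suc n) powr (-2))"
    have "\<forall>\<^sub>F \<sigma> in at_top. norm (Im (w \<sigma>)) \<le> 2 powr (2 - \<sigma>) * C"
      using eventually_ge_at_top[of 2]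
    proof eventually_elim
      case (elim \<sigma>)
      have "w \<sigma> = log_dseries (Complex \<sigma> t)"
        using elim g_eq[of "Complex \<sigma> t"] by (simp add: w_def s1)
      moreover have "cmod (log_dseries (Complex \<sigma> t) - of_real (lcoef (Suc 0))) \<le> 2 powr (2 - \<sigma>) * C"
        using dirichlet_series_at_infinity[where c = "\<lambda>n. of_real (lcoef (Suc n))" and s = "Complex \<sigma> t"]
          norm_lcoef log_dseries_sums[of "Complex \<sigma> t"] elim unfolding C_def by auto
      ultimately have "cmod (w \<sigma>) \<le> 2 powr (2 - \<sigma>) * C" by (simp add: lcoef_def)
      then show ?case using abs_Im_le_cmod[of "w \<sigma>"] by simp
    qed
    moreover have "((\<lambda>\<sigma>. 2 powr (2 - \<sigma>) * C) \<longlongrightarrow> 0) at_top" by real_asymp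
    ultimately show "((\<lambda>\<sigma>. Im (w \<sigma>)) \<longlongrightarrow> 0) at_top" by (rule Lim_null_comparison)
  qed
  then have "S_regular t = Im (w (1/2)) / pi"
    unfolding S_regular_def using is_arg_zeta_unique[OF _ _ t] by (intro the_equality) auto
  then have "pi * S t = Im (w (1/2))" using t by (simp add: S_def)
  then have "Im l = pi * S t + Im (Ln (Complex (-1/2) t))" by (simp add: w_def)
  then show ?thesis using tendsto_Im[OF l] by simp
qed

text \<open>The ordinates thus form a null set, and the values of S there do not affect integrals.
  If zreg were constant, the constant would be 1 and zeta(2) = 1, but the first two terms of the
  series already exceed 1.\<close>

lemma countable_zeta_zero_ordinates: "countable {t. zeta_zero_ordinate t}"
proof -
  have "countable {z\<in>UNIV. zreg z = 0}"
  proof (rule holomorphic_countable_zeros[OF zreg_holomorphic])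
    show "\<not> zreg constant_on UNIV"
    proof
      assume "zreg constant_on UNIV"
      then obtain k where k: "\<And>z. zreg z = k" unfolding constant_on_def by auto
      have "k = 1" using k zreg_1 by metis
      then have "dseries 2 = 1" using zreg_dseries[of 2] k[of 2] by simp
      then have "(\<lambda>n. of_nat (Suc n) powr (- 2)) sums (1 :: complex)" using dseries(2)[of 2] by simp
      from sums_Re[OF this] have "(\<lambda>n. Re (of_nat (Suc n) powr (- 2 :: complex))) sums 1"
        by (simp only: one_complex.sel)
      moreover have "Re (of_nat (Suc n) powr (- 2 :: complex)) = exp (- 2 * ln (real (Suc n)))" for n
        unfolding nat_powr_exp by (simp add: Re_exp del: of_nat_Suc)
      ultimately have sm: "(\<lambda>n. exp (- 2 * ln (real (Suc n)))) sums 1" by (simp only:)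
      have "(\<Sum>n<2. exp (- 2 * ln (real (Suc n)))) \<le> (\<Sum>n. exp (- 2 * ln (real (Suc n))))"
        by (rule sum_le_suminf[OF sums_summable[OF sm]]) auto
      then have "1 + exp (- 2 * ln 2) \<le> (1::real)" using sums_unique[OF sm] by (simp add: numeral_2_eq_2)
      then show False by simp
    qed
  qed auto
  then have "countable (insert 1 {z. zreg z = 0})" by simp
  then have "countable (Im ` insert 1 {z. zreg z = 0})" by (rule countable_image)
  then show ?thesis
    by (rule countable_subset[rotated]) (auto simp: zeta_zero_ordinate_def zeta_eq_zreg image_iff)
qed

section \<open>Laplace transforms\<close>

text \<open>This is sin (h x) / x with its limit h at 0; twice it is the Fourier transform of the
  indicator of [- h, h].\<close>

definition wsinc :: "real \<Rightarrow> real \<Rightarrow> real" where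
  "wsinc h x = h * sinc (h * x)"

lemma wsinc_continuous: "continuous_on A (wsinc h)"
  unfolding wsinc_def[abs_def] by (intro continuous_intros)

lemma wsinc_measurable [measurable]: "wsinc h \<in> borel_measurable borel"
  by (intro borel_measurable_continuous_onI wsinc_continuous)

lemma mult_wsinc: "x * wsinc h x = sin (h * x)"
  by (auto simp: wsinc_def)

lemma abs_wsinc_le: "h > 0 \<Longrightarrow> \<bar>wsinc h x\<bar> \<le> h"
  using abs_sin_x_le_abs_x[of "h * x"] by (simp add: wsinc_def abs_mult abs_divide divide_le_eq)

lemma exp_decay_quadratic:
  fixes b x :: real
  assumes b: "b > 0" and x: "x \<ge> 0"
  shows "exp (- b * x) \<le> (1 + 2 / b\<^sup>2) / (1 + x\<^sup>2)"
proof -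
  have "1 + b * x + (b * x)\<^sup>2 / 2 \<le> exp (b * x)" using b x by (intro exp_lower_Taylor_quadratic) auto
  moreover have "b * x \<ge> 0" using b x by simp
  ultimately have e: "1 + (b * x)\<^sup>2 / 2 \<le> exp (b * x)" by linarith
  have "1 + x\<^sup>2 \<le> (1 + 2 / b\<^sup>2) * (1 + (b * x)\<^sup>2 / 2)"
    using b by (simp add: field_simps power_mult_distrib)
  also have "\<dots> \<le> (1 + 2 / b\<^sup>2) * exp (b * x)" using e by (intro mult_left_mono) auto
  finally have "(1 + x\<^sup>2) / exp (b * x) \<le> 1 + 2 / b\<^sup>2" by (simp add: divide_le_eq)
  moreover have "(1 + x\<^sup>2) / exp (b * x) = exp (- b * x) * (1 + x\<^sup>2)" by (simp add: exp_minus field_simps)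
  moreover have "1 + x\<^sup>2 > 0" by (simp add: add_pos_nonneg)
  ultimately show ?thesis by (simp only: pos_le_divide_eq)
qed

lemma laplace_exp:
  fixes a :: complex
  assumes a: "Re a > 0"
  shows "integrable lborel (\<lambda>x. of_real (indicator {0..} x) * exp (- a * of_real x))"
    and "(\<integral>x. of_real (indicator {0..} x) * exp (- a * of_real x) \<partial>lborel) = 1 / a"
proof -
  let ?f = "\<lambda>x. of_real (indicator {0..} x) * exp (- a * of_real x)"
  show int: "integrable lborel ?f"
  proof (rule integrable_quadratic_decay[of _ "1 + 2 / (Re a)\<^sup>2"])
    have [measurable]: "(\<lambda>x::real. exp (- a * of_real x)) \<in> borel_measurable borel"
      by (intro borel_measurable_continuous_onI continuous_intros)
    show "?f \<in> borel_measurable borel" by measurable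
    show "cmod (?f x) \<le> (1 + 2 / (Re a)\<^sup>2) / (1 + x\<^sup>2)" for x
      using exp_decay_quadratic[OF a, of x] by (cases "x \<ge> 0") (auto simp: norm_mult indicator_def)
  qed
  define F where "F = (\<lambda>x::real. - exp (- a * of_real x) / a)"
  have a0: "a \<noteq> 0" using a by auto
  have "(LBINT x=0..\<infinity>. exp (- a * of_real x)) = 0 - (- 1 / a)"
  proof (rule interval_integral_FTC_integrable)
    show "(F has_vector_derivative exp (- a * of_real x)) (at x)" for x
    proof -
      have "((\<lambda>z. - exp (- a * z) / a) has_field_derivative - (exp (- a * of_real x) * (- a * 1)) / a) (at (of_real x))"
        by (intro DERIV_cdivide DERIV_minus DERIV_fun_exp DERIV_cmult DERIV_ident)
      from has_vector_derivative_real_field[OF this] show ?thesis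
        unfolding F_def using a0 by (simp add: o_def)
    qed
    show "isCont (\<lambda>x. exp (- a * of_real x)) x" for x :: real by (intro continuous_intros)
    have "set_integrable lborel {0..} (\<lambda>x. exp (- a * of_real x))"
      using int by (simp add: set_integrable_def scaleR_conv_of_real)
    then show "set_integrable lborel (einterval 0 \<infinity>) (\<lambda>x. exp (- a * of_real x))"
      by (rule set_integrable_subset) (auto simp: einterval_def)
    have "(F \<longlongrightarrow> - exp (- a * of_real 0) / a) (at_right 0)"
      unfolding F_def using a0 by (intro tendsto_intros) auto
    then show "((F \<circ> real_of_ereal) \<longlongrightarrow> - 1 / a) (at_right 0)"
      by (simp add: ereal_tendsto_simps zero_ereal_def)
    have "(F \<longlongrightarrow> 0) at_top"
    proof (rule Lim_null_comparison)
      show "\<forall>\<^sub>F x in at_top. norm (F x) \<le> exp (- Re a * x) / cmod a"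
        by (intro always_eventually) (auto simp: F_def norm_divide)
      show "((\<lambda>x. exp (- Re a * x) / cmod a) \<longlongrightarrow> 0) at_top"
        using a a0 by real_asymp
    qed
    then show "((F \<circ> real_of_ereal) \<longlongrightarrow> 0) (at_left \<infinity>)"
      by (simp add: ereal_tendsto_simps)
  qed auto
  then have "(LINT x:{0<..}|lborel. exp (- a * of_real x)) = 1 / a"
    by (simp add: interval_lebesgue_integral_def einterval_def greaterThan_def)
  moreover have "(LINT x:{0<..}|lborel. exp (- a * of_real x)) = (\<integral>x. ?f x \<partial>lborel)"
    unfolding set_lebesgue_integral_def
  proof (rule integral_cong_AE)
    have [measurable]: "(\<lambda>x::real. exp (- a * of_real x)) \<in> borel_measurable borel"
      by (intro borel_measurable_continuous_onI continuous_intros)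
    show "(\<lambda>x. indicator {0<..} x *\<^sub>R exp (- a * of_real x)) \<in> borel_measurable lborel" by measurable
    show "?f \<in> borel_measurable lborel" by measurable
    have "AE x in lborel. x \<noteq> (0::real)" by (rule AE_lborel_singleton)
    then show "AE x in lborel. indicator {0<..} x *\<^sub>R exp (- a * of_real x) = ?f x"
      by eventually_elim (auto simp: indicator_def)
  qed
  ultimately show "(\<integral>x. ?f x \<partial>lborel) = 1 / a" by simp
qed

text \<open>The double integral of exp (- (z + iy) x) over x \<ge> 0 and |y| \<le> h is computed in
  both orders. In this form the pole term continues past Re s = 1 once the factor \<open>Kh\<close>
  supplies decay.\<close>

lemma Ln_difference_laplace:
  fixes z :: complex
  assumes z: "Re z > 0" and h: "h > 0"
  shows "Ln (z + \<i> * of_real h) - Ln (z - \<i> * of_real h)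
     = 2 * \<i> * (\<integral>x. of_real (indicator {0..} x * wsinc h x) * exp (- z * of_real x) \<partial>lborel)"
proof -
  let ?f = "\<lambda>y x. of_real (indicator {-h..h} y) * (of_real (indicator {0..} x) * exp (- (z + \<i> * of_real y) * of_real x))"
  have Re: "Re (z + \<i> * of_real y) > 0" for y using z by simp
  have fm: "(\<lambda>(y, x). ?f y x) \<in> borel_measurable (lborel \<Otimes>\<^sub>M lborel)"
  proof -
    have "continuous_on UNIV (\<lambda>p::real\<times>real. exp (- (z + \<i> * of_real (fst p)) * of_real (snd p)))"
      by (intro continuous_intros)
    then have [measurable]: "(\<lambda>p::real\<times>real. exp (- (z + \<i> * of_real (fst p)) * of_real (snd p))) \<in> borel_measurable (borel \<Otimes>\<^sub>M borel)"
      by (simp add: borel_measurable_continuous_onI borel_prod)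
    show ?thesis unfolding case_prod_beta by measurable
  qed
  have nf: "norm (?f y x) = indicator {-h..h} y * (indicator {0..} x * exp (- Re z * x))" for y x
    by (simp add: norm_mult indicator_def)
  have ri: "integrable lborel (\<lambda>x. indicator {0..} x * exp (- Re z * x))"
  proof -
    have "integrable lborel (\<lambda>x. cmod (of_real (indicator {0..} x) * exp (- of_real (Re z) * of_real x)))"
      by (rule integrable_norm[OF laplace_exp(1)]) (use z in simp)
    then show ?thesis by (simp add: norm_mult indicator_def)
  qed
  have int: "integrable (lborel \<Otimes>\<^sub>M lborel) (\<lambda>(y, x). ?f y x)"
  proof (rule lborel_pair.Fubini_integrable[OF fm])
    have "(\<lambda>y. \<integral>x. norm (case (y, x) of (y, x) \<Rightarrow> ?f y x) \<partial>lborel)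
        = (\<lambda>y. indicator {-h..h} y * (\<integral>x. indicator {0..} x * exp (- Re z * x) \<partial>lborel))"
      unfolding case_prod_conv nf integral_mult_right_zero ..
    then show "integrable lborel (\<lambda>y. \<integral>x. norm (case (y, x) of (y, x) \<Rightarrow> ?f y x) \<partial>lborel)"
      by (simp add: emeasure_lborel_Icc_eq integrable_mult_left)
    show "AE y in lborel. integrable lborel (\<lambda>x. case (y, x) of (y, x) \<Rightarrow> ?f y x)"
      unfolding case_prod_conv by (intro AE_I2 integrable_mult_right laplace_exp(1)[OF Re])
  qed
  have inner1: "(\<integral>x. ?f y x \<partial>lborel) = indicator {-h..h} y *\<^sub>R (1 / (z + \<i> * of_real y))" for y
    unfolding integral_mult_right_zero laplace_exp(2)[OF Re] by (simp add: scaleR_conv_of_real)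
  have "(\<integral>y. indicator {-h..h} y *\<^sub>R (1 / (z + \<i> * of_real y)) \<partial>lborel)
      = - \<i> * Ln (z + \<i> * of_real h) - (- \<i> * Ln (z + \<i> * of_real (- h)))"
  proof (rule integral_FTC_atLeastAtMost[of "- h" h "\<lambda>y. - \<i> * Ln (z + \<i> * of_real y)"])
    fix y :: real
    have np: "z + \<i> * of_real y \<notin> \<real>\<^sub>\<le>\<^sub>0" using Re[of y] by (auto simp: complex_nonpos_Reals_iff)
    then have "((\<lambda>w. - \<i> * Ln (z + \<i> * w)) has_field_derivative (1 / (z + \<i> * of_real y))) (at (of_real y))"
      by (auto intro!: derivative_eq_intros simp: field_simps)
    from has_vector_derivative_real_field[OF this]
    show "((\<lambda>y. - \<i> * Ln (z + \<i> * of_real y)) has_vector_derivative 1 / (z + \<i> * of_real y)) (at y within {-h..h})"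
      by (auto simp: o_def intro: has_vector_derivative_at_within)
  next
    have "z + \<i> * of_real y \<noteq> 0" for y using Re[of y] by (metis less_irrefl zero_complex.sel(1))
    then show "continuous_on {-h..h} (\<lambda>y. 1 / (z + \<i> * of_real y))"
      by (intro continuous_intros) auto
  qed (use h in auto)
  then have L: "(\<integral>y. (\<integral>x. ?f y x \<partial>lborel) \<partial>lborel) = - \<i> * (Ln (z + \<i> * of_real h) - Ln (z - \<i> * of_real h))"
    unfolding inner1 by (simp add: algebra_simps)
  have inner2: "(\<integral>y. ?f y x \<partial>lborel) = 2 * (of_real (indicator {0..} x * wsinc h x) * exp (- z * of_real x))" for x
  proof -
    have "(\<integral>y. indicator {-h..h} y *\<^sub>R exp (- \<i> * of_real x * of_real y) \<partial>lborel) = 2 * of_real (wsinc h x)"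
    proof (cases "x = 0")
      case True
      then show ?thesis using h by (simp add: wsinc_def scaleR_conv_of_real)
    next
      case False
      have "(\<integral>y. indicator {-h..h} y *\<^sub>R exp (- \<i> * of_real x * of_real y) \<partial>lborel)
         = exp (- \<i> * of_real x * of_real h) / (- \<i> * of_real x) - exp (- \<i> * of_real x * of_real (- h)) / (- \<i> * of_real x)"
      proof (rule integral_FTC_atLeastAtMost[of "- h" h "\<lambda>y. exp (- \<i> * of_real x * of_real y) / (- \<i> * of_real x)"])
        fix y :: real
        have "((\<lambda>w. exp (- \<i> * of_real x * w) / (- \<i> * of_real x)) has_field_derivative exp (- \<i> * of_real x * of_real y)) (at (of_real y))"
          using False by (auto intro!: derivative_eq_intros)
        from has_vector_derivative_real_field[OF this]
        show "((\<lambda>y. exp (- \<i> * of_real x * of_real y) / (- \<i> * of_real x)) has_vector_derivative exp (- \<i> * of_real x * of_real y)) (at y within {-h..h})"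
          by (auto simp: o_def intro: has_vector_derivative_at_within)
      qed (use h in \<open>auto intro!: continuous_intros\<close>)
      also have "exp (- \<i> * of_real x * of_real h) = cis (- (x * h))"
        by (simp add: cis_conv_exp mult.assoc)
      also have "exp (- \<i> * of_real x * of_real (- h)) = cis (x * h)"
        by (simp add: cis_conv_exp mult.assoc)
      also have "cis (- (x * h)) / (- \<i> * of_real x) - cis (x * h) / (- \<i> * of_real x) = (cis (- (x * h)) - cis (x * h)) / (- \<i> * of_real x)"
        by (simp add: diff_divide_distrib)
      also have "cis (- (x * h)) - cis (x * h) = - 2 * \<i> * of_real (sin (h * x))"
        by (auto simp: complex_eq_iff mult.commute)
      also have "- 2 * \<i> * of_real (sin (h * x)) / (- \<i> * of_real x) = 2 * of_real (sin (h * x) / x)"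
        using False by (simp add: field_simps)
      also have "sin (h * x) / x = wsinc h x" using mult_wsinc[of x h] False by (simp add: field_simps)
      finally show ?thesis .
    qed
    moreover have "(\<integral>y. ?f y x \<partial>lborel)
        = (\<integral>y. (indicator {-h..h} y *\<^sub>R exp (- \<i> * of_real x * of_real y)) * (of_real (indicator {0..} x) * exp (- z * of_real x)) \<partial>lborel)"
    proof -
      have "exp (- (z + \<i> * of_real y) * of_real x) = exp (- \<i> * of_real x * of_real y) * exp (- z * of_real x)" for y
        unfolding exp_add[symmetric] by (simp add: algebra_simps)
      then show ?thesis by (simp add: scaleR_conv_of_real mult_ac)
    qed
    ultimately show ?thesis unfolding integral_mult_left_zero by simp
  qed
  have "(\<integral>x. (\<integral>y. ?f y x \<partial>lborel) \<partial>lborel) = (\<integral>y. (\<integral>x. ?f y x \<partial>lborel) \<partial>lborel)"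
    by (rule lborel_pair.Fubini_integral[OF int])
  then have "2 * (\<integral>x. of_real (indicator {0..} x * wsinc h x) * exp (- z * of_real x) \<partial>lborel)
      = - \<i> * (Ln (z + \<i> * of_real h) - Ln (z - \<i> * of_real h))"
    unfolding inner2 L by (simp only: integral_mult_right_zero)
  then have "\<i> * (2 * (\<integral>x. of_real (indicator {0..} x * wsinc h x) * exp (- z * of_real x) \<partial>lborel))
      = \<i> * (- \<i> * (Ln (z + \<i> * of_real h) - Ln (z - \<i> * of_real h)))" by simp
  then show ?thesis by (simp add: mult_ac)
qed

text \<open>Cauchy condensation reduces it to the sum of 1 / (1 + (n log 2)^2).\<close>

lemma summable_inverse_n_ln_square: "summable (\<lambda>n. 1 / (real (Suc n) * (1 + (ln (real (Suc n)))\<^sup>2)))"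
proof -
  let ?f = "\<lambda>n::nat. 1 / (real n * (1 + (ln (real n))\<^sup>2))"
  have "summable ?f \<longleftrightarrow> summable (\<lambda>n. 2 ^ n * ?f (2 ^ n))"
  proof (rule condensation_test)
    fix m :: nat assume m: "0 < m"
    have "ln (real m) \<le> ln (real (Suc m))" "0 \<le> ln (real m)" using m by auto
    then have "(ln (real m))\<^sup>2 \<le> (ln (real (Suc m)))\<^sup>2" by (intro power_mono) auto
    then have "real m * (1 + (ln (real m))\<^sup>2) \<le> real (Suc m) * (1 + (ln (real (Suc m)))\<^sup>2)"
      by (intro mult_mono) auto
    then show "?f (Suc m) \<le> ?f m" using m by (intro divide_left_mono mult_pos_pos) (auto simp: add_pos_nonneg)
  qed auto
  moreover have "summable (\<lambda>n. 2 ^ n * ?f (2 ^ n))"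
  proof (rule summable_comparison_test'[where N = 1])
    show "summable (\<lambda>n. (1 / (ln 2)\<^sup>2) * (1 / real n ^ 2))"
      by (intro summable_mult) (simp add: inverse_power_summable flip: inverse_eq_divide)
    fix n :: nat assume n: "n \<ge> 1"
    have l: "ln (real (2 ^ n)) = real n * ln 2" by (simp add: ln_realpow)
    have "norm (2 ^ n * ?f (2 ^ n)) = 1 / (1 + (real n * ln 2)\<^sup>2)" unfolding l by simp
    also have "\<dots> \<le> 1 / (real n * ln 2)\<^sup>2"
      using n by (intro divide_left_mono) (auto simp: add_pos_nonneg)
    finally show "norm (2 ^ n * ?f (2 ^ n)) \<le> (1 / (ln 2)\<^sup>2) * (1 / real n ^ 2)"
      by (simp add: power_mult_distrib mult.commute)
  qed
  ultimately have "summable ?f" by blast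
  then show ?thesis by (subst summable_Suc_iff)
qed

section \<open>The smoothed increments\<close>

lemma ln_add_le: "a \<ge> 1 \<Longrightarrow> b \<ge> 0 \<Longrightarrow> ln (a + b) \<le> ln a + (b::real)"
proof -
  assume a: "a \<ge> 1" and b: "b \<ge> 0"
  have "a + b \<le> a * (1 + b)" using mult_right_mono[of 1 a b] a b by (simp add: algebra_simps)
  also have "\<dots> \<le> a * exp b" using a exp_ge_add_one_self[of b] by (intro mult_left_mono) auto
  finally have "ln (a + b) \<le> ln (a * exp b)" using a b by (subst ln_le_cancel_iff) auto
  also have "\<dots> = ln a + b" using a by (simp add: ln_mult)
  finally show ?thesis .
qed

text \<open>The weight 1 + |u| pays for the logarithmic growth of log zeta under translation by
  u.\<close>

lemma double_exp_moment_integrable: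
  assumes c: "c > 0"
  shows "integrable lborel (\<lambda>u. exp (- c * exp (pi * \<bar>u\<bar>)) * (1 + \<bar>u\<bar>))"
proof (rule integrable_quadratic_decay[of _ "512 / c ^ 4"])
  show "(\<lambda>u. exp (- c * exp (pi * \<bar>u\<bar>)) * (1 + \<bar>u\<bar>)) \<in> borel_measurable borel"
    by (intro borel_measurable_continuous_onI continuous_intros)
  fix u :: real
  define v where "v = \<bar>u\<bar>"
  have v: "v \<ge> 0" by (simp add: v_def)
  define q where "q = exp (pi * v)"
  have "exp (- c * q) \<le> 256 / (c * q) ^ 4" using exp_neg_le_power4[of "c * q"] c by (simp add: q_def)
  also have "\<dots> = 256 / c ^ 4 / q ^ 4" by (simp add: power_mult_distrib)
  finally have 1: "exp (- c * q) \<le> 256 / c ^ 4 / q ^ 4" .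
  have 2: "1 + v \<le> exp v" by (rule exp_ge_add_one_self)
  have 3: "1 + v\<^sup>2 \<le> 2 * exp v" using exp_lower_Taylor_quadratic[OF v] v by linarith
  have 4: "exp v \<le> q" unfolding q_def using v pi_ge_two mult_right_mono[of 1 pi v] by simp
  have q1: "q \<ge> 1" using v by (simp add: q_def)
  have "(1 + v) * (1 + v\<^sup>2) \<le> q * (2 * q)" 
  proof (rule mult_mono)
    show "1 + v \<le> q" "1 + v\<^sup>2 \<le> 2 * q" "0 \<le> q" using 2 3 4 q1 by linarith+
  qed simp
  also have "\<dots> \<le> 2 * q ^ 4"
    using q1 power_increasing[of 2 4 q] by (simp add: power2_eq_square)
  finally have 5: "(1 + v) * (1 + v\<^sup>2) \<le> 2 * q ^ 4" .
  have "exp (- c * q) * (1 + v) * (1 + v\<^sup>2) \<le> (256 / c ^ 4 / q ^ 4) * (2 * q ^ 4)"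
    unfolding mult.assoc by (rule mult_mono[OF 1 5]) (use v c q1 in auto)
  also have "\<dots> = 512 / c ^ 4" using q1 by simp
  finally have "exp (- c * q) * (1 + v) \<le> 512 / c ^ 4 / (1 + v\<^sup>2)"
    by (subst pos_le_divide_eq) (simp_all add: add_pos_nonneg)
  then show "norm (exp (- c * exp (pi * \<bar>u\<bar>)) * (1 + \<bar>u\<bar>)) \<le> 512 / c ^ 4 / (1 + u\<^sup>2)"
    by (simp add: q_def v_def abs_mult)
qed

lemma cis_measurable [measurable]: "(\<lambda>u::real. cis (- (x * u))) \<in> borel_measurable borel"
  unfolding cis_conv_exp by (intro borel_measurable_continuous_onI continuous_intros)

context kernel
begin

lemma C_pos: "C > 0"
  using Kh_decay[of 0] Kh_0 by simp

lemma Kh_measurable [measurable]: "Kh \<in> borel_measurable borel"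
  by (intro borel_measurable_continuous_onI Kh_continuous)

lemma integral_K: "(\<integral>u. K u \<partial>lborel) = Kh 0"
proof -
  have "complex_of_real (\<integral>u. K u \<partial>lborel) = of_real (Kh 0)"
    using Kh[of 0] by simp
  then show ?thesis by (simp only: of_real_eq_iff)
qed

lemma K_moment_integrable: "integrable lborel (\<lambda>u. K u * (1 + \<bar>u\<bar>))"
proof (rule Bochner_Integration.integrable_bound[OF integrable_mult_right[OF double_exp_moment_integrable[OF c_pos], of B]])
  have "K u * (1 + \<bar>u\<bar>) \<le> B * exp (- c * exp (pi * \<bar>u\<bar>)) * (1 + \<bar>u\<bar>)" for u
    by (intro mult_right_mono K_decay) auto
  then show "AE u in lborel. norm (K u * (1 + \<bar>u\<bar>)) \<le> norm (B * (exp (- c * exp (pi * \<bar>u\<bar>)) * (1 + \<bar>u\<bar>)))"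
    using K_nonneg B_nonneg by (intro AE_I2) (simp add: abs_mult mult.assoc)
qed auto

lemma K_cis_integrable: "integrable lborel (\<lambda>u. of_real (K u) * cis (- (x * u)))"
  using K_nonneg by (intro Bochner_Integration.integrable_bound[OF K_integrable]) (auto simp: norm_mult)

text \<open>Half of the exponent comes from \<open>Kh\<close> and half from \<sigma> \<ge> 1/2; at x
  = log n the product exp (- x) is 1 / n.\<close>

lemma Kh_exp_bound:
  assumes "x \<ge> 0" "\<sigma> \<ge> 1/2"
  shows "Kh x * exp (- \<sigma> * x) \<le> C * exp (- x) / (1 + x\<^sup>2)"
proof -
  have "exp (- \<sigma> * x) \<le> exp (- (1/2) * x)" using assms mult_right_mono[of "1/2" \<sigma> x] by simp
  then have "Kh x * exp (- \<sigma> * x) \<le> (C * exp (- x / 2) / (1 + x\<^sup>2)) * exp (- (1/2) * x)"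
    using Kh_decay[OF assms(1)] Kh_nonneg C_pos by (intro mult_mono) auto
  also have "\<dots> = C * (exp (- x / 2) * exp (- (1/2) * x)) / (1 + x\<^sup>2)" by simp
  also have "exp (- x / 2) * exp (- (1/2) * x) = exp (- x)" unfolding exp_add[symmetric] by simp
  finally show ?thesis .
qed

end

locale smoothed = kernel K Kh B c C + log_zreg g for K Kh B c C g +
  fixes h :: real
  assumes h_pos: "h > 0"
begin

abbreviation lam :: "nat \<Rightarrow> real" where "lam n \<equiv> ln (real (Suc n))"

text \<open>The sine comes from n^(-ih) - n^(ih) = - 2i sin (h log n), and \<open>Kh\<close> from
  integrating n^(-iu) against K. The index n stands for the integer n + 1.\<close>

definition bcoef :: "nat \<Rightarrow> real" where
  "bcoef n = lcoef (Suc n) * sin (h * lam n) * Kh (lam n)"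

definition Dser :: "complex \<Rightarrow> complex" where
  "Dser s = (\<Sum>n. of_real (bcoef n) * exp (- s * of_real (lam n)))"

text \<open>The counterpart of \<open>bcoef\<close> for the pole: a density in x \<ge> 0 whose
  Laplace transform at s - 1 is, up to the factor 2i, the smoothed difference of Ln (s - 1).\<close>

definition pker :: "real \<Rightarrow> real" where
  "pker x = indicator {0..} x * wsinc h x * Kh x"

definition Pint :: "complex \<Rightarrow> complex" where
  "Pint s = (\<integral>x. of_real (pker x) * exp (- (s - 1) * of_real x) \<partial>lborel)"

definition Fint :: "complex \<Rightarrow> complex" where
  "Fint s = (\<integral>u. of_real (K u) * (g (s + \<i> * of_real (u + h)) - g (s + \<i> * of_real (u - h))) \<partial>lborel)"

lemma abs_bcoef_le: "\<bar>bcoef n\<bar> \<le> Kh (lam n)"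
proof -
  have "\<bar>bcoef n\<bar> = lcoef (Suc n) * \<bar>sin (h * lam n)\<bar> * Kh (lam n)"
    using lcoef_nonneg Kh_nonneg by (simp add: bcoef_def abs_mult)
  also have "\<dots> \<le> 1 * 1 * Kh (lam n)"
    using lcoef_nonneg lcoef_le_1 Kh_nonneg by (intro mult_mono) auto
  finally show ?thesis by simp
qed

lemma bcoef_bound:
  assumes "\<sigma> \<ge> 1/2"
  shows "\<bar>bcoef n\<bar> * exp (- \<sigma> * lam n) \<le> C * (1 / (real (Suc n) * (1 + (lam n)\<^sup>2)))"
proof -
  have "\<bar>bcoef n\<bar> * exp (- \<sigma> * lam n) \<le> Kh (lam n) * exp (- \<sigma> * lam n)"
    by (intro mult_right_mono abs_bcoef_le) auto
  also have "\<dots> \<le> C * exp (- lam n) / (1 + (lam n)\<^sup>2)"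
    using assms by (intro Kh_exp_bound) auto
  also have "exp (- lam n) = 1 / real (Suc n)" by (simp add: exp_minus inverse_eq_divide del: of_nat_Suc)
  finally show ?thesis by (simp add: field_simps del: of_nat_Suc)
qed

lemma summable_bound: "summable (\<lambda>n. C * (1 / (real (Suc n) * (1 + (lam n)\<^sup>2))))"
  by (intro summable_mult summable_inverse_n_ln_square)

lemma norm_Dser_term:
  assumes "Re s \<ge> 1/2"
  shows "cmod (of_real (bcoef n) * exp (- s * of_real (lam n))) \<le> C * (1 / (real (Suc n) * (1 + (lam n)\<^sup>2)))"
  using bcoef_bound[OF assms, of n] by (simp add: norm_mult del: of_nat_Suc)

lemma Dser_holomorphic: "Dser holomorphic_on {s. Re s > 1/2}"
  unfolding Dser_def[abs_def]
proof (rule suminf_holomorphic(1)[OF open_half])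
  show "(\<lambda>s. of_real (bcoef n) * exp (- s * of_real (lam n))) holomorphic_on {s. Re s > 1/2}" for n
    by (intro holomorphic_intros)
  fix s :: complex
  show "\<exists>d f. 0 < d \<and> summable f \<and> (\<forall>n. \<forall>y\<in>ball s d \<inter> {s. Re s > 1/2}.
      cmod (of_real (bcoef n) * exp (- y * of_real (lam n))) \<le> f n)"
    using summable_bound norm_Dser_term
    by (intro exI[of _ 1] exI[of _ "\<lambda>n. C * (1 / (real (Suc n) * (1 + (lam n)\<^sup>2)))"]) (auto simp del: of_nat_Suc)
qed

lemma Dser_sums:
  assumes "Re s \<ge> 1/2"
  shows "(\<lambda>n. of_real (bcoef n) * exp (- s * of_real (lam n))) sums Dser s"
  unfolding Dser_def using norm_Dser_term[OF assms]
  by (intro summable_sums summable_comparison_test'[OF summable_bound, of 0]) auto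

lemma pker_measurable [measurable]: "pker \<in> borel_measurable borel"
  unfolding pker_def[abs_def] by measurable

lemma norm_pker_bound:
  assumes "\<sigma> \<ge> 1/2"
  shows "\<bar>pker x\<bar> * exp ((1 - \<sigma>) * x) \<le> (h * C) / (1 + x\<^sup>2)"
proof (cases "x \<ge> 0")
  case True
  have "\<bar>pker x\<bar> * exp ((1 - \<sigma>) * x) = \<bar>wsinc h x\<bar> * (Kh x * exp (- \<sigma> * x)) * exp x"
    using True Kh_nonneg by (simp add: pker_def abs_mult left_diff_distrib exp_diff exp_minus field_simps)
  also have "\<dots> \<le> h * (C * exp (- x) / (1 + x\<^sup>2)) * exp x"
    using Kh_exp_bound[OF True assms] abs_wsinc_le[OF h_pos] h_pos Kh_nonneg
    by (intro mult_right_mono mult_mono) auto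
  also have "\<dots> = h * C * (exp (- x) * exp x) / (1 + x\<^sup>2)" by simp
  also have "exp (- x) * exp x = 1" by (simp flip: exp_add)
  finally show ?thesis by simp
next
  case False
  then show ?thesis using h_pos C_pos by (simp add: pker_def)
qed

lemma norm_Pint_integrand:
  assumes "Re s \<ge> 1/2"
  shows "cmod (of_real (pker x) * exp (- (s - 1) * of_real x)) \<le> (h * C) / (1 + x\<^sup>2)"
proof -
  have "cmod (of_real (pker x) * exp (- (s - 1) * of_real x)) = \<bar>pker x\<bar> * exp ((1 - Re s) * x)"
    by (simp add: norm_mult)
  then show ?thesis using norm_pker_bound[OF assms, of x] by simp
qed

lemma Pint_integrand_measurable: "(\<lambda>x. of_real (pker x) * exp (- (s - 1 :: complex) * of_real x)) \<in> borel_measurable borel"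
proof -
  have [measurable]: "(\<lambda>x::real. exp (- (s - 1) * of_real x)) \<in> borel_measurable borel"
    by (intro borel_measurable_continuous_onI continuous_intros)
  show ?thesis by measurable
qed

lemma Pint_holomorphic: "Pint holomorphic_on {s. Re s > 1/2}"
  unfolding Pint_def[abs_def]
proof (rule holomorphic_integral[OF open_half])
  show "(\<lambda>s. of_real (pker x) * exp (- (s - 1) * of_real x)) holomorphic_on {s. Re s > 1/2}" for x
    by (intro holomorphic_intros)
  show "(\<lambda>x. of_real (pker x) * exp (- (s - 1) * of_real x)) \<in> borel_measurable lborel" for s :: complex
    using Pint_integrand_measurable[of s] by simp
  fix s :: complex assume "s \<in> {s. Re s > 1/2}"
  then obtain r where r: "r > 0" "cball s r \<subseteq> {s. Re s > 1/2}"
    using open_half[of "1/2"] unfolding open_contains_cball by blast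
  have "integrable lborel (\<lambda>x::real. (h * C) / (1 + x\<^sup>2))"
    by (rule integrable_quadratic_decay[of _ "h * C"]) (use h_pos C_pos in auto)
  moreover have "\<forall>w\<in>cball s r. \<forall>x\<in>space lborel. cmod (of_real (pker x) * exp (- (w - 1) * of_real x)) \<le> (h * C) / (1 + x\<^sup>2)"
  proof (intro ballI norm_Pint_integrand)
    fix w assume "w \<in> cball s r"
    then have "w \<in> {s. Re s > 1/2}" using r by blast
    then show "Re w \<ge> 1/2" by simp
  qed
  ultimately show "\<exists>r>0. \<exists>f. cball s r \<subseteq> {s. Re s > 1/2} \<and> integrable lborel f \<and>
      (\<forall>w\<in>cball s r. \<forall>x\<in>space lborel. cmod (of_real (pker x) * exp (- (w - 1) * of_real x)) \<le> f x)"
    using r by blast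
qed

lemma Fint_integrand_measurable:
  assumes "Re s > 1/2"
  shows "(\<lambda>u. of_real (K u) * (g (s + \<i> * of_real (u + h)) - g (s + \<i> * of_real (u - h)))) \<in> borel_measurable borel"
proof -
  have "continuous_on UNIV (\<lambda>u. g (s + \<i> * of_real (u + a)))" for a
    by (rule continuous_on_compose2[OF holomorphic_on_imp_continuous_on[OF g_holomorphic]])
       (use assms in \<open>auto intro!: continuous_intros\<close>)
  then have m: "(\<lambda>u. g (s + \<i> * of_real (u + a))) \<in> borel_measurable borel" for a
    by (rule borel_measurable_continuous_onI)
  have [measurable]: "(\<lambda>u. g (s + \<i> * of_real (u + h))) \<in> borel_measurable borel"
      "(\<lambda>u. g (s + \<i> * of_real (u - h))) \<in> borel_measurable borel"
    using m[of h] m[of "- h"] by auto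
  show ?thesis by measurable
qed

lemma Fint_dominated:
  assumes s: "1/2 < Re s" "Re s < 7/4"
  shows "\<exists>r>0. \<exists>f. cball s r \<subseteq> {s. 1/2 < Re s} \<inter> {s. Re s < 7/4} \<and> integrable lborel f \<and>
    (\<forall>w\<in>cball s r. \<forall>u\<in>space lborel. cmod (of_real (K u) * (g (w + \<i> * of_real (u + h)) - g (w + \<i> * of_real (u - h)))) \<le> f u)"
proof -
  \<comment> \<open>Discs of this radius stay at distance at least r from the critical line, where
    \<open>g_growth\<close> applies; the bound 7/4 keeps Re w below 2.\<close>
  define r where "r = min (Re s - 1/2) (7/4 - Re s) / 2"
  have r: "r > 0" using s by (simp add: r_def)
  obtain D where D: "D > 0" "\<And>\<sigma> t. 1/2 + r \<le> \<sigma> \<Longrightarrow> \<sigma> \<le> 2 \<Longrightarrow> cmod (g (Complex \<sigma> t)) \<le> D * ln (\<bar>t\<bar> + 3)"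
    using g_growth[OF r] by blast
  define l where "l = ln (\<bar>Im s\<bar> + r + h + 3)"
  have l: "l \<ge> 1" using ln_abs_plus_3[of "\<bar>Im s\<bar> + r + h"] r h_pos by (simp add: l_def add_ac)
  define f where "f = (\<lambda>u. (2 * D * l) * (K u * (1 + \<bar>u\<bar>)))"
  have Rew: "Re s - r \<le> Re w \<and> Re w \<le> Re s + r \<and> \<bar>Im w\<bar> \<le> \<bar>Im s\<bar> + r" if "w \<in> cball s r" for w
  proof -
    have "cmod (s - w) \<le> r" using that by (simp add: dist_norm)
    then show ?thesis using abs_Re_le_cmod[of "s - w"] abs_Im_le_cmod[of "s - w"] by auto
  qed
  have Re2: "1/2 + r \<le> Re s - r" "Re s + r < 7/4" using s by (auto simp: r_def min_def field_simps)
  have gb: "cmod (g (w + \<i> * of_real (u + a))) \<le> D * l * (1 + \<bar>u\<bar>)" if w: "w \<in> cball s r" and a: "\<bar>a\<bar> \<le> h" for w u a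
  proof -
    have "w + \<i> * of_real (u + a) = Complex (Re w) (Im w + u + a)" by (simp add: complex_eq_iff)
    then have "cmod (g (w + \<i> * of_real (u + a))) \<le> D * ln (\<bar>Im w + u + a\<bar> + 3)"
      using D(2)[of "Re w" "Im w + u + a"] Rew[OF w] Re2 by simp
    also have "\<dots> \<le> D * (l * (1 + \<bar>u\<bar>))"
    proof -
      have "ln (\<bar>Im w + u + a\<bar> + 3) \<le> ln ((\<bar>Im s\<bar> + r + h + 3) + \<bar>u\<bar>)"
        using Rew[OF w] a by (subst ln_le_cancel_iff) auto
      also have "\<dots> \<le> l + \<bar>u\<bar>" unfolding l_def using r h_pos by (intro ln_add_le) auto
      also have "\<dots> \<le> l * (1 + \<bar>u\<bar>)" using mult_right_mono[OF l, of "\<bar>u\<bar>"] by (simp add: distrib_left)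
      finally show ?thesis using D(1) by (intro mult_left_mono) auto
    qed
    finally show ?thesis by simp
  qed
  have "cmod (of_real (K u) * (g (w + \<i> * of_real (u + h)) - g (w + \<i> * of_real (u - h)))) \<le> f u"
    if w: "w \<in> cball s r" for w u
  proof -
    have "cmod (g (w + \<i> * of_real (u + h)) - g (w + \<i> * of_real (u - h))) \<le> 2 * (D * l * (1 + \<bar>u\<bar>))"
      using gb[OF w, of h u] gb[OF w, of "- h" u] h_pos
        norm_triangle_ineq4[of "g (w + \<i> * of_real (u + h))" "g (w + \<i> * of_real (u - h))"] by simp
    then have "K u * cmod (g (w + \<i> * of_real (u + h)) - g (w + \<i> * of_real (u - h))) \<le> K u * (2 * (D * l * (1 + \<bar>u\<bar>)))"
      using K_nonneg by (intro mult_left_mono) auto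
    then show ?thesis unfolding f_def norm_mult norm_of_real using K_nonneg by (simp add: mult_ac)
  qed
  moreover have "integrable lborel f" unfolding f_def by (intro integrable_mult_right K_moment_integrable)
  moreover have "cball s r \<subseteq> {s. 1/2 < Re s} \<inter> {s. Re s < 7/4}" using Rew Re2 r by fastforce
  ultimately show ?thesis using r by blast
qed

lemma Fint_holomorphic: "Fint holomorphic_on ({s. 1/2 < Re s} \<inter> {s. Re s < 7/4})"
  unfolding Fint_def[abs_def]
proof (rule holomorphic_integral)
  show "open ({s. 1/2 < Re s} \<inter> {s. Re s < 7/4})"
    by (intro open_Int open_halfspace_Re_gt open_halfspace_Re_lt)
  fix u :: real
  have "(g \<circ> (\<lambda>s. s + \<i> * of_real (u + a))) holomorphic_on ({s. 1/2 < Re s} \<inter> {s. Re s < 7/4})" for a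
    by (rule holomorphic_on_compose_gen[OF _ g_holomorphic]) (auto intro!: holomorphic_intros)
  from this[of h] this[of "- h"]
  show "(\<lambda>s. of_real (K u) * (g (s + \<i> * of_real (u + h)) - g (s + \<i> * of_real (u - h)))) holomorphic_on ({s. 1/2 < Re s} \<inter> {s. Re s < 7/4})"
    by (intro holomorphic_intros) (auto simp: o_def)
next
  fix s assume s: "s \<in> {s. 1/2 < Re s} \<inter> {s. Re s < 7/4}"
  show "(\<lambda>u. of_real (K u) * (g (s + \<i> * of_real (u + h)) - g (s + \<i> * of_real (u - h)))) \<in> borel_measurable lborel"
    using Fint_integrand_measurable[of s] s by simp
  show "\<exists>r>0. \<exists>f. cball s r \<subseteq> {s. 1/2 < Re s} \<inter> {s. Re s < 7/4} \<and> integrable lborel f \<and>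
    (\<forall>w\<in>cball s r. \<forall>u\<in>space lborel. cmod (of_real (K u) * (g (w + \<i> * of_real (u + h)) - g (w + \<i> * of_real (u - h)))) \<le> f u)"
    using Fint_dominated[of s] s by simp
qed

lemma Fint_integrable:
  assumes s: "1/2 < Re s" "Re s < 7/4"
  shows "integrable lborel (\<lambda>u. of_real (K u) * (g (s + \<i> * of_real (u + h)) - g (s + \<i> * of_real (u - h))))"
proof -
  obtain r f where r: "r > 0" "integrable lborel f"
    "\<forall>w\<in>cball s r. \<forall>u\<in>space lborel. cmod (of_real (K u) * (g (w + \<i> * of_real (u + h)) - g (w + \<i> * of_real (u - h)))) \<le> f u"
    using Fint_dominated[OF s] by blast
  then have le: "cmod (of_real (K u) * (g (s + \<i> * of_real (u + h)) - g (s + \<i> * of_real (u - h)))) \<le> f u" for u by simp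
  show ?thesis
    by (rule Bochner_Integration.integrable_bound[OF r(2)])
       (use le Fint_integrand_measurable[OF s(1)] in \<open>auto intro!: AE_I2 order_trans[OF _ abs_ge_self]\<close>)
qed

section \<open>The formula for the smoothed increments\<close>

lemma dirichlet_part:
  assumes s: "Re s > 1"
  defines "q \<equiv> \<lambda>u. of_real (K u) * (log_dseries (s + \<i> * of_real (u + h)) - log_dseries (s + \<i> * of_real (u - h)))"
  shows "integrable lborel q" and "(\<integral>u. q u \<partial>lborel) = - 2 * \<i> * Dser s"
proof -
  \<comment> \<open>k n is what remains of a term after the dependence on u, namely K u times cis (-
    (lam n * u)), is split off; integrating that factor gives Kh (lam n).\<close>
  define k where "k = (\<lambda>n. - 2 * \<i> * of_real (lcoef (Suc n) * sin (h * lam n)) * exp (- s * of_real (lam n)))"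
  define f where "f = (\<lambda>n u. of_real (K u) * cis (- (lam n * u)) * k n)"
  have term_eq: "of_real (K u) * (of_real (lcoef (Suc n)) * of_nat (Suc n) powr (- (s + \<i> * of_real (u + h)))
       - of_real (lcoef (Suc n)) * of_nat (Suc n) powr (- (s + \<i> * of_real (u - h)))) = f n u" for n u
  proof -
    have e: "of_nat (Suc n) powr (- (s + \<i> * of_real (u + a))) = exp (- s * of_real (lam n)) * cis (- (lam n * u)) * cis (- (lam n * a))" for a
      unfolding nat_powr_exp cis_conv_exp exp_add[symmetric] by (simp add: algebra_simps del: of_nat_Suc)
    have e': "of_nat (Suc n) powr (- (s + \<i> * of_real (u - h))) = exp (- s * of_real (lam n)) * cis (- (lam n * u)) * cis (lam n * h)"
      using e[of "- h"] by simp
    have "cis (- (lam n * h)) - cis (lam n * h) = - 2 * \<i> * of_real (sin (h * lam n))"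
      by (simp add: complex_eq_iff mult.commute)
    then have c: "cis (- (lam n * h)) = cis (lam n * h) - 2 * \<i> * of_real (sin (h * lam n))"
      by (simp add: algebra_simps)
    show ?thesis unfolding e[of h] e' f_def k_def c of_real_mult by (simp add: algebra_simps del: of_nat_Suc)
  qed
  have q_sums: "(\<lambda>n. f n u) sums q u" for u
  proof -
    have "(\<lambda>n. of_real (K u) * (of_real (lcoef (Suc n)) * of_nat (Suc n) powr (- (s + \<i> * of_real (u + h)))
       - of_real (lcoef (Suc n)) * of_nat (Suc n) powr (- (s + \<i> * of_real (u - h))))) sums q u"
      unfolding q_def by (intro sums_mult sums_diff log_dseries_sums) (use s in auto)
    then show ?thesis unfolding term_eq .
  qed
  have q_eq: "q = (\<lambda>u. \<Sum>n. f n u)" by (intro ext sums_unique[OF q_sums])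
  have nk: "cmod (k n) \<le> 2 * cmod (of_real (lcoef (Suc n)) * of_nat (Suc n) powr (- s))" for n
  proof -
    have "cmod (k n) = 2 * (lcoef (Suc n) * \<bar>sin (h * lam n)\<bar> * cmod (exp (- s * of_real (lam n))))"
      unfolding k_def using lcoef_nonneg[of "Suc n"] by (simp add: norm_mult abs_mult del: of_nat_Suc)
    also have "\<dots> \<le> 2 * (lcoef (Suc n) * 1 * cmod (exp (- s * of_real (lam n))))"
      using lcoef_nonneg[of "Suc n"] by (intro mult_left_mono mult_right_mono) auto
    finally show ?thesis unfolding nat_powr_exp norm_mult using lcoef_nonneg[of "Suc n"] by simp
  qed
  have sk: "summable (\<lambda>n. cmod (k n))"
    by (rule summable_comparison_test'[OF summable_mult[OF summable_norm_log_dseries[OF s]], of 0 _ 2])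
       (use nk in simp)
  have fi: "integrable lborel (f n)" for n
    unfolding f_def by (intro integrable_mult_left K_cis_integrable)
  have nf: "cmod (f n u) = K u * cmod (k n)" for n u
    using K_nonneg[of u] by (simp add: f_def norm_mult)
  have s1: "AE u in lborel. summable (\<lambda>n. norm (f n u))"
    unfolding nf by (intro AE_I2 summable_mult sk)
  have s2: "summable (\<lambda>n. \<integral>u. norm (f n u) \<partial>lborel)"
    unfolding nf integral_mult_left_zero by (intro summable_mult sk)
  show "integrable lborel q" unfolding q_eq by (rule integrable_suminf[OF fi s1 s2])
  have "(\<lambda>n. \<integral>u. f n u \<partial>lborel) sums (\<integral>u. q u \<partial>lborel)"
    unfolding q_eq by (rule sums_integral[OF fi s1 s2])
  moreover have "(\<integral>u. f n u \<partial>lborel) = - 2 * \<i> * (of_real (bcoef n) * exp (- s * of_real (lam n)))" for n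
    unfolding f_def integral_mult_left_zero Kh k_def bcoef_def by (simp add: mult_ac del: of_nat_Suc)
  moreover have "(\<lambda>n. - 2 * \<i> * (of_real (bcoef n) * exp (- s * of_real (lam n)))) sums (- 2 * \<i> * Dser s)"
    by (intro sums_mult Dser_sums) (use s in simp)
  ultimately show "(\<integral>u. q u \<partial>lborel) = - 2 * \<i> * Dser s"
    by (simp only: sums_unique2)
qed

text \<open>After \<open>Ln_difference_laplace\<close> the integral over u becomes the Fourier
  transform of K at x, which produces the factor Kh x in \<open>pker\<close>.\<close>

lemma pole_part:
  assumes s: "Re s > 1"
  defines "q \<equiv> \<lambda>u. of_real (K u) * (Ln (s + \<i> * of_real (u + h) - 1) - Ln (s + \<i> * of_real (u - h) - 1))"
  shows "integrable lborel q" and "(\<integral>u. q u \<partial>lborel) = 2 * \<i> * Pint s"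
proof -
  let ?E = "\<lambda>u x. exp (- (s - 1 + \<i> * of_real u) * of_real x)"
  let ?f = "\<lambda>u x. of_real (K u) * (of_real (indicator {0..} x * wsinc h x) * ?E u x)"
  have Re: "Re (s - 1 + \<i> * of_real u) > 0" for u using s by simp
  have "continuous_on UNIV (\<lambda>p::real\<times>real. exp (- (s - 1 + \<i> * of_real (fst p)) * of_real (snd p)))"
    by (intro continuous_intros)
  then have [measurable]: "(\<lambda>p::real\<times>real. exp (- (s - 1 + \<i> * of_real (fst p)) * of_real (snd p))) \<in> borel_measurable (borel \<Otimes>\<^sub>M borel)"
    by (simp add: borel_measurable_continuous_onI borel_prod)
  have fm: "(\<lambda>(u, x). ?f u x) \<in> borel_measurable (lborel \<Otimes>\<^sub>M lborel)"
    unfolding case_prod_beta by measurable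
  define b where "b = Re s - 1"
  have b: "b > 0" using s by (simp add: b_def)
  define e where "e = (\<lambda>x. indicator {0..} x * \<bar>wsinc h x\<bar> * exp (- b * x))"
  have nf: "norm (?f u x) = K u * e x" for u x
    using K_nonneg[of u] by (simp add: norm_mult e_def b_def indicator_def)
  have ei: "integrable lborel e"
  proof (rule integrable_quadratic_decay[of _ "h * (1 + 2 / b\<^sup>2)"])
    show "e \<in> borel_measurable borel" unfolding e_def by measurable
    show "norm (e x) \<le> h * (1 + 2 / b\<^sup>2) / (1 + x\<^sup>2)" for x
    proof (cases "x \<ge> 0")
      case True
      have "norm (e x) = \<bar>wsinc h x\<bar> * exp (- b * x)" using True by (simp add: e_def abs_mult)
      also have "\<dots> \<le> h * ((1 + 2 / b\<^sup>2) / (1 + x\<^sup>2))"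
        by (rule mult_mono[OF abs_wsinc_le[OF h_pos] exp_decay_quadratic[OF b True]]) (use h_pos in auto)
      finally show ?thesis by simp
    next
      case False
      then show ?thesis using h_pos by (simp add: e_def add_nonneg_nonneg)
    qed
  qed
  have ii: "integrable lborel (\<lambda>x. ?f u x)" for u
  proof (rule Bochner_Integration.integrable_bound[OF integrable_mult_right[OF ei, of "K u"]])
    have [measurable]: "(\<lambda>x::real. ?E u x) \<in> borel_measurable borel"
      by (intro borel_measurable_continuous_onI continuous_intros)
    show "(\<lambda>x. ?f u x) \<in> borel_measurable lborel" by measurable
    show "AE x in lborel. norm (?f u x) \<le> norm (K u * e x)" unfolding nf by simp
  qed
  have int: "integrable (lborel \<Otimes>\<^sub>M lborel) (\<lambda>(u, x). ?f u x)"
  proof (rule lborel_pair.Fubini_integrable[OF fm])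
    show "integrable lborel (\<lambda>u. \<integral>x. norm (case (u, x) of (u, x) \<Rightarrow> ?f u x) \<partial>lborel)"
      unfolding case_prod_conv nf integral_mult_right_zero by (intro integrable_mult_left K_integrable)
    show "AE u in lborel. integrable lborel (\<lambda>x. case (u, x) of (u, x) \<Rightarrow> ?f u x)"
      unfolding case_prod_conv using ii by simp
  qed
  have inner1: "2 * \<i> * (\<integral>x. ?f u x \<partial>lborel) = q u" for u
  proof -
    have "s + \<i> * of_real (u + h) - 1 = (s - 1 + \<i> * of_real u) + \<i> * of_real h"
      "s + \<i> * of_real (u - h) - 1 = (s - 1 + \<i> * of_real u) - \<i> * of_real h"
      by (simp_all add: algebra_simps)
    then have "q u = of_real (K u) * (2 * \<i> * (\<integral>x. of_real (indicator {0..} x * wsinc h x) * ?E u x \<partial>lborel))"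
      unfolding q_def by (simp only: Ln_difference_laplace[OF Re h_pos])
    then show ?thesis unfolding integral_mult_right_zero by (simp add: mult_ac)
  qed
  have "integrable lborel (\<lambda>u. \<integral>x. ?f u x \<partial>lborel)"
    using lborel_pair.integrable_fst[OF int] by simp
  then have "integrable lborel (\<lambda>u. 2 * \<i> * (\<integral>x. ?f u x \<partial>lborel))" by (rule integrable_mult_right)
  then show "integrable lborel q" unfolding inner1 .
  have inner2: "(\<integral>u. ?f u x \<partial>lborel) = of_real (pker x) * exp (- (s - 1) * of_real x)" for x
  proof -
    have "?E u x = exp (- (s - 1) * of_real x) * cis (- (x * u))" for u
      unfolding cis_conv_exp exp_add[symmetric] by (simp add: algebra_simps)
    then have "(\<integral>u. ?f u x \<partial>lborel) = (\<integral>u. (of_real (K u) * cis (- (x * u))) * (of_real (indicator {0..} x * wsinc h x) * exp (- (s - 1) * of_real x)) \<partial>lborel)"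
      by (simp add: mult_ac)
    also have "\<dots> = of_real (Kh x) * (of_real (indicator {0..} x * wsinc h x) * exp (- (s - 1) * of_real x))"
      unfolding integral_mult_left_zero Kh ..
    also have "\<dots> = of_real (pker x) * exp (- (s - 1) * of_real x)" by (simp add: pker_def)
    finally show ?thesis .
  qed
  have "(\<integral>u. q u \<partial>lborel) = 2 * \<i> * (\<integral>u. (\<integral>x. ?f u x \<partial>lborel) \<partial>lborel)"
    unfolding inner1[symmetric] by (rule integral_mult_right_zero)
  also have "(\<integral>u. (\<integral>x. ?f u x \<partial>lborel) \<partial>lborel) = (\<integral>x. (\<integral>u. ?f u x \<partial>lborel) \<partial>lborel)"
    by (rule lborel_pair.Fubini_integral[OF int, symmetric])
  also have "\<dots> = Pint s" unfolding inner2 Pint_def ..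
  finally show "(\<integral>u. q u \<partial>lborel) = 2 * \<i> * Pint s" .
qed

lemma Fint_eq_right:
  assumes s: "Re s > 1"
  shows "Fint s = 2 * \<i> * (Pint s - Dser s)"
proof -
  have "of_real (K u) * (g (s + \<i> * of_real (u + h)) - g (s + \<i> * of_real (u - h)))
      = of_real (K u) * (log_dseries (s + \<i> * of_real (u + h)) - log_dseries (s + \<i> * of_real (u - h)))
      + of_real (K u) * (Ln (s + \<i> * of_real (u + h) - 1) - Ln (s + \<i> * of_real (u - h) - 1))" for u
    using s by (subst (1 2) g_eq) (auto simp: algebra_simps)
  then have "Fint s = (\<integral>u. of_real (K u) * (log_dseries (s + \<i> * of_real (u + h)) - log_dseries (s + \<i> * of_real (u - h)))
      + of_real (K u) * (Ln (s + \<i> * of_real (u + h) - 1) - Ln (s + \<i> * of_real (u - h) - 1)) \<partial>lborel)"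
    unfolding Fint_def by (simp only:)
  also have "\<dots> = - 2 * \<i> * Dser s + 2 * \<i> * Pint s"
    unfolding Bochner_Integration.integral_add[OF dirichlet_part(1)[OF s] pole_part(1)[OF s]]
      dirichlet_part(2)[OF s] pole_part(2)[OF s] ..
  finally show ?thesis by (simp add: algebra_simps)
qed

text \<open>RH enters through the holomorphy of \<open>Fint\<close> up to the critical line. The
  decay of \<open>Kh\<close> makes the right side holomorphic there too, so the identity known for
  Re s > 1 extends.\<close>

lemma Fint_eq:
  assumes s: "1/2 < Re s" "Re s < 7/4"
  shows "Fint s = 2 * \<i> * (Pint s - Dser s)"
proof (rule analytic_continuation_open[of "{s. Re s > 1} \<inter> {s. Re s < 7/4}" "{s. 1/2 < Re s} \<inter> {s. Re s < 7/4}" Fint "\<lambda>s. 2 * \<i> * (Pint s - Dser s)"])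
  have "Complex (3/2) 0 \<in> {s. Re s > 1} \<inter> {s. Re s < 7/4}" by simp
  then show "{s. Re s > 1} \<inter> {s. Re s < 7/4} \<noteq> {}" by blast
  show "Fint holomorphic_on {s. 1/2 < Re s} \<inter> {s. Re s < 7/4}" by (rule Fint_holomorphic)
  show "(\<lambda>s. 2 * \<i> * (Pint s - Dser s)) holomorphic_on {s. 1/2 < Re s} \<inter> {s. Re s < 7/4}"
    by (intro holomorphic_intros holomorphic_on_subset[OF Pint_holomorphic] holomorphic_on_subset[OF Dser_holomorphic]) auto
  show "connected ({s. 1/2 < Re s} \<inter> {s. Re s < 7/4})"
    by (intro convex_connected convex_Int convex_halfspace_Re_gt convex_halfspace_Re_lt)
  show "open ({s. 1/2 < Re s} \<inter> {s. Re s < 7/4})" "open ({s. Re s > 1} \<inter> {s. Re s < 7/4})"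
    by (intro open_Int open_halfspace_Re_gt open_halfspace_Re_lt)+
qed (use s Fint_eq_right in auto)

section \<open>Limits of both sides as \<sigma> tends to 1/2\<close>

definition Dcos :: "real \<Rightarrow> real \<Rightarrow> real" where
  "Dcos \<sigma> t = (\<Sum>n. bcoef n * exp (- \<sigma> * lam n) * cos (t * lam n))"

definition Pcos :: "real \<Rightarrow> real \<Rightarrow> real" where
  "Pcos \<sigma> t = (\<integral>x. pker x * exp ((1 - \<sigma>) * x) * cos (t * x) \<partial>lborel)"

lemma smoothed_formula:
  fixes \<sigma> t :: real
  assumes \<sigma>: "1/2 < \<sigma>" "\<sigma> < 7/4"
  defines "f \<equiv> \<lambda>u. K u * (Im (g (Complex \<sigma> (t + u + h))) - Im (g (Complex \<sigma> (t + u - h))))"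
  shows "integrable lborel f" and "(\<integral>u. f u \<partial>lborel) = 2 * Pcos \<sigma> t - 2 * Dcos \<sigma> t"
proof -
  define s where "s = Complex \<sigma> t"
  have s: "1/2 < Re s" "Re s < 7/4" using \<sigma> by (auto simp: s_def)
  let ?F = "\<lambda>u. of_real (K u) * (g (s + \<i> * of_real (u + h)) - g (s + \<i> * of_real (u - h)))"
  have arg: "s + \<i> * of_real (u + h) = Complex \<sigma> (t + u + h)" "s + \<i> * of_real (u - h) = Complex \<sigma> (t + u - h)" for u
    by (auto simp: s_def complex_eq_iff)
  have f_eq: "f = (\<lambda>u. Im (?F u))" unfolding f_def arg by simp
  show "integrable lborel f" unfolding f_eq by (rule integrable_Im[OF Fint_integrable[OF s]])
  have "(\<integral>u. f u \<partial>lborel) = Im (Fint s)"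
    unfolding f_eq Fint_def by (rule integral_Im[OF Fint_integrable[OF s]])
  also have "\<dots> = 2 * Re (Pint s) - 2 * Re (Dser s)" unfolding Fint_eq[OF s] by simp
  also have "Re (Pint s) = Pcos \<sigma> t"
  proof -
    have "integrable lborel (\<lambda>x. of_real (pker x) * exp (- (s - 1) * of_real x))"
      by (rule integrable_quadratic_decay[OF Pint_integrand_measurable norm_Pint_integrand]) (use s in simp)
    then have "Re (Pint s) = (\<integral>x. Re (of_real (pker x) * exp (- (s - 1) * of_real x)) \<partial>lborel)"
      unfolding Pint_def by (rule integral_Re[symmetric])
    moreover have "Re (of_real (pker x) * exp (- (s - 1) * of_real x)) = pker x * exp ((1 - \<sigma>) * x) * cos (t * x)" for x
      by (simp add: Re_exp s_def)
    ultimately show ?thesis unfolding Pcos_def by (simp only:)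
  qed
  also have "Re (Dser s) = Dcos \<sigma> t"
  proof -
    have "(\<lambda>n. Re (of_real (bcoef n) * exp (- s * of_real (lam n)))) sums Re (Dser s)"
      by (rule sums_Re[OF Dser_sums]) (use s in simp)
    moreover have "Re (of_real (bcoef n) * exp (- s * of_real (lam n))) = bcoef n * exp (- \<sigma> * lam n) * cos (t * lam n)" for n
      by (simp add: Re_exp s_def del: of_nat_Suc)
    ultimately have "(\<lambda>n. bcoef n * exp (- \<sigma> * lam n) * cos (t * lam n)) sums Re (Dser s)" by (simp only:)
    then show ?thesis unfolding Dcos_def by (rule sums_unique)
  qed
  finally show "(\<integral>u. f u \<partial>lborel) = 2 * Pcos \<sigma> t - 2 * Dcos \<sigma> t" .
qed

text \<open>The majorant of \<open>bcoef_bound\<close> is uniform in \<sigma> \<ge> 1/2, so the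
  limit may be taken termwise.\<close>

lemma Dcos_tendsto: "((\<lambda>\<sigma>. Dcos \<sigma> t) \<longlongrightarrow> Dcos (1/2) t) (at_right (1/2))"
  unfolding Dcos_def
proof (rule tannerys_theorem[THEN conjunct2, THEN conjunct2])
  show "((\<lambda>\<sigma>. bcoef n * exp (- \<sigma> * lam n) * cos (t * lam n)) \<longlongrightarrow> bcoef n * exp (- (1/2) * lam n) * cos (t * lam n)) (at_right (1/2))" for n
    by (intro tendsto_intros)
  have ev: "\<forall>\<^sub>F \<sigma> in at_right (1/2::real). \<sigma> > 1/2" by (simp add: eventually_at_filter)
  have "\<forall>\<^sub>F p in (at_top :: nat filter) \<times>\<^sub>F at_right (1/2::real). snd p > 1/2"
    by (rule eventually_compose_filterlim[OF ev filterlim_snd])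
  then show "\<forall>\<^sub>F (n, \<sigma>) in at_top \<times>\<^sub>F at_right (1/2). norm (bcoef n * exp (- \<sigma> * lam n) * cos (t * lam n))
      \<le> C * (1 / (real (Suc n) * (1 + (lam n)\<^sup>2)))"
  proof eventually_elim
    case (elim p)
    obtain n \<sigma> where p: "p = (n, \<sigma>)" by force
    have "norm (bcoef n * exp (- \<sigma> * lam n) * cos (t * lam n)) \<le> \<bar>bcoef n\<bar> * exp (- \<sigma> * lam n) * 1"
      unfolding real_norm_def abs_mult abs_exp_cancel by (intro mult_left_mono) auto
    then show ?case using bcoef_bound[of \<sigma> n] elim by (simp add: p del: of_nat_Suc)
  qed
qed (use summable_bound in auto)

lemma Pcos_integrable:
  assumes "\<sigma> \<ge> 1/2"
  shows "integrable lborel (\<lambda>x. pker x * exp ((1 - \<sigma>) * x) * cos (t * x))"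
    and "norm (pker x * exp ((1 - \<sigma>) * x) * cos (t * x)) \<le> (h * C) / (1 + x\<^sup>2)"
proof -
  show le: "norm (pker x * exp ((1 - \<sigma>) * x) * cos (t * x)) \<le> (h * C) / (1 + x\<^sup>2)" for x
  proof -
    have "norm (pker x * exp ((1 - \<sigma>) * x) * cos (t * x)) \<le> \<bar>pker x\<bar> * exp ((1 - \<sigma>) * x) * 1"
      unfolding real_norm_def abs_mult abs_exp_cancel by (intro mult_left_mono) auto
    then show ?thesis using norm_pker_bound[OF assms, of x] by simp
  qed
  show "integrable lborel (\<lambda>x. pker x * exp ((1 - \<sigma>) * x) * cos (t * x))"
    by (rule integrable_quadratic_decay[OF _ le]) measurable
qed

lemma Pcos_tendsto: "((\<lambda>\<sigma>. Pcos \<sigma> t) \<longlongrightarrow> Pcos (1/2) t) (at_right (1/2))"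
  unfolding tendsto_at_iff_sequentially o_def
proof (intro allI impI)
  fix X :: "nat \<Rightarrow> real" assume X: "\<forall>i. X i \<in> {1/2<..} - {1/2}" "X \<longlonglongrightarrow> 1/2"
  have X1: "X i \<ge> 1/2" for i using X(1)[rule_format, of i] by simp
  show "(\<lambda>i. Pcos (X i) t) \<longlonglongrightarrow> Pcos (1/2) t"
    unfolding Pcos_def
  proof (rule integral_dominated_convergence[where w = "\<lambda>x. (h * C) / (1 + x\<^sup>2)"])
    show "integrable lborel (\<lambda>x::real. (h * C) / (1 + x\<^sup>2))"
      by (rule integrable_quadratic_decay[of _ "h * C"]) (use h_pos C_pos in auto)
    show "AE x in lborel. (\<lambda>i. pker x * exp ((1 - X i) * x) * cos (t * x)) \<longlonglongrightarrow> pker x * exp ((1 - 1/2) * x) * cos (t * x)"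
      by (intro AE_I2 tendsto_intros X)
    show "AE x in lborel. norm (pker x * exp ((1 - X i) * x) * cos (t * x)) \<le> (h * C) / (1 + x\<^sup>2)" for i
      by (intro AE_I2 Pcos_integrable(2) X1)
  qed measurable
qed

end

section \<open>Almost periods, the Riemann--Lebesgue lemma and the divergent sum\<close>

text \<open>Pigeonhole: the phases modulo 1 are sorted into cells of length 1 / M, and each of the
  finitely many cell patterns keeps one representative. Subtracting from T the representative of its
  pattern brings all phases close to integers, and the representatives are bounded; so every T has
  an almost period nearby.\<close>

lemma almost_periods:
  fixes \<omega> :: "nat \<Rightarrow> real"
  assumes \<epsilon>: "\<epsilon> > 0"
  obtains l where "l \<ge> 0" "\<And>T. \<exists>t. \<bar>t - T\<bar> \<le> l \<and> (\<forall>n<N. cos (t * \<omega> n) \<ge> 1 - \<epsilon>)"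
proof -
  define M :: nat where "M = nat \<lceil>20 / \<epsilon>\<rceil> + 1"
  have M: "real M \<ge> 20 / \<epsilon>" "M \<ge> 1" unfolding M_def by linarith+
  define code where "code = (\<lambda>T. \<lambda>n\<in>{..<N}. \<lfloor>real M * frac (T * \<omega> n / (2 * pi))\<rfloor>)"
  have "code T \<in> {..<N} \<rightarrow>\<^sub>E {0..<int M}" for T
  proof -
    have "\<lfloor>real M * frac y\<rfloor> \<in> {0..<int M}" for y :: real
    proof -
      have "0 \<le> real M * frac y" by simp
      moreover have "real M * frac y < real M" using frac_lt_1[of y] M(2) by simp
      ultimately show ?thesis by (simp add: floor_less_iff)
    qed
    then show ?thesis by (auto simp: code_def)
  qed
  then have "range code \<subseteq> {..<N} \<rightarrow>\<^sub>E {0..<int M}" by blast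
  then have fin: "finite (range code)" by (rule finite_subset) (auto intro: finite_PiE)
  define r where "r = (\<lambda>k. SOME T. code T = k)"
  have r: "code (r (code T)) = code T" for T unfolding r_def by (rule someI[of _ T]) simp
  define l where "l = Max ((\<lambda>k. \<bar>r k\<bar>) ` range code)"
  have l: "\<bar>r (code T)\<bar> \<le> l" for T unfolding l_def by (rule Max_ge) (use fin in auto)
  have "\<exists>t. \<bar>t - T\<bar> \<le> l \<and> (\<forall>n<N. cos (t * \<omega> n) \<ge> 1 - \<epsilon>)" for T
  proof (intro exI conjI allI impI)
    show "\<bar>(T - r (code T)) - T\<bar> \<le> l" using l[of T] by simp
    fix n assume n: "n < N"
    define x y where "x = T * \<omega> n / (2 * pi)" and "y = r (code T) * \<omega> n / (2 * pi)"
    have fl: "\<lfloor>real M * frac x\<rfloor> = \<lfloor>real M * frac y\<rfloor>"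
      using fun_cong[OF r[of T], of n] n by (simp add: code_def x_def y_def)
    define d where "d = frac x - frac y"
    have "\<bar>real M * frac x - real M * frac y\<bar> < 1" using fl by linarith
    then have "real M * \<bar>d\<bar> < 1" unfolding d_def by (simp add: abs_mult flip: right_diff_distrib)
    have xy: "x - y = d + of_int (\<lfloor>x\<rfloor> - \<lfloor>y\<rfloor>)" by (simp add: d_def frac_def)
    have "(T - r (code T)) * \<omega> n = 2 * pi * (x - y)" by (simp add: x_def y_def field_simps)
    also have "\<dots> = 2 * pi * d + 2 * pi * of_int (\<lfloor>x\<rfloor> - \<lfloor>y\<rfloor>)" unfolding xy by (rule distrib_left)
    finally have eq: "cos ((T - r (code T)) * \<omega> n) = cos (2 * pi * d)"
      using sin_int_2pin[of "\<lfloor>x\<rfloor> - \<lfloor>y\<rfloor>"] cos_int_2pin[of "\<lfloor>x\<rfloor> - \<lfloor>y\<rfloor>"] by (simp add: cos_add)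
    have "cos (2 * pi * d) = 1 - 2 * (sin (pi * d))\<^sup>2" using cos_double_sin[of "pi * d"] by (simp add: mult.assoc)
    moreover have "(sin (pi * d))\<^sup>2 \<le> \<epsilon> / 2"
    proof -
      have "\<bar>sin (pi * d)\<bar> \<le> 1" by simp
      moreover have "\<bar>sin (pi * d)\<bar> \<le> \<epsilon> / 2"
      proof -
        have "\<bar>sin (pi * d)\<bar> \<le> pi * \<bar>d\<bar>" using abs_sin_x_le_abs_x[of "pi * d"] by (simp add: abs_mult)
        also have "\<dots> \<le> 4 * \<bar>d\<bar>" using pi_less_4 by (intro mult_right_mono) auto
        also have "\<bar>d\<bar> \<le> \<epsilon> / 20"
        proof -
          have "20 / \<epsilon> * \<bar>d\<bar> \<le> real M * \<bar>d\<bar>" using M(1) by (intro mult_right_mono) auto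
          then have "20 / \<epsilon> * \<bar>d\<bar> \<le> 1" using \<open>real M * \<bar>d\<bar> < 1\<close> by linarith
          then show ?thesis using \<epsilon> by (simp add: field_simps)
        qed
        finally show ?thesis using \<epsilon> by simp
      qed
      ultimately have "\<bar>sin (pi * d)\<bar> * \<bar>sin (pi * d)\<bar> \<le> 1 * (\<epsilon> / 2)" by (intro mult_mono) auto
      then show ?thesis by (simp add: power2_eq_square)
    qed
    ultimately show "cos ((T - r (code T)) * \<omega> n) \<ge> 1 - \<epsilon>" unfolding eq by simp
  qed
  moreover have "l \<ge> 0" using l[of 0] by linarith
  ultimately show ?thesis using that by blast
qed

text \<open>Translation by the half period pi / t reverses the sign of cos (t x), so twice the
  integral is at most the L^1 distance between w and its translate. Continuity is asked only off 0
  because \<open>pker\<close> jumps there.\<close>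

lemma Riemann_Lebesgue_cos:
  fixes w :: "real \<Rightarrow> real"
  assumes meas [measurable]: "w \<in> borel_measurable borel"
    and bd: "\<And>x. \<bar>w x\<bar> \<le> D / (1 + x\<^sup>2)" and cont: "\<And>x. x \<noteq> 0 \<Longrightarrow> isCont w x"
  shows "((\<lambda>t. \<integral>x. w x * cos (t * x) \<partial>lborel) \<longlongrightarrow> 0) at_top"
proof (rule tendsto_at_topI_sequentially)
  fix X :: "nat \<Rightarrow> real" assume X: "filterlim X at_top sequentially"
  have D: "D \<ge> 0" using bd[of 0] by simp
  \<comment> \<open>The value 0 for small X n keeps all translations bounded by pi, as the majorant
    requires.\<close>
  define Y where "Y = (\<lambda>n. if X n \<ge> 1 then pi / X n else 0)"
  have Y: "\<bar>Y n\<bar> \<le> pi" for n by (auto simp: Y_def divide_le_eq)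
  have ev1: "\<forall>\<^sub>F n in sequentially. X n \<ge> 1" using X by (simp add: filterlim_at_top)
  have Y0: "Y \<longlonglongrightarrow> 0"
  proof (rule Lim_transform_eventually)
    show "(\<lambda>n. pi / X n) \<longlonglongrightarrow> 0" using X by (intro tendsto_divide_0[OF tendsto_const] filterlim_at_top_imp_at_infinity)
    show "\<forall>\<^sub>F n in sequentially. pi / X n = Y n" using ev1 by eventually_elim (simp add: Y_def)
  qed
  define g where "g = (\<lambda>x::real. D * (3 + 2 * pi\<^sup>2) / (1 + x\<^sup>2))"
  have gi: "integrable lborel g" unfolding g_def
    by (rule integrable_quadratic_decay[of _ "D * (3 + 2 * pi\<^sup>2)"]) (use D in auto)
  have wi: "integrable lborel (\<lambda>x. w x * cos (t * x))" for t
  proof (rule integrable_quadratic_decay)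
    show "norm (w x * cos (t * x)) \<le> D / (1 + x\<^sup>2)" for x
      using bd[of x] mult_left_le[of "\<bar>cos (t * x)\<bar>" "\<bar>w x\<bar>"] by (simp add: abs_mult)
  qed measurable
  have dom: "\<bar>w x - w (x + Y n)\<bar> \<le> g x" for x n
  proof -
    have "\<bar>w (x + Y n)\<bar> \<le> D * (1 / (1 + (x + Y n)\<^sup>2))" using bd[of "x + Y n"] by simp
    also have "\<dots> \<le> D * ((2 + 2 * (Y n)\<^sup>2) / (1 + x\<^sup>2))" by (intro mult_left_mono shift_quadratic_decay D)
    also have "\<dots> \<le> D * ((2 + 2 * pi\<^sup>2) / (1 + x\<^sup>2))"
    proof -
      have "(Y n)\<^sup>2 \<le> pi\<^sup>2" using Y[of n] by (simp add: power2_le_iff_abs_le)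
      then show ?thesis using D by (intro mult_left_mono divide_right_mono) auto
    qed
    finally have "\<bar>w (x + Y n)\<bar> \<le> D * ((2 + 2 * pi\<^sup>2) / (1 + x\<^sup>2))" .
    moreover have "\<bar>w x\<bar> \<le> D * (1 / (1 + x\<^sup>2))" using bd[of x] by simp
    moreover have "D * (1 / (1 + x\<^sup>2)) + D * ((2 + 2 * pi\<^sup>2) / (1 + x\<^sup>2)) = g x"
      unfolding g_def by (simp add: add_divide_distrib[symmetric]) (simp add: algebra_simps)
    ultimately show ?thesis by linarith
  qed
  have lim: "(\<lambda>n. \<integral>x. \<bar>w x - w (x + Y n)\<bar> \<partial>lborel) \<longlonglongrightarrow> (\<integral>x. 0 \<partial>(lborel :: real measure))"
  proof (rule integral_dominated_convergence[OF _ _ gi])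
    have "AE x in lborel. x \<noteq> (0::real)" by (rule AE_lborel_singleton)
    then show "AE x in lborel. (\<lambda>n. \<bar>w x - w (x + Y n)\<bar>) \<longlonglongrightarrow> 0"
    proof eventually_elim
      case (elim x)
      have "(\<lambda>n. x + Y n) \<longlonglongrightarrow> x + 0" by (intro tendsto_intros Y0)
      then have "(\<lambda>n. w (x + Y n)) \<longlonglongrightarrow> w x" using isCont_tendsto_compose[OF cont[OF elim], of "\<lambda>n. x + Y n"] by simp
      then have "(\<lambda>n. \<bar>w x - w (x + Y n)\<bar>) \<longlonglongrightarrow> \<bar>w x - w x\<bar>" by (intro tendsto_intros)
      then show ?case by simp
    qed
    show "AE x in lborel. norm \<bar>w x - w (x + Y n)\<bar> \<le> g x" for n using dom by simp
  qed auto
  show "(\<lambda>n. \<integral>x. w x * cos (X n * x) \<partial>lborel) \<longlonglongrightarrow> 0"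
  proof (rule Lim_null_comparison)
    show "(\<lambda>n. \<integral>x. \<bar>w x - w (x + Y n)\<bar> \<partial>lborel) \<longlonglongrightarrow> 0" using lim by simp
    show "\<forall>\<^sub>F n in sequentially. norm (\<integral>x. w x * cos (X n * x) \<partial>lborel) \<le> (\<integral>x. \<bar>w x - w (x + Y n)\<bar> \<partial>lborel)"
      using ev1
    proof eventually_elim
      case (elim n)
      define I where "I = (\<integral>x. w x * cos (X n * x) \<partial>lborel)"
      have XY: "X n * Y n = pi" using elim by (simp add: Y_def)
      have c: "cos (X n * (x + Y n)) = - cos (X n * x)" for x
        unfolding distrib_left XY by (simp add: cos_add)
      have "I = (\<integral>x. w (Y n + 1 * x) * cos (X n * (Y n + 1 * x)) \<partial>lborel)"
        unfolding I_def using lborel_integral_real_affine[of 1 "\<lambda>x. w x * cos (X n * x)" "Y n"] by simp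
      also have "\<dots> = (\<integral>x. - (w (x + Y n) * cos (X n * x)) \<partial>lborel)"
        by (simp add: c add.commute)
      finally have I2: "I = (\<integral>x. - (w (x + Y n) * cos (X n * x)) \<partial>lborel)" .
      have i2: "integrable lborel (\<lambda>x. - (w (x + Y n) * cos (X n * x)))"
      proof -
        have "integrable lborel (\<lambda>x. w (Y n + 1 * x) * cos (X n * (Y n + 1 * x)))"
          using lborel_integrable_real_affine[OF wi[of "X n"], of 1 "Y n"] by simp
        then show ?thesis by (simp add: c add.commute)
      qed
      have "I + I = (\<integral>x. w x * cos (X n * x) + - (w (x + Y n) * cos (X n * x)) \<partial>lborel)"
        unfolding Bochner_Integration.integral_add[OF wi i2] I2[symmetric] by (simp add: I_def)
      also have "norm \<dots> \<le> (\<integral>x. \<bar>w x - w (x + Y n)\<bar> \<partial>lborel)"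
      proof (rule norm_integral_le)
        show "integrable lborel (\<lambda>x. w x * cos (X n * x) + - (w (x + Y n) * cos (X n * x)))"
          by (intro Bochner_Integration.integrable_add wi i2)
        show "integrable lborel (\<lambda>x. \<bar>w x - w (x + Y n)\<bar>)"
          by (rule Bochner_Integration.integrable_bound[OF gi]) (use dom in \<open>auto intro!: AE_I2 order_trans[OF _ abs_ge_self]\<close>)
        show "norm (w x * cos (X n * x) + - (w (x + Y n) * cos (X n * x))) \<le> \<bar>w x - w (x + Y n)\<bar>" for x
        proof -
          have "w x * cos (X n * x) + - (w (x + Y n) * cos (X n * x)) = (w x - w (x + Y n)) * cos (X n * x)"
            by (simp add: algebra_simps)
          then show ?thesis by (simp add: abs_mult mult_left_le)
        qed
      qed
      finally have "2 * \<bar>I\<bar> \<le> (\<integral>x. \<bar>w x - w (x + Y n)\<bar> \<partial>lborel)" by simp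
      then show ?case unfolding I_def[symmetric] real_norm_def using abs_ge_zero[of I] by linarith
    qed
  qed
qed

text \<open>If Q bounded the partial sums, then log zeta(x) \<le> Q for all x > 1, and (x - 1)
  zeta(x) would tend to 0 as x \<rightarrow> 1, against \<open>zreg_1\<close>.\<close>

lemma lcoef_sum_unbounded: "\<exists>N. (\<Sum>n<N. lcoef (Suc n) / real (Suc n)) > Q"
proof (rule ccontr)
  assume "\<not> ?thesis"
  then have le: "(\<Sum>n<N. lcoef (Suc n) / real (Suc n)) \<le> Q" for N by (auto simp: not_less)
  have bound: "cmod (zreg (of_real x)) \<le> (x - 1) * exp Q" if x: "x > 1" for x
  proof -
    have Re: "Re (of_real x) > 1" using x by simp
    have "(\<lambda>n. Re (of_real (lcoef (Suc n)) * of_nat (Suc n) powr (- of_real x))) sums Re (log_dseries (of_real x))"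
      by (rule sums_Re[OF log_dseries_sums[OF Re]])
    moreover have "Re (of_real (lcoef (Suc n)) * of_nat (Suc n) powr (- of_real x)) = lcoef (Suc n) * exp (- x * ln (real (Suc n)))" for n
      unfolding nat_powr_exp by (simp add: Re_exp del: of_nat_Suc)
    ultimately have sm: "(\<lambda>n. lcoef (Suc n) * exp (- x * ln (real (Suc n)))) sums Re (log_dseries (of_real x))" by (simp only:)
    have "Re (log_dseries (of_real x)) \<le> Q"
    proof (rule LIMSEQ_le_const2[OF sm[unfolded sums_def]], intro exI allI impI)
      fix N :: nat
      have "(\<Sum>n<N. lcoef (Suc n) * exp (- x * ln (real (Suc n)))) \<le> (\<Sum>n<N. lcoef (Suc n) / real (Suc n))"
      proof (rule sum_mono)
        fix n
        have "exp (- x * ln (real (Suc n))) \<le> exp (- ln (real (Suc n)))"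
          using x mult_right_mono[of 1 x "ln (real (Suc n))"] by simp
        also have "\<dots> = 1 / real (Suc n)" by (simp add: exp_minus inverse_eq_divide del: of_nat_Suc)
        finally have "lcoef (Suc n) * exp (- x * ln (real (Suc n))) \<le> lcoef (Suc n) * (1 / real (Suc n))"
          by (intro mult_left_mono lcoef_nonneg)
        then show "lcoef (Suc n) * exp (- x * ln (real (Suc n))) \<le> lcoef (Suc n) / real (Suc n)" by simp
      qed
      then show "(\<Sum>n<N. lcoef (Suc n) * exp (- x * ln (real (Suc n)))) \<le> Q" using le[of N] by linarith
    qed
    moreover have "cmod (dseries (of_real x)) = exp (Re (log_dseries (of_real x)))"
      unfolding exp_log_dseries[OF Re, symmetric] by (rule norm_exp_eq_Re)
    ultimately have "cmod (dseries (of_real x)) \<le> exp Q" by simp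
    moreover have "cmod (zreg (of_real x)) = (x - 1) * cmod (dseries (of_real x))"
    proof -
      have "complex_of_real x - 1 = of_real (x - 1)" by simp
      then show ?thesis unfolding zreg_dseries[OF Re] norm_mult using x by (simp only: norm_of_real)
    qed
    ultimately show ?thesis using x by simp
  qed
  have "isCont zreg 1"
    using holomorphic_on_imp_continuous_on[OF zreg_holomorphic] by (simp add: continuous_on_eq_continuous_at)
  moreover have "((\<lambda>x. complex_of_real x) \<longlongrightarrow> 1) (at_right 1)" by (auto intro!: tendsto_eq_intros)
  ultimately have "((\<lambda>x. zreg (of_real x)) \<longlongrightarrow> zreg 1) (at_right 1)" by (rule isCont_tendsto_compose)
  moreover have "((\<lambda>x. zreg (of_real x)) \<longlongrightarrow> 0) (at_right 1)"
  proof (rule Lim_null_comparison)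
    have "\<forall>\<^sub>F x in at_right (1::real). x > 1" by (simp add: eventually_at_filter)
    then show "\<forall>\<^sub>F x in at_right 1. cmod (zreg (of_real x)) \<le> (x - 1) * exp Q"
      by eventually_elim (rule bound)
    have "((\<lambda>x. (x - 1) * exp Q) \<longlongrightarrow> (1 - 1) * exp Q) (at_right (1::real))" by (intro tendsto_intros)
    then show "((\<lambda>x. (x - 1) * exp Q) \<longlongrightarrow> 0) (at_right (1::real))" by simp
  qed
  ultimately have "zreg 1 = 0" by (rule tendsto_unique[rotated]) simp
  then show False by (simp add: zreg_1)
qed

text \<open>For y \<ge> 1/2 one has exp (y / 2) \<ge> (1 + y^2) / 8, hence exp (- y / 2) y / (1 +
  y^2) \<ge> exp (- y) / 16, and the divergence of \<open>lcoef_sum_unbounded\<close> carries over.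
  The term n = 0 belongs to the integer 1 and vanishes.\<close>

lemma weighted_lcoef_sum_unbounded:
  "\<exists>N. (\<Sum>n<N. lcoef (Suc n) * exp (- ln (real (Suc n)) / 2) * (ln (real (Suc n)) / (1 + (ln (real (Suc n)))\<^sup>2))) > Q"
proof -
  obtain N where N: "(\<Sum>n<N. lcoef (Suc n) / real (Suc n)) > 16 * Q" using lcoef_sum_unbounded by blast
  have "(\<Sum>n<N. lcoef (Suc n) / real (Suc n)) / 16 \<le>
      (\<Sum>n<N. lcoef (Suc n) * exp (- ln (real (Suc n)) / 2) * (ln (real (Suc n)) / (1 + (ln (real (Suc n)))\<^sup>2)))"
    unfolding sum_divide_distrib
  proof (rule sum_mono)
    fix n
    define y where "y = ln (real (Suc n))"
    show "lcoef (Suc n) / real (Suc n) / 16 \<le> lcoef (Suc n) * exp (- ln (real (Suc n)) / 2) * (ln (real (Suc n)) / (1 + (ln (real (Suc n)))\<^sup>2))"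
    proof (cases "n = 0")
      case True
      then show ?thesis by (simp add: lcoef_def)
    next
      case False
      have "ln 2 \<le> y" unfolding y_def using False by (subst ln_le_cancel_iff) auto
      then have y: "y \<ge> 1/2" using ln2_ge_two_thirds by linarith
      have "1 + y / 2 + (y / 2)\<^sup>2 / 2 \<le> exp (y / 2)" using y by (intro exp_lower_Taylor_quadratic) auto
      then have "(1 + y\<^sup>2) / 8 \<le> exp (y / 2)" using y by (simp add: power_divide)
      then have "(1 + y\<^sup>2) / 8 * (1/2) \<le> exp (y / 2) * y" using y by (intro mult_mono) auto
      then have "1 / 16 \<le> exp (y / 2) * y / (1 + y\<^sup>2)" by (simp add: pos_le_divide_eq add_pos_nonneg)
      then have "exp (- y) * (1 / 16) \<le> exp (- y) * (exp (y / 2) * y / (1 + y\<^sup>2))" by (intro mult_left_mono) auto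
      also have "\<dots> = (exp (- y) * exp (y / 2)) * (y / (1 + y\<^sup>2))" by simp
      also have "exp (- y) * exp (y / 2) = exp (- y / 2)" unfolding exp_add[symmetric] by simp
      finally have "lcoef (Suc n) * (exp (- y) * (1 / 16)) \<le> lcoef (Suc n) * (exp (- y / 2) * (y / (1 + y\<^sup>2)))"
        by (intro mult_left_mono lcoef_nonneg)
      moreover have "exp (- y) = 1 / real (Suc n)" unfolding y_def by (simp add: exp_minus inverse_eq_divide del: of_nat_Suc)
      ultimately show ?thesis unfolding y_def[symmetric] by simp
    qed
  qed
  then show ?thesis using N by (intro exI[of _ N]) linarith
qed

section \<open>Large negative increments\<close>

lemma laplace_sin:
  fixes a :: real
  shows "integrable lborel (\<lambda>y. indicator {0..} y * exp (- y) * sin (a * y))"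
    and "(\<integral>y. indicator {0..} y * exp (- y) * sin (a * y) \<partial>lborel) = a / (1 + a\<^sup>2)"
    and "integrable lborel (\<lambda>y. indicator {0..} y * exp (- y) :: real)"
    and "(\<integral>y. indicator {0..} y * exp (- y) \<partial>lborel) = (1::real)"
proof -
  define z where "z = Complex 1 (- a)"
  have z: "Re z > 0" by (simp add: z_def)
  have e: "Im (of_real (indicator {0..} y) * exp (- z * of_real y)) = indicator {0..} y * exp (- y) * sin (a * y)" for y
    by (simp add: z_def Im_exp)
  show "integrable lborel (\<lambda>y. indicator {0..} y * exp (- y) * sin (a * y))"
    using integrable_Im[OF laplace_exp(1)[OF z]] unfolding e .
  have "(\<integral>y. indicator {0..} y * exp (- y) * sin (a * y) \<partial>lborel) = Im (1 / z)"
    using integral_Im[OF laplace_exp(1)[OF z]] unfolding e laplace_exp(2)[OF z] .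
  also have "\<dots> = a / (1 + a\<^sup>2)" by (simp add: z_def Im_divide)
  finally show "(\<integral>y. indicator {0..} y * exp (- y) * sin (a * y) \<partial>lborel) = a / (1 + a\<^sup>2)" .
  have o: "Re (1::complex) > 0" by simp
  have e1: "Re (of_real (indicator {0..} y) * exp (- 1 * of_real y)) = indicator {0..} y * exp (- y)" for y
    by (simp add: Re_exp)
  show "integrable lborel (\<lambda>y. indicator {0..} y * exp (- y) :: real)"
    using integrable_Re[OF laplace_exp(1)[OF o]] unfolding e1 .
  show "(\<integral>y. indicator {0..} y * exp (- y) \<partial>lborel) = (1::real)"
    using integral_Re[OF laplace_exp(1)[OF o]] unfolding e1 laplace_exp(2)[OF o] by simp
qed

text \<open>Averaging over the shift against the density \<open>exp (- y)\<close> turns the sines into the positive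
  weights \<open>a / (1 + a\<^sup>2)\<close>.\<close>

lemma exists_shift_large_sine_sum:
  fixes b \<omega> :: "nat \<Rightarrow> real"
  assumes b: "\<And>n. b n \<ge> 0" "summable b" and \<omega>: "\<And>n. \<omega> n \<ge> 0" and V: "V \<ge> 0"
    and big: "(\<Sum>n<N. b n * (\<omega> n / (1 + (\<omega> n)\<^sup>2))) > V"
  shows "\<exists>y>0. (\<Sum>n. b n * sin (\<omega> n * y)) > V"
proof (rule ccontr)
  assume "\<not> ?thesis"
  then have le': "(\<Sum>n. b n * sin (\<omega> n * y)) \<le> V" if "y > 0" for y using that by (meson leI)
  have le: "(\<Sum>n. b n * sin (\<omega> n * y)) \<le> V" if "y \<ge> 0" for y
    using that V le'[of y] by (cases "y = 0") auto
  define e where "e = (\<lambda>y::real. indicator {0..} y * exp (- y) :: real)"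
  have e0: "e y \<ge> 0" for y by (simp add: e_def)
  define f where "f = (\<lambda>n y. b n * (e y * sin (\<omega> n * y)))"
  have fi: "integrable lborel (f n)" for n
    unfolding f_def e_def by (intro integrable_mult_right laplace_sin(1))
  have nf: "norm (f n y) \<le> b n * e y" for n y
    using b(1)[of n] e0[of y] by (simp add: f_def abs_mult mult_left_mono mult_left_le)
  have ei: "integrable lborel e" unfolding e_def by (rule laplace_sin(3))
  have s1: "summable (\<lambda>n. norm (f n y))" for y
    by (rule summable_comparison_test'[OF summable_mult2[OF b(2), of "e y"], of 0]) (use nf in simp)
  have s2: "summable (\<lambda>n. \<integral>y. norm (f n y) \<partial>lborel)"
  proof (rule summable_comparison_test'[OF b(2), of 0])
    fix n
    have "(\<integral>y. norm (f n y) \<partial>lborel) \<le> (\<integral>y. b n * e y \<partial>lborel)"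
      by (rule integral_mono[OF integrable_norm[OF fi] integrable_mult_right[OF ei] nf])
    also have "\<dots> = b n" using laplace_sin(4) by (simp add: e_def)
    finally show "norm (\<integral>y. norm (f n y) \<partial>lborel) \<le> b n" by simp
  qed
  have I: "(\<integral>y. f n y \<partial>lborel) = b n * (\<omega> n / (1 + (\<omega> n)\<^sup>2))" for n
    unfolding f_def e_def integral_mult_right_zero laplace_sin(2) ..
  have sums: "(\<lambda>n. b n * (\<omega> n / (1 + (\<omega> n)\<^sup>2))) sums (\<integral>y. (\<Sum>n. f n y) \<partial>lborel)"
    using sums_integral[OF fi _ s2] s1 unfolding I by simp
  have "(\<integral>y. (\<Sum>n. f n y) \<partial>lborel) \<le> (\<integral>y. V * e y \<partial>lborel)"
  proof (rule integral_mono)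
    show "integrable lborel (\<lambda>y. \<Sum>n. f n y)" using integrable_suminf[OF fi _ s2] s1 by simp
    show "integrable lborel (\<lambda>y. V * e y)" by (intro integrable_mult_right ei)
    fix y :: real
    show "(\<Sum>n. f n y) \<le> V * e y"
    proof (cases "y \<ge> 0")
      case True
      have sb: "summable (\<lambda>n. b n * sin (\<omega> n * y))"
        by (rule summable_comparison_test'[OF b(2), of 0]) (use b(1) in \<open>auto simp: abs_mult mult_left_le\<close>)
      have "(\<Sum>n. f n y) = (\<Sum>n. e y * (b n * sin (\<omega> n * y)))" unfolding f_def by (simp add: mult_ac)
      also have "\<dots> = e y * (\<Sum>n. b n * sin (\<omega> n * y))" by (rule suminf_mult[OF sb])
      also have "\<dots> \<le> e y * V" by (intro mult_left_mono le True e0)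
      finally show ?thesis by (simp add: mult.commute)
    next
      case False
      then show ?thesis by (simp add: f_def e_def)
    qed
  qed
  also have "\<dots> = V" using laplace_sin(4) by (simp add: e_def)
  finally have "(\<Sum>n. b n * (\<omega> n / (1 + (\<omega> n)\<^sup>2))) \<le> V" using sums_unique[OF sums] by simp
  moreover have "(\<Sum>n<N. b n * (\<omega> n / (1 + (\<omega> n)\<^sup>2))) \<le> (\<Sum>n. b n * (\<omega> n / (1 + (\<omega> n)\<^sup>2)))"
    by (rule sum_le_suminf[OF sums_summable[OF sums]]) (use b(1) \<omega> in auto)
  ultimately show False using big by linarith
qed

section \<open>The inequality on the critical line, the pole term and almost periods\<close>

context smoothed
begin

definition growth :: "real \<Rightarrow> real" where
  "growth t = ln (\<bar>t\<bar> + h + 3)"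

lemma growth_ge_1: "growth t \<ge> 1"
  unfolding growth_def using ln_abs_plus_3[of "\<bar>t\<bar> + h"] h_pos by simp

lemma growth_add: "growth (t + u) \<le> growth t * (1 + \<bar>u\<bar>)"
proof -
  have "growth (t + u) \<le> ln ((\<bar>t\<bar> + h + 3) + \<bar>u\<bar>)"
    unfolding growth_def using h_pos by (subst ln_le_cancel_iff) auto
  also have "\<dots> \<le> growth t + \<bar>u\<bar>" unfolding growth_def using h_pos by (intro ln_add_le) auto
  also have "\<dots> \<le> growth t * (1 + \<bar>u\<bar>)"
    using mult_right_mono[OF growth_ge_1[of t], of "\<bar>u\<bar>"] by (simp add: distrib_left)
  finally show ?thesis .
qed

lemma AE_not_ordinate: "AE u in lborel. \<not> zeta_zero_ordinate (u + a)"
proof -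
  have "countable ((\<lambda>t. t - a) ` {t. zeta_zero_ordinate t})"
    by (intro countable_image countable_zeta_zero_ordinates)
  then have "(\<lambda>t. t - a) ` {t. zeta_zero_ordinate t} \<in> null_sets lborel"
    by (rule countable_imp_null_set_lborel)
  then have "AE u in lborel. u \<notin> (\<lambda>t. t - a) ` {t. zeta_zero_ordinate t}" by (rule AE_not_in)
  then show ?thesis
  proof eventually_elim
    case (elim u)
    show ?case
    proof
      assume "zeta_zero_ordinate (u + a)"
      then have "(u + a) - a \<in> (\<lambda>t. t - a) ` {t. zeta_zero_ordinate t}" by blast
      then show False using elim by simp
    qed
  qed
qed

text \<open>The smoothed increments at abscissa \<open>\<sigma>\<close> are bounded below uniformly in \<open>\<sigma>\<close>, so a Fatou-type
  argument gives the inequality on the critical line; outside the window only the trivial lower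
  bound for the increments is used.\<close>

lemma critical_line_inequality:
  obtains E where "E > 0" "\<And>t H a. a \<ge> 0 \<Longrightarrow>
     (\<forall>\<tau>. \<bar>\<tau> - t\<bar> \<le> H \<longrightarrow> pi * (S (\<tau> + h) - S (\<tau> - h)) - 2 * pi \<ge> - a) \<Longrightarrow>
     - a * Kh 0 - E * growth t * exp (- (c / 2) * exp (pi * H)) \<le> 2 * Pcos (1/2) t - 2 * Dcos (1/2) t"
proof -
  obtain C1 where C1: "C1 > 0"
    "\<And>\<sigma> t h. 1/2 < \<sigma> \<Longrightarrow> \<sigma> \<le> 3/4 \<Longrightarrow> h > 0 \<Longrightarrow>
       Im (g (Complex \<sigma> (t + h))) - Im (g (Complex \<sigma> (t - h))) \<ge> - C1 * h * ln (\<bar>t\<bar> + h + 3)"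
    using Im_g_increment_lower by blast
  define G where "G = C1 * h"
  have G: "G > 0" using C1(1) h_pos by (simp add: G_def)
  define J where "J = (\<integral>u. exp (- (c / 2) * exp (pi * \<bar>u\<bar>)) * (1 + \<bar>u\<bar>) \<partial>lborel)"
  have Ji: "integrable lborel (\<lambda>u. exp (- (c / 2) * exp (pi * \<bar>u\<bar>)) * (1 + \<bar>u\<bar>))"
    by (rule double_exp_moment_integrable) (use c_pos in simp)
  have J: "J \<ge> 0" unfolding J_def by (intro Bochner_Integration.integral_nonneg) auto
  define E where "E = G * B * J + 1"
  have E: "E > 0" using G B_nonneg J by (simp add: E_def add_nonneg_pos)
  have main: "- a * Kh 0 - E * growth t * exp (- (c / 2) * exp (pi * H)) \<le> 2 * Pcos (1/2) t - 2 * Dcos (1/2) t"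
    if a: "a \<ge> 0" and win: "\<forall>\<tau>. \<bar>\<tau> - t\<bar> \<le> H \<longrightarrow> pi * (S (\<tau> + h) - S (\<tau> - h)) - 2 * pi \<ge> - a" for t H a
  proof -
    define f where "f = (\<lambda>\<sigma> u. K u * (Im (g (Complex \<sigma> (t + u + h))) - Im (g (Complex \<sigma> (t + u - h)))))"
    define tl where "tl = (\<lambda>u. indicator {u. \<bar>u\<bar> > H} u * (K u * (1 + \<bar>u\<bar>)) * (G * growth t))"
    \<comment> \<open>A minorant of the limiting integrand, independent of \<sigma>: - a K covers
      the window, and tl carries the trivial logarithmic bound beyond it.\<close>
    define \<psi> where "\<psi> = (\<lambda>u. - a * K u - tl u)"
    define dm where "dm = (\<lambda>u. (G * growth t) * (K u * (1 + \<bar>u\<bar>)) + a * K u)"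
    have gt: "growth t \<ge> 1" by (rule growth_ge_1)
    have [measurable]: "{u::real. \<bar>u\<bar> > H} \<in> sets borel" by measurable
    have tli: "integrable lborel tl"
      unfolding tl_def
      by (intro integrable_mult_left Bochner_Integration.integrable_bound[OF K_moment_integrable])
         (auto simp: indicator_def)
    have \<psi>i: "integrable lborel \<psi>" unfolding \<psi>_def
      by (intro Bochner_Integration.integrable_diff integrable_mult_right K_integrable tli)
    have dmi: "integrable lborel dm" unfolding dm_def
      by (intro Bochner_Integration.integrable_add integrable_mult_right K_integrable K_moment_integrable)
    have low: "- (G * growth t) * (K u * (1 + \<bar>u\<bar>)) \<le> f \<sigma> u" if \<sigma>: "1/2 < \<sigma>" "\<sigma> \<le> 3/4" for \<sigma> u
    proof -
      have "- G * growth (t + u) \<le> Im (g (Complex \<sigma> (t + u + h))) - Im (g (Complex \<sigma> (t + u - h)))"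
        using C1(2)[OF \<sigma> h_pos, of "t + u"] by (simp add: G_def growth_def)
      moreover have "G * growth (t + u) \<le> G * (growth t * (1 + \<bar>u\<bar>))"
        using growth_add G by (intro mult_left_mono) auto
      ultimately have "- (G * (growth t * (1 + \<bar>u\<bar>))) \<le> Im (g (Complex \<sigma> (t + u + h))) - Im (g (Complex \<sigma> (t + u - h)))"
        by linarith
      then have "K u * (- (G * (growth t * (1 + \<bar>u\<bar>)))) \<le> f \<sigma> u"
        unfolding f_def by (intro mult_left_mono K_nonneg)
      then show ?thesis by (simp add: mult_ac)
    qed
    have tl_bounds: "0 \<le> tl u" "tl u \<le> (G * growth t) * (K u * (1 + \<bar>u\<bar>))" for u
      using K_nonneg[of u] G gt by (auto simp: tl_def indicator_def)
    define X where "X = (\<lambda>k::nat. 1/2 + 1 / (real k + 4))"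
    have X: "1/2 < X k" "X k \<le> 3/4" for k by (auto simp: X_def field_simps)
    have X0: "X \<longlonglongrightarrow> 1/2" unfolding X_def by real_asymp
    have Xr: "filterlim X (at_right (1/2)) sequentially"
      using X0 X(1) by (intro tendsto_imp_filterlim_at_right) auto
    \<comment> \<open>There is no upper majorant uniform in \<sigma> at hand, so only the negative
      part of f - \<psi> is sent to the limit; it is dominated by dm and tends to 0 almost
      everywhere.\<close>
    have lim: "(\<lambda>k. \<integral>u. min (f (X k) u - \<psi> u) 0 \<partial>lborel) \<longlonglongrightarrow> (\<integral>u. 0 \<partial>(lborel :: real measure))"
    proof (rule integral_dominated_convergence[OF _ _ dmi])
      show "(\<lambda>u. min (f (X k) u - \<psi> u) 0) \<in> borel_measurable lborel" for k
      proof -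
        have [measurable]: "f (X k) \<in> borel_measurable lborel"
          unfolding f_def using smoothed_formula(1)[of "X k" t] X[of k] by (intro borel_measurable_integrable) auto
        have [measurable]: "\<psi> \<in> borel_measurable lborel" by (rule borel_measurable_integrable[OF \<psi>i])
        show ?thesis by measurable
      qed
      show "AE u in lborel. norm (min (f (X k) u - \<psi> u) 0) \<le> dm u" for k
      proof (intro AE_I2)
        fix u
        have "f (X k) u - \<psi> u \<ge> - dm u"
          using low[OF X(1)[of k] X(2)[of k], of u] tl_bounds[of u]
            mult_nonneg_nonneg[OF a K_nonneg[of u]] by (simp add: \<psi>_def dm_def)
        moreover have "dm u \<ge> 0" using K_nonneg[of u] a G gt by (simp add: dm_def)
        ultimately show "norm (min (f (X k) u - \<psi> u) 0) \<le> dm u" by (auto simp: min_def)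
      qed
      show "AE u in lborel. (\<lambda>k. min (f (X k) u - \<psi> u) 0) \<longlonglongrightarrow> 0"
        using AE_not_ordinate[of "t + h"] AE_not_ordinate[of "t - h"]
      proof eventually_elim
        case (elim u)
        define L where "L = K u * ((pi * S (t + u + h) + Im (Ln (Complex (-1/2) (t + u + h))))
            - (pi * S (t + u - h) + Im (Ln (Complex (-1/2) (t + u - h)))))"
        have "((\<lambda>\<sigma>. f \<sigma> u) \<longlongrightarrow> L) (at_right (1/2))"
          unfolding f_def L_def by (intro tendsto_intros Im_g_limit) (use elim in \<open>simp_all add: algebra_simps\<close>)
        then have fl: "(\<lambda>k. f (X k) u) \<longlonglongrightarrow> L" by (rule filterlim_compose[OF _ Xr])
        have "L \<ge> \<psi> u"
        proof (cases "\<bar>u\<bar> > H")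
          case True
          have "- (G * growth t) * (K u * (1 + \<bar>u\<bar>)) \<le> L"
            by (rule LIMSEQ_le_const[OF fl]) (use low[OF X] in auto)
          moreover have "tl u = (G * growth t) * (K u * (1 + \<bar>u\<bar>))" using True by (simp add: tl_def)
          moreover have "0 \<le> a * K u" using a K_nonneg by simp
          ultimately show ?thesis by (simp add: \<psi>_def)
        next
          case False
          \<comment> \<open>The two arguments from the pole are each at most pi in modulus; this
            accounts for the 2 pi subtracted in the hypothesis.\<close>
          have Lnb: "\<bar>Im (Ln (Complex (-1/2) y))\<bar> \<le> pi" for y
          proof -
            have "Complex (-1/2) y \<noteq> 0" by (simp add: complex_eq_iff)
            then show ?thesis using mpi_less_Im_Ln[of "Complex (-1/2) y"] Im_Ln_le_pi[of "Complex (-1/2) y"] by linarith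
          qed
          have "pi * (S (t + u + h) - S (t + u - h)) - 2 * pi \<ge> - a" using win[rule_format, of "t + u"] False by simp
          then have "- a \<le> (pi * S (t + u + h) + Im (Ln (Complex (-1/2) (t + u + h))))
            - (pi * S (t + u - h) + Im (Ln (Complex (-1/2) (t + u - h))))"
            using Lnb[of "t + u + h"] Lnb[of "t + u - h"] unfolding right_diff_distrib by linarith
          then have "K u * (- a) \<le> L" unfolding L_def by (intro mult_left_mono K_nonneg)
          then show ?thesis using tl_bounds(1)[of u] by (simp add: \<psi>_def mult.commute)
        qed
        then have "min (L - \<psi> u) 0 = 0" by simp
        moreover have "(\<lambda>k. min (f (X k) u - \<psi> u) 0) \<longlonglongrightarrow> min (L - \<psi> u) 0"
          by (intro tendsto_intros fl)
        ultimately show ?case by simp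
      qed
    qed auto
    have fi: "integrable lborel (f (X k))" and fint: "(\<integral>u. f (X k) u \<partial>lborel) = 2 * Pcos (X k) t - 2 * Dcos (X k) t" for k
      unfolding f_def using smoothed_formula[of "X k" t] X[of k] by auto
    have "(\<integral>u. \<psi> u \<partial>lborel) + (\<integral>u. min (f (X k) u - \<psi> u) 0 \<partial>lborel) \<le> 2 * Pcos (X k) t - 2 * Dcos (X k) t" for k
    proof -
      have mi: "integrable lborel (\<lambda>u. min (f (X k) u - \<psi> u) 0)"
        by (intro integrable_min Bochner_Integration.integrable_diff fi \<psi>i) auto
      have "(\<integral>u. \<psi> u \<partial>lborel) + (\<integral>u. min (f (X k) u - \<psi> u) 0 \<partial>lborel) = (\<integral>u. \<psi> u + min (f (X k) u - \<psi> u) 0 \<partial>lborel)"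
        by (rule Bochner_Integration.integral_add[OF \<psi>i mi, symmetric])
      also have "\<dots> \<le> (\<integral>u. f (X k) u \<partial>lborel)"
        by (rule integral_mono[OF Bochner_Integration.integrable_add[OF \<psi>i mi] fi]) (auto simp: min_def)
      finally show ?thesis by (simp add: fint)
    qed
    moreover have "(\<lambda>k. (\<integral>u. \<psi> u \<partial>lborel) + (\<integral>u. min (f (X k) u - \<psi> u) 0 \<partial>lborel)) \<longlonglongrightarrow> (\<integral>u. \<psi> u \<partial>lborel) + 0"
      using lim by (intro tendsto_intros) simp
    moreover have "(\<lambda>k. 2 * Pcos (X k) t - 2 * Dcos (X k) t) \<longlonglongrightarrow> 2 * Pcos (1/2) t - 2 * Dcos (1/2) t"
      by (intro tendsto_intros filterlim_compose[OF Pcos_tendsto Xr] filterlim_compose[OF Dcos_tendsto Xr])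
    ultimately have "(\<integral>u. \<psi> u \<partial>lborel) + 0 \<le> 2 * Pcos (1/2) t - 2 * Dcos (1/2) t"
      by (intro LIMSEQ_le) auto
    moreover have "(\<integral>u. \<psi> u \<partial>lborel) = - a * Kh 0 - (\<integral>u. tl u \<partial>lborel)"
    proof -
      have "(\<integral>u. \<psi> u \<partial>lborel) = (\<integral>u. - a * K u \<partial>lborel) - (\<integral>u. tl u \<partial>lborel)"
        unfolding \<psi>_def by (rule Bochner_Integration.integral_diff[OF integrable_mult_right[OF K_integrable] tli])
      also have "(\<integral>u. - a * K u \<partial>lborel) = - a * Kh 0" unfolding integral_mult_right_zero integral_K ..
      finally show ?thesis .
    qed
    moreover have "(\<integral>u. tl u \<partial>lborel) \<le> E * growth t * exp (- (c / 2) * exp (pi * H))"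
    proof -
      define Z where "Z = exp (- (c / 2) * exp (pi * H))"
      have "(\<integral>u. tl u \<partial>lborel) \<le> (\<integral>u. (G * growth t * (B * Z)) * (exp (- (c / 2) * exp (pi * \<bar>u\<bar>)) * (1 + \<bar>u\<bar>)) \<partial>lborel)"
      proof (rule integral_mono[OF tli integrable_mult_right[OF Ji]])
        fix u :: real
        show "tl u \<le> (G * growth t * (B * Z)) * (exp (- (c / 2) * exp (pi * \<bar>u\<bar>)) * (1 + \<bar>u\<bar>))"
        proof (cases "\<bar>u\<bar> > H")
          case True
          \<comment> \<open>Half of the exponent yields the small factor Z for |u| > H; the other
            half keeps the integral J finite.\<close>
          have "exp (- c * exp (pi * \<bar>u\<bar>)) = exp (- (c / 2) * exp (pi * \<bar>u\<bar>)) * exp (- (c / 2) * exp (pi * \<bar>u\<bar>))"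
            unfolding exp_add[symmetric] by simp
          also have "\<dots> \<le> Z * exp (- (c / 2) * exp (pi * \<bar>u\<bar>))"
            unfolding Z_def using True c_pos by (intro mult_right_mono) auto
          finally have "B * exp (- c * exp (pi * \<bar>u\<bar>)) \<le> B * (Z * exp (- (c / 2) * exp (pi * \<bar>u\<bar>)))"
            using B_nonneg by (intro mult_left_mono) auto
          then have "K u \<le> B * (Z * exp (- (c / 2) * exp (pi * \<bar>u\<bar>)))" using K_decay[of u] by linarith
          then have "(G * growth t) * (K u * (1 + \<bar>u\<bar>)) \<le> (G * growth t) * (B * (Z * exp (- (c / 2) * exp (pi * \<bar>u\<bar>))) * (1 + \<bar>u\<bar>))"
            using G gt by (intro mult_left_mono mult_right_mono) auto
          then show ?thesis using True by (simp add: tl_def mult_ac)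
        next
          case False
          then show ?thesis using G gt B_nonneg by (simp add: tl_def Z_def)
        qed
      qed
      also have "\<dots> = (G * growth t * (B * Z)) * J" unfolding J_def by (rule integral_mult_right_zero)
      also have "\<dots> = (G * B * J) * (growth t * Z)" by simp
      also have "\<dots> \<le> E * (growth t * Z)" using gt by (intro mult_right_mono) (auto simp: E_def Z_def)
      finally show ?thesis by (simp add: Z_def)
    qed
    ultimately show ?thesis by linarith
  qed
  show ?thesis by (rule that[OF E main])
qed

text \<open>At \<sigma> = 1/2 the decay of \<open>Kh\<close> balances exp (x / 2) and leaves an
  integrable weight, so the Riemann-Lebesgue lemma applies.\<close>

lemma Pcos_vanishes: "((\<lambda>t. Pcos (1/2) t) \<longlongrightarrow> 0) at_top"
  unfolding Pcos_def
proof (rule Riemann_Lebesgue_cos[of _ "h * C"])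
  show "(\<lambda>x. pker x * exp ((1 - 1/2) * x)) \<in> borel_measurable borel" by measurable
  show "\<bar>pker x * exp ((1 - 1/2) * x)\<bar> \<le> h * C / (1 + x\<^sup>2)" for x
    using norm_pker_bound[of "1/2" x] by (simp add: abs_mult)
  fix x :: real assume x: "x \<noteq> 0"
  have k: "isCont (\<lambda>x. wsinc h x * Kh x * exp ((1 - 1/2) * x)) x"
    using wsinc_continuous[of UNIV h] Kh_continuous
    by (intro continuous_intros) (auto simp: continuous_on_eq_continuous_at)
  show "isCont (\<lambda>x. pker x * exp ((1 - 1/2) * x)) x"
  proof (cases "x > 0")
    case True
    have "\<forall>\<^sub>F y in nhds x. pker y * exp ((1 - 1/2) * y) = wsinc h y * Kh y * exp ((1 - 1/2) * y)"
    proof -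
      have "\<forall>\<^sub>F y in nhds x. y \<in> {0<..}" by (rule eventually_nhds_in_open) (use True in auto)
      then show ?thesis by eventually_elim (simp add: pker_def)
    qed
    then show ?thesis using k by (subst isCont_cong)
  next
    case False
    have "\<forall>\<^sub>F y in nhds x. pker y * exp ((1 - 1/2) * y) = 0"
    proof -
      have "\<forall>\<^sub>F y in nhds x. y \<in> {..<0}" by (rule eventually_nhds_in_open) (use False x in auto)
      then show ?thesis by eventually_elim (simp add: pker_def)
    qed
    then show ?thesis by (rule isCont_cong[THEN iffD2]) simp
  qed
qed

text \<open>Beyond the first N terms the summable majorant costs at most 2 * \<delta> / 4; on the
  first N terms an almost period costs at most V \<epsilon> \<le> \<delta> / 2.\<close>

lemma Dcos_almost_period:
  assumes \<delta>: "\<delta> > 0"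
  obtains l where "l \<ge> 0" "\<And>T. \<exists>t. \<bar>t - T\<bar> \<le> l \<and> Dcos (1/2) t \<ge> Dcos (1/2) 0 - \<delta>"
proof -
  define v where "v = (\<lambda>n. C * (1 / (real (Suc n) * (1 + (lam n)\<^sup>2))))"
  have sv: "summable v" unfolding v_def by (rule summable_bound)
  have v0: "v n \<ge> 0" for n using C_pos by (simp add: v_def)
  define V where "V = suminf v"
  have V: "V \<ge> 0" unfolding V_def by (rule suminf_nonneg[OF sv v0])
  obtain N where N: "norm (\<Sum>n. v (n + N)) < \<delta> / 4"
    using suminf_exist_split[OF _ sv, of "\<delta> / 4"] \<delta> by auto
  define \<epsilon> where "\<epsilon> = \<delta> / (2 * (V + 1))"
  have \<epsilon>: "\<epsilon> > 0" using \<delta> V by (simp add: \<epsilon>_def)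
  obtain l where l: "l \<ge> 0" "\<And>T. \<exists>t. \<bar>t - T\<bar> \<le> l \<and> (\<forall>n<N. cos (t * lam n) \<ge> 1 - \<epsilon>)"
    by (rule almost_periods[OF \<epsilon>, where \<omega> = "\<lambda>n. lam n" and N = N], rule that)
  have "\<exists>t. \<bar>t - T\<bar> \<le> l \<and> Dcos (1/2) t \<ge> Dcos (1/2) 0 - \<delta>" for T
  proof -
    obtain t where t: "\<bar>t - T\<bar> \<le> l" "\<And>n. n < N \<Longrightarrow> cos (t * lam n) \<ge> 1 - \<epsilon>" using l(2) by blast
    define p where "p = (\<lambda>n. bcoef n * exp (- (1/2) * lam n))"
    have pv: "\<bar>p n\<bar> \<le> v n" for n using bcoef_bound[of "1/2" n] by (simp add: p_def v_def abs_mult del: of_nat_Suc)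
    have sp: "summable (\<lambda>n. p n * cos (t * lam n))" for t
    proof (rule summable_comparison_test'[OF sv, of 0])
      fix n
      have "norm (p n * cos (t * lam n)) \<le> \<bar>p n\<bar> * 1"
        unfolding real_norm_def abs_mult by (intro mult_left_mono) auto
      then show "norm (p n * cos (t * lam n)) \<le> v n" using pv[of n] by linarith
    qed
    define d where "d = (\<lambda>n. p n * (1 - cos (t * lam n)))"
    have dv: "\<bar>d n\<bar> \<le> 2 * v n" for n
    proof -
      have "\<bar>1 - cos (t * lam n)\<bar> \<le> 2" using cos_ge_minus_one[of "t * lam n"] by (simp add: abs_le_iff)
      then have "\<bar>p n\<bar> * \<bar>1 - cos (t * lam n)\<bar> \<le> v n * 2" using pv[of n] v0[of n] by (intro mult_mono) auto
      then show ?thesis by (simp add: d_def abs_mult)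
    qed
    have sd: "summable d" by (rule summable_comparison_test'[OF summable_mult[OF sv, of 2], of 0]) (use dv in auto)
    have "Dcos (1/2) 0 - Dcos (1/2) t = (\<Sum>n. d n)"
    proof -
      have D: "Dcos (1/2) t' = (\<Sum>n. p n * cos (t' * lam n))" for t' unfolding Dcos_def p_def ..
      have "Dcos (1/2) 0 - Dcos (1/2) t = (\<Sum>n. p n * cos (0 * lam n) - p n * cos (t * lam n))"
        unfolding D by (rule suminf_diff[OF sp sp])
      also have "(\<lambda>n. p n * cos (0 * lam n) - p n * cos (t * lam n)) = d"
        unfolding d_def by (simp add: right_diff_distrib del: of_nat_Suc)
      finally show ?thesis .
    qed
    also have "\<dots> = (\<Sum>n. d (n + N)) + (\<Sum>n<N. d n)" by (rule suminf_split_initial_segment[OF sd])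
    also have "\<dots> \<le> \<delta> / 2 + \<delta> / 2"
    proof (rule add_mono)
      have "(\<Sum>n. d (n + N)) \<le> (\<Sum>n. 2 * v (n + N))"
      proof (rule suminf_le)
        show "d (n + N) \<le> 2 * v (n + N)" for n using dv[of "n + N"] by linarith
        show "summable (\<lambda>n. d (n + N))" using sd by (subst summable_iff_shift)
        show "summable (\<lambda>n. 2 * v (n + N))" using sv by (intro summable_mult) (subst summable_iff_shift)
      qed
      also have "\<dots> = 2 * (\<Sum>n. v (n + N))" by (rule suminf_mult) (simp add: summable_iff_shift sv)
      finally show "(\<Sum>n. d (n + N)) \<le> \<delta> / 2" using N by simp
      have "(\<Sum>n<N. d n) \<le> (\<Sum>n<N. v n * \<epsilon>)"
      proof (rule sum_mono)
        fix n assume "n \<in> {..<N}"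
        then have c: "0 \<le> 1 - cos (t * lam n)" "1 - cos (t * lam n) \<le> \<epsilon>" using t(2)[of n] by auto
        have "d n \<le> \<bar>p n\<bar> * (1 - cos (t * lam n))" unfolding d_def by (intro mult_right_mono c(1)) simp
        also have "\<dots> \<le> v n * \<epsilon>" using pv[of n] v0[of n] c by (intro mult_mono) auto
        finally show "d n \<le> v n * \<epsilon>" .
      qed
      also have "\<dots> = (\<Sum>n<N. v n) * \<epsilon>" by (rule sum_distrib_right[symmetric])
      also have "\<dots> \<le> V * \<epsilon>" unfolding V_def using \<epsilon> sum_le_suminf[OF sv, of "{..<N}"] v0 by (intro mult_right_mono) auto
      also have "\<dots> \<le> \<delta> / 2" using V \<delta> by (simp add: \<epsilon>_def field_simps)
      finally show "(\<Sum>n<N. d n) \<le> \<delta> / 2" .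
    qed
    finally show ?thesis using t(1) by (intro exI[of _ t]) auto
  qed
  then show ?thesis using that l(1) by blast
qed

end

text \<open>An infimum in \<open>ereal\<close> is strictly below - A exactly when some increment in
  the window is, so attainment of the minimum is not an issue.\<close>

theorem theorem4:
  assumes RH: "riemann_hypothesis"
  shows "\<forall>A::real. A \<ge> 1 \<longrightarrow>
    (\<exists>T\<^sub>0 c\<^sub>0 h :: real. h > 0 \<and>
      (\<forall>T\<ge>T\<^sub>0. let H = 1 / pi * ln (ln (ln T)) + c\<^sub>0 in
        (INF t \<in> {t. \<bar>t - T\<bar> \<le> H}. ereal (S (t + h) - S (t - h))) < ereal (- A)))"
proof (intro allI impI)
  fix A :: real assume A: "A \<ge> 1"
  \<comment> \<open>a is A on the scale of the argument pi S, plus the 2 pi lost to the pole term in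
    \<open>critical_line_inequality\<close>.\<close>
  define a where "a = pi * A + 2 * pi"
  have a: "a > 0" using A by (simp add: a_def add_pos_pos)
  \<comment> \<open>The factor 4 compensates for Kh \<ge> Kh 0 / 4 on the first N frequencies; the
    added 1 becomes a surplus Kh 0 that absorbs the error terms.\<close>
  obtain N where N: "(\<Sum>n<N. lcoef (Suc n) * exp (- ln (real (Suc n)) / 2) * (ln (real (Suc n)) / (1 + (ln (real (Suc n)))\<^sup>2))) > 4 * (a + 1)"
    using weighted_lcoef_sum_unbounded by blast
  have "ln (real (Suc N)) \<ge> 0" by simp
  then obtain K Kh B c C where ker: "kernel K Kh B c C"
    and Kh_low: "\<And>x. 0 \<le> x \<Longrightarrow> x \<le> ln (real (Suc N)) \<Longrightarrow> Kh x \<ge> Kh 0 / 4"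
    using kernel_exists by blast
  interpret kernel K Kh B c C by (rule ker)
  obtain g where lz: "log_zreg g" using log_zreg_exists[OF RH] by blast
  define b where "b = (\<lambda>n. lcoef (Suc n) * exp (- ln (real (Suc n)) / 2) * Kh (ln (real (Suc n))))"
  have b0: "b n \<ge> 0" for n using lcoef_nonneg Kh_nonneg by (simp add: b_def)
  have bs: "summable b"
  proof (rule summable_comparison_test'[OF summable_mult[OF summable_inverse_n_ln_square, of C], of 0])
    fix n
    define y where "y = ln (real (Suc n))"
    have "norm (b n) = lcoef (Suc n) * (Kh y * exp (- (1/2) * y))" using b0[of n] by (simp add: b_def y_def)
    also have "\<dots> \<le> 1 * (C * exp (- y) / (1 + y\<^sup>2))"
      using lcoef_le_1 Kh_nonneg[of y] by (intro mult_mono Kh_exp_bound) (auto simp: y_def)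
    also have "exp (- y) = 1 / real (Suc n)" unfolding y_def by (simp add: exp_minus inverse_eq_divide del: of_nat_Suc)
    finally show "norm (b n) \<le> C * (1 / (real (Suc n) * (1 + (ln (real (Suc n)))\<^sup>2)))" by (simp add: y_def)
  qed
  have "(a + 1) * Kh 0 = (4 * (a + 1)) * (Kh 0 / 4)" by simp
  also have "\<dots> < (\<Sum>n<N. lcoef (Suc n) * exp (- ln (real (Suc n)) / 2) * (ln (real (Suc n)) / (1 + (ln (real (Suc n)))\<^sup>2))) * (Kh 0 / 4)"
    using N Kh_0 by (intro mult_strict_right_mono) auto
  also have "\<dots> \<le> (\<Sum>n<N. b n * (ln (real (Suc n)) / (1 + (ln (real (Suc n)))\<^sup>2)))"
    unfolding sum_distrib_right
  proof (rule sum_mono)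
    fix n assume "n \<in> {..<N}"
    then have "Kh (ln (real (Suc n))) \<ge> Kh 0 / 4" by (intro Kh_low) auto
    then have "(lcoef (Suc n) * exp (- ln (real (Suc n)) / 2) * (ln (real (Suc n)) / (1 + (ln (real (Suc n)))\<^sup>2))) * (Kh 0 / 4)
        \<le> (lcoef (Suc n) * exp (- ln (real (Suc n)) / 2) * (ln (real (Suc n)) / (1 + (ln (real (Suc n)))\<^sup>2))) * Kh (ln (real (Suc n)))"
      using lcoef_nonneg by (intro mult_left_mono) auto
    then show "lcoef (Suc n) * exp (- ln (real (Suc n)) / 2) * (ln (real (Suc n)) / (1 + (ln (real (Suc n)))\<^sup>2)) * (Kh 0 / 4)
        \<le> b n * (ln (real (Suc n)) / (1 + (ln (real (Suc n)))\<^sup>2))" by (simp add: b_def mult_ac del: of_nat_Suc)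
  qed
  finally have big: "(\<Sum>n<N. b n * (ln (real (Suc n)) / (1 + (ln (real (Suc n)))\<^sup>2))) > (a + 1) * Kh 0" .
  have "\<exists>y>0. (\<Sum>n. b n * sin (ln (real (Suc n)) * y)) > (a + 1) * Kh 0"
    by (rule exists_shift_large_sine_sum[OF b0 bs _ _ big]) (use a Kh_0 in auto)
  then obtain h where h: "h > 0" "(\<Sum>n. b n * sin (ln (real (Suc n)) * h)) > (a + 1) * Kh 0" by blast
  interpret smoothed K Kh B c C g h using ker lz h(1) by (intro smoothed.intro smoothed_axioms.intro)
  have "Dcos (1/2) 0 = (\<Sum>n. b n * sin (ln (real (Suc n)) * h))"
    unfolding Dcos_def bcoef_def b_def by (simp add: mult_ac del: of_nat_Suc)
  then have D0: "Dcos (1/2) 0 > a * Kh 0 + Kh 0" using h(2) by (simp add: distrib_right)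
  obtain E where E: "E > 0" "\<And>t H a. a \<ge> 0 \<Longrightarrow>
     (\<forall>\<tau>. \<bar>\<tau> - t\<bar> \<le> H \<longrightarrow> pi * (S (\<tau> + h) - S (\<tau> - h)) - 2 * pi \<ge> - a) \<Longrightarrow>
     - a * Kh 0 - E * growth t * exp (- (c / 2) * exp (pi * H)) \<le> 2 * Pcos (1/2) t - 2 * Dcos (1/2) t"
    by (rule critical_line_inequality, rule that)
  have Kh4: "Kh 0 / 4 > 0" using Kh_0 by simp
  obtain l where l: "l \<ge> 0" "\<And>T. \<exists>t. \<bar>t - T\<bar> \<le> l \<and> Dcos (1/2) t \<ge> Dcos (1/2) 0 - Kh 0 / 4"
    by (rule Dcos_almost_period[OF Kh4], rule that)
  have "\<forall>\<^sub>F t in at_top. Pcos (1/2) t < Kh 0 / 4" by (rule order_tendstoD(2)[OF Pcos_vanishes Kh4])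
  then obtain T1 where T1: "\<And>t. t \<ge> T1 \<Longrightarrow> Pcos (1/2) t < Kh 0 / 4" by (auto simp: eventually_at_top_linorder)
  \<comment> \<open>l allows for the distance from T to the almost period. The other summand makes
    exp (pi H) = (4 / c) log log T, so that exp (- (c / 2) exp (pi H)) is exactly (log
    T)^(-2).\<close>
  define c0 where "c0 = l + ln (4 / c) / pi"
  \<comment> \<open>This bounds growth t by log (T^2) = 2 log T for every t within l of T.\<close>
  have "\<forall>\<^sub>F T in at_top. T + l + h + 3 \<le> T\<^sup>2" by real_asymp
  moreover have "\<forall>\<^sub>F T in at_top. 2 * E / ln T < Kh 0 / 4"
  proof (rule order_tendstoD(2)[OF _ Kh4])
    show "((\<lambda>T. 2 * E / ln T) \<longlongrightarrow> 0) at_top" by real_asymp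
  qed
  moreover have "\<forall>\<^sub>F T in at_top. ln (ln T) > (0::real)" by real_asymp
  moreover have "\<forall>\<^sub>F T in at_top. T \<ge> T1 + l" by (rule eventually_ge_at_top)
  moreover have "\<forall>\<^sub>F T in at_top. T > (1::real)" by (rule eventually_gt_at_top)
  moreover have "\<forall>\<^sub>F T in at_top. ln T > (0::real)" by real_asymp
  ultimately have "\<forall>\<^sub>F T in at_top. T + l + h + 3 \<le> T\<^sup>2 \<and> 2 * E / ln T < Kh 0 / 4 \<and> ln (ln T) > 0 \<and> T \<ge> T1 + l \<and> T > 1 \<and> ln T > 0"
    by eventually_elim simp
  then obtain T0 where T0: "\<And>T. T \<ge> T0 \<Longrightarrow> T + l + h + 3 \<le> T\<^sup>2 \<and> 2 * E / ln T < Kh 0 / 4 \<and> ln (ln T) > 0 \<and> T \<ge> T1 + l \<and> T > 1 \<and> ln T > 0"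
    by (auto simp: eventually_at_top_linorder)
  have "(INF t \<in> {t. \<bar>t - T\<bar> \<le> 1 / pi * ln (ln (ln T)) + c0}. ereal (S (t + h) - S (t - h))) < ereal (- A)"
    if T: "T \<ge> T0" for T
  proof (rule ccontr)
    assume "\<not> ?thesis"
    then have S_low: "S (t + h) - S (t - h) \<ge> - A" if "\<bar>t - T\<bar> \<le> 1 / pi * ln (ln (ln T)) + c0" for t
      using that by (auto simp: INF_less_iff not_less)
    note TT = T0[OF T]
    obtain t where t: "\<bar>t - T\<bar> \<le> l" "Dcos (1/2) t \<ge> Dcos (1/2) 0 - Kh 0 / 4" using l(2) by blast
    define H where "H = 1 / pi * ln (ln (ln T)) + ln (4 / c) / pi"
    have win: "\<forall>\<tau>. \<bar>\<tau> - t\<bar> \<le> H \<longrightarrow> pi * (S (\<tau> + h) - S (\<tau> - h)) - 2 * pi \<ge> - a"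
    proof (intro allI impI)
      fix \<tau> assume "\<bar>\<tau> - t\<bar> \<le> H"
      then have "\<bar>\<tau> - T\<bar> \<le> 1 / pi * ln (ln (ln T)) + c0" using t(1) unfolding H_def c0_def by linarith
      then have "S (\<tau> + h) - S (\<tau> - h) \<ge> - A" by (rule S_low)
      then have "pi * (- A) \<le> pi * (S (\<tau> + h) - S (\<tau> - h))" by (intro mult_left_mono) auto
      then show "pi * (S (\<tau> + h) - S (\<tau> - h)) - 2 * pi \<ge> - a" by (simp add: a_def)
    qed
    have "- a * Kh 0 - E * growth t * exp (- (c / 2) * exp (pi * H)) \<le> 2 * Pcos (1/2) t - 2 * Dcos (1/2) t"
      by (rule E(2)[OF _ win]) (use a in simp)
    moreover have "E * growth t * exp (- (c / 2) * exp (pi * H)) < Kh 0 / 4"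
    proof -
      have "pi * H = ln (ln (ln T)) + ln (4 / c)" by (simp add: H_def distrib_left)
      then have "exp (pi * H) = ln (ln T) * (4 / c)" using TT c_pos by (simp add: exp_add)
      then have "- (c / 2) * exp (pi * H) = - ln (ln T) + - ln (ln T)" using c_pos by simp
      then have e: "exp (- (c / 2) * exp (pi * H)) = 1 / ln T * (1 / ln T)"
        using TT unfolding \<open>- (c / 2) * exp (pi * H) = _\<close> exp_add exp_minus by (simp add: inverse_eq_divide)
      have "growth t \<le> 2 * ln T"
      proof -
        have "\<bar>t\<bar> + h + 3 \<le> T\<^sup>2" using t(1) TT by linarith
        then have "growth t \<le> ln (T\<^sup>2)" unfolding growth_def using h(1) TT by (subst ln_le_cancel_iff) auto
        then show ?thesis using TT by (simp add: ln_realpow)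
      qed
      then have "E * growth t * exp (- (c / 2) * exp (pi * H)) \<le> E * (2 * ln T) * (1 / ln T * (1 / ln T))"
        unfolding e using E(1) TT by (intro mult_right_mono mult_left_mono) auto
      also have "\<dots> = 2 * E / ln T" using TT by simp
      finally show ?thesis using TT by linarith
    qed
    moreover have "Pcos (1/2) t < Kh 0 / 4" using T1[of t] t(1) TT by linarith
    moreover have "a * Kh 0 \<ge> 0" using a Kh_0 by simp
    \<comment> \<open>With k = Kh 0 the bounds combine to - a k - k/4 < 2 (k/4) - 2 (a k + k - k/4),
      that is, a k < - 3k/4.\<close>
    ultimately show False using D0 t(2) Kh_0 by simp
  qed
  then show "\<exists>T\<^sub>0 c\<^sub>0 h :: real. h > 0 \<and>
      (\<forall>T\<ge>T\<^sub>0. let H = 1 / pi * ln (ln (ln T)) + c\<^sub>0 in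
        (INF t \<in> {t. \<bar>t - T\<bar> \<le> H}. ereal (S (t + h) - S (t - h))) < ereal (- A))"
    unfolding Let_def using h(1) by blast
qed

end
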